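(* Let $\mathbb{K}$ be a field, let $s \geq 1$ be an integer, let $t_1,\ldots,t_s$ be positive integers, and let $G = G(t_1,\ldots,t_s)$ be the graph consisting of $s$ odd cycles of lengths $2t_1+1,\ldots,2t_s+1$ all sharing one common vertex. Then the toric ideal $I_G$ of $G$ is geometrically vertex decomposable.
   Context: The graph $G(t_1,\ldots,t_s)$. It is the finite simple graph with a center vertex $v$ and, for each $1 \le i \le s$, further vertices $v_{i,1},\ldots,v_{i,2t_i}$ (all vertices distinct), and edges $e_{i,1}=\{v,v_{i,1}\}$, $e_{i,j}=\{v_{i,j-1},v_{i,j}\}$ for $2\le j\le 2t_i$, and $e_{i,2t_i+1}=\{v_{i,2t_i},v\}$. Thus it consists of $s$ odd cycles of lengths $2t_i+1$ whose only common vertex is $v$. Toric ideal. For a finite simple graph $G$ with vertices $x_1,\ldots,x_n$ and edges $e_1,\ldots,e_m$, the toric ideal $I_G$ is the kernel of the $\mathbb{K}$-algebra homomorphism $\varphi:\mathbb{K}[e_1,\ldots,e_m]\to\mathbb{K}[x_1,\ldots,x_n]$ given by $\varphi(e_i)=x_jx_k$ if $e_i=\{x_j,x_k\}$. It is an ideal of $\mathbb{K}[e_1,\ldots,e_m]$. Initial $y$-forms. Let $R=\mathbb{K}[x_1,\ldots,x_n]$ be a polynomial ring and $y$ one of its variables. Write $f\in R$, $f \neq 0$, as $f=\sum_{i=0}^d\alpha_iy^i$ with $\alpha_i$ polynomials in the variables other than $y$ and $\alpha_d\neq 0$; the initial $y$-form of $f$ is $\mathrm{in}_y(f)=\alpha_dy^d$.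 For an ideal $I$, $\mathrm{in}_y(I)=\langle \mathrm{in}_y(f)\mid f\in I\rangle$. A monomial order $<$ is $y$-compatible if $\mathrm{in}_<(f)=\mathrm{in}_<(\mathrm{in}_y(f))$ for all $f\in R$. The ideals $\mathcal{C}_{y,I}$ and $\mathcal{N}_{y,I}$. Fix a $y$-compatible monomial order $<$ and a Gröbner basis $\{g_1,\ldots,g_t\}$ of $I$ with respect to $<$. Write $g_i=q_iy^{d_i}+r_i$ with $\mathrm{in}_y(g_i)=q_iy^{d_i}$ (so $y$ divides no term of $q_i$ and $y^{d_i}$ divides no term of $r_i$). Define $\mathcal{C}_{y,I}=\langle q_1,\ldots,q_t\rangle$ and $\mathcal{N}_{y,I}=\langle q_i\mid d_i=0\rangle$. Geometrically vertex decomposable ideals (recursive definition). An ideal $I$ of $R=\mathbb{K}[x_1,\ldots,x_n]$ is geometrically vertex decomposable if $I$ is unmixed (all associated primes of $I$ have the same height) and either (1) $I=\langle 1\rangle$, or $I$ is generated by a (possibly empty) subset of the variables; or (2) there exist a variable $y$ of $R$ and a $y$-compatible monomial order such that $\mathrm{in}_y(I)=\mathcal{C}_{y,I}\cap(\mathcal{N}_{y,I}+\langle y\rangle)$ and the contractions of $\mathcal{C}_{y,I}$ and $\mathcal{N}_{y,I}$ to $\mathbb{K}[x_1,\ldots,\hat{y},\ldots,x_n]$ (the polynomial ring in the variables other than $y$) are geometrically vertex decomposable. *)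

theory Defs
  imports
    "HOL-Algebra.QuotRing"
    "HOL-Library.Poly_Mapping"
    "HOL-Library.Extended_Nat"
begin

section \<open>Multivariate polynomials with variables in a given set\<close>

text \<open>A monomial is a finitely supported exponent vector, and a polynomial a finitely supported
  family of coefficients; the product of \<^theory>\<open>HOL-Library.Poly_Mapping\<close> is convolution.\<close>

type_synonym 'v monom = "'v \<Rightarrow>\<^sub>0 nat"

type_synonym ('v, 'k) mpoly = "'v monom \<Rightarrow>\<^sub>0 'k"

definition monomials :: "'v set \<Rightarrow> 'v monom set" where
  "monomials V = {m. Poly_Mapping.keys m \<subseteq> V}"

text \<open>The polynomial ring $K[V]$; it is embedded in $K[W]$ for \<open>V \<subseteq> W\<close>.\<close>

definition poly_ring :: "'v set \<Rightarrow> ('v, 'k::field) mpoly ring" where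
  "poly_ring V =
     \<lparr>carrier = {p. Poly_Mapping.keys p \<subseteq> monomials V},
      mult = (*), one = 1, zero = 0, add = (+)\<rparr>"

definition Const :: "'k::field \<Rightarrow> ('v, 'k) mpoly" where
  "Const a = Poly_Mapping.single 0 a"

definition Var :: "'v \<Rightarrow> ('v, 'k::field) mpoly" where
  "Var x = Poly_Mapping.single (Poly_Mapping.single x 1) 1"

definition substitute ::
    "('v \<Rightarrow> ('w, 'k::field) mpoly) \<Rightarrow> ('v, 'k) mpoly \<Rightarrow> ('w, 'k) mpoly" where
  "substitute h p =
     (\<Sum>m\<in>Poly_Mapping.keys p. Const (Poly_Mapping.lookup p m) *
        (\<Prod>x\<in>Poly_Mapping.keys m. h x ^ Poly_Mapping.lookup m x))"

section \<open>Unmixed ideals\<close>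

definition assoc_primes :: "('a, 'b) ring_scheme \<Rightarrow> 'a set \<Rightarrow> 'a set set" where
  "assoc_primes R I =
     {P. primeideal P R \<and> (\<exists>f\<in>carrier R. P = {g \<in> carrier R. g \<otimes>\<^bsub>R\<^esub> f \<in> I})}"

definition height :: "('a, 'b) ring_scheme \<Rightarrow> 'a set \<Rightarrow> enat" where
  "height R P = Sup {enat n | n. \<exists>c :: nat \<Rightarrow> 'a set.
     (\<forall>i\<le>n. primeideal (c i) R) \<and> (\<forall>i<n. c i \<subset> c (Suc i)) \<and> c n = P}"

definition unmixed :: "('a, 'b) ring_scheme \<Rightarrow> 'a set \<Rightarrow> bool" where
  "unmixed R I \<longleftrightarrow>
     (\<forall>P\<in>assoc_primes R I. \<forall>Q\<in>assoc_primes R I. height R P = height R Q)"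

section \<open>Monomial orders and Groebner bases\<close>

text \<open>\<open>(a, b) \<in> r\<close> means that \<open>a\<close> is at most \<open>b\<close>.\<close>

definition monomial_order :: "'v set \<Rightarrow> 'v monom rel \<Rightarrow> bool" where
  "monomial_order V r \<longleftrightarrow>
     linear_order_on (monomials V) r \<and>
     (\<forall>a\<in>monomials V. (0, a) \<in> r) \<and>
     (\<forall>a\<in>monomials V. \<forall>b\<in>monomials V. \<forall>c\<in>monomials V.
        (a, b) \<in> r \<longrightarrow> (a + c, b + c) \<in> r)"

definition lead_monom :: "'v monom rel \<Rightarrow> ('v, 'k::field) mpoly \<Rightarrow> 'v monom" where
  "lead_monom r f =
     (THE m. m \<in> Poly_Mapping.keys f \<and> (\<forall>m'\<in>Poly_Mapping.keys f. (m', m) \<in> r))"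

text \<open>The initial term of \<open>f\<close>, coefficient included; it is \<open>0\<close> for \<open>f = 0\<close>, whatever the value
  of \<open>lead_monom r 0\<close>.\<close>

definition initial_term :: "'v monom rel \<Rightarrow> ('v, 'k::field) mpoly \<Rightarrow> ('v, 'k) mpoly" where
  "initial_term r f =
     Poly_Mapping.single (lead_monom r f) (Poly_Mapping.lookup f (lead_monom r f))"

definition groebner_basis ::
    "'v set \<Rightarrow> 'v monom rel \<Rightarrow> ('v, 'k::field) mpoly set \<Rightarrow> ('v, 'k) mpoly set \<Rightarrow> bool" where
  "groebner_basis V r I G \<longleftrightarrow>
     finite G \<and> G \<subseteq> I \<and> 0 \<notin> G \<and>
     Idl\<^bsub>poly_ring V\<^esub> (initial_term r ` G) = Idl\<^bsub>poly_ring V\<^esub> (initial_term r ` (I - {0}))"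

section \<open>Initial y-forms and geometric vertex decomposition\<close>

definition y_degree :: "'v \<Rightarrow> ('v, 'k::field) mpoly \<Rightarrow> nat" where
  "y_degree y f = Max ((\<lambda>m. Poly_Mapping.lookup m y) ` Poly_Mapping.keys f)"

text \<open>The coefficient $\alpha_i$ in $f = \sum_i \alpha_i y^i$, a polynomial in the other
  variables.\<close>

definition y_coeff :: "'v \<Rightarrow> nat \<Rightarrow> ('v, 'k::field) mpoly \<Rightarrow> ('v, 'k) mpoly" where
  "y_coeff y i f =
     (\<Sum>m\<in>{m \<in> Poly_Mapping.keys f. Poly_Mapping.lookup m y = i}.
        Poly_Mapping.single (m - Poly_Mapping.single y i) (Poly_Mapping.lookup f m))"

definition y_lead_coeff :: "'v \<Rightarrow> ('v, 'k::field) mpoly \<Rightarrow> ('v, 'k) mpoly" where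
  "y_lead_coeff y f = y_coeff y (y_degree y f) f"

definition initial_y_form :: "'v \<Rightarrow> ('v, 'k::field) mpoly \<Rightarrow> ('v, 'k) mpoly" where
  "initial_y_form y f = y_lead_coeff y f * Var y ^ y_degree y f"

definition initial_y_ideal ::
    "'v set \<Rightarrow> 'v \<Rightarrow> ('v, 'k::field) mpoly set \<Rightarrow> ('v, 'k) mpoly set" where
  "initial_y_ideal V y I = Idl\<^bsub>poly_ring V\<^esub> (initial_y_form y ` (I - {0}))"

text \<open>The type \<open>'k\<close> of coefficients does not occur in \<open>V\<close>, \<open>y\<close> and \<open>r\<close>, so that it is passed
  as an extra argument.\<close>

definition y_compatible :: "'k::field itself \<Rightarrow> 'v set \<Rightarrow> 'v \<Rightarrow> 'v monom rel \<Rightarrow> bool" where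
  "y_compatible _ V y r \<longleftrightarrow>
     (\<forall>f \<in> carrier (poly_ring V :: ('v, 'k) mpoly ring).
        initial_term r f = initial_term r (initial_y_form y f))"

text \<open>Both ideals are determined by a Groebner basis \<open>G\<close> of the ideal under consideration.\<close>

definition C_ideal :: "'v set \<Rightarrow> 'v \<Rightarrow> ('v, 'k::field) mpoly set \<Rightarrow> ('v, 'k) mpoly set" where
  "C_ideal V y G = Idl\<^bsub>poly_ring V\<^esub> (y_lead_coeff y ` G)"

definition N_ideal :: "'v set \<Rightarrow> 'v \<Rightarrow> ('v, 'k::field) mpoly set \<Rightarrow> ('v, 'k) mpoly set" where
  "N_ideal V y G = Idl\<^bsub>poly_ring V\<^esub> (y_lead_coeff y ` {g \<in> G. y_degree y g = 0})"

text \<open>\<open>GVD V I\<close>: the ideal \<open>I\<close> of $K[V]$ is geometrically vertex decomposable.\<close>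

inductive GVD :: "'v set \<Rightarrow> ('v, 'k::field) mpoly set \<Rightarrow> bool" where
  unit:
    "\<lbrakk>ideal I (poly_ring V); unmixed (poly_ring V) I; I = Idl\<^bsub>poly_ring V\<^esub> {1}\<rbrakk> \<Longrightarrow> GVD V I"
| variables:
    "\<lbrakk>ideal I (poly_ring V); unmixed (poly_ring V) I; S \<subseteq> V; I = Idl\<^bsub>poly_ring V\<^esub> (Var ` S)\<rbrakk>
     \<Longrightarrow> GVD V I"
| decompose:
    "\<lbrakk>ideal I (poly_ring V); unmixed (poly_ring V) I;
      y \<in> V; monomial_order V r; y_compatible TYPE('k) V y r; groebner_basis V r I G;
      initial_y_ideal V y I =
        C_ideal V y G \<inter> (N_ideal V y G <+>\<^bsub>poly_ring V\<^esub> Idl\<^bsub>poly_ring V\<^esub> {Var y});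
      GVD (V - {y}) (C_ideal V y G \<inter> carrier (poly_ring (V - {y})));
      GVD (V - {y}) (N_ideal V y G \<inter> carrier (poly_ring (V - {y})))\<rbrakk>
     \<Longrightarrow> GVD V (I :: ('v, 'k) mpoly set)"

section \<open>Toric ideals of graphs\<close>

text \<open>A finite simple graph is given by its vertex set \<open>V\<close> and its set \<open>E\<close> of two-element subsets
  of \<open>V\<close>. The edges themselves are the variables of the ring containing the toric ideal; for an
  edge \<open>e = {j, k}\<close> the product below is $x_j x_k$.\<close>

definition simple_graph :: "'a set \<Rightarrow> 'a set set \<Rightarrow> bool" where
  "simple_graph V E \<longleftrightarrow> finite V \<and> (\<forall>e\<in>E. e \<subseteq> V \<and> card e = 2)"

definition toric_ideal :: "'a set \<Rightarrow> 'a set set \<Rightarrow> ('a set, 'k::field) mpoly set" where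
  "toric_ideal V E =
     a_kernel (poly_ring E) (poly_ring V) (substitute (\<lambda>e. \<Prod>x\<in>e. Var x))"

text \<open>The graph $G(t_1, \ldots, t_s)$, where \<open>Outer i j\<close> is $v_{i,j}$ and \<open>Center\<close> is $v$.\<close>

datatype vertex = Center | Outer nat nat

definition G_vertices :: "nat \<Rightarrow> (nat \<Rightarrow> nat) \<Rightarrow> vertex set" where
  "G_vertices s t = insert Center {Outer i j | i j. i \<in> {1..s} \<and> j \<in> {1..2 * t i}}"

definition G_edge :: "(nat \<Rightarrow> nat) \<Rightarrow> nat \<Rightarrow> nat \<Rightarrow> vertex set" where
  "G_edge t i j =
     (if j = 1 then {Center, Outer i 1}
      else if j \<le> 2 * t i then {Outer i (j - 1), Outer i j}
      else {Outer i (2 * t i), Center})"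

definition G_edges :: "nat \<Rightarrow> (nat \<Rightarrow> nat) \<Rightarrow> vertex set set" where
  "G_edges s t = {G_edge t i j | i j. i \<in> {1..s} \<and> j \<in> {1..2 * t i + 1}}"

lemma simple_graph_G:
  assumes "\<forall>i\<in>{1..s}. t i \<ge> 1"
  shows "simple_graph (G_vertices s t) (G_edges s t)"
proof -
  have "{Outer i j | i j. i \<in> {1..s} \<and> j \<in> {1..2 * t i}} =
      (\<Union>i\<in>{1..s}. Outer i ` {1..2 * t i})"
    by auto
  then have "finite (G_vertices s t)"
    by (simp add: G_vertices_def)
  moreover have "e \<subseteq> G_vertices s t \<and> card e = 2" if e: "e \<in> G_edges s t" for e
  proof -
    obtain i j where ij: "i \<in> {1..s}" "j \<in> {1..2 * t i + 1}" "e = G_edge t i j"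
      using e by (auto simp: G_edges_def)
    then have "t i \<ge> 1"
      using assms by blast
    with ij show ?thesis
      by (auto simp: G_edge_def G_vertices_def card_insert_if)
  qed
  ultimately show ?thesis
    by (simp add: simple_graph_def)
qed

end

theory Submission
  imports Defs
begin

text \<open>
  Let $A_i$ and $B_i$ be the products of the edges in odd and in even position on the $i$-th cycle.
  Then $I_G$ is the ideal of $2 \times 2$ minors of the matrix with columns $(A_i, B_i)$. For a
  variable $y$ of $A_i$ the ideal $\mathcal{N}$ is the ideal of minors of the other columns, and
  $\mathcal{C} = \mathcal{N} + (A_i / y) \langle B_j : j \neq i \rangle$. Splitting off the variables
  of $A_i / y$ one by one leads from $\mathcal{C}$ to $\langle B_j : j \neq i \rangle$, a complete
  intersection of monomials, always with the same $\mathcal{N}$.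

  All ideals that occur are finite intersections of primes generated by variables and the minors of
  some columns. Unmixedness thus amounts to computing the heights of these primes: adding variables
  and columns one at a time gives a chain of primes, and no chain is longer, because a chain of
  length $n$ below $P$ and a set $S$ of variables independent modulo $P$ give as many linearly
  independent products of bounded degree as there are monomials in $n + |S|$ variables.
\<close>

section \<open>Polynomials and their coefficient sums\<close>

text \<open>No Groebner basis is ever exhibited. One exists by Dickson's lemma, and
  \<open>GVD_decomposeI\<close> shows that its ideals C and N are the expected ones once three
  things are known: top coefficients in y lie in C, every element of C is the coefficient of y in an
  element of I linear in y, and I meets the smaller ring in N. To check this without generators, the
  toric ideals are given by vanishing coefficient sums over classes of monomials, which also makes
  them kernels of maps into a domain.

  The matrix arises as follows. Two edge monomials have the same image iff on each cycle their
  exponents differ by an alternating vector c_i, -c_i, ..., c_i, and the exponents of the center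
  agree. The first and the last edge of a cycle are both in odd position, so the center sees 2 c_i,
  and the last condition says that the integers c_i add up to 0, whatever the characteristic of K.

  The ideals C are unmixed because their primes are of two kinds with equal height: minors of n
  columns plus one variable, of height (n - 1) + 1, and transversals of the n sets B_j, of height
  n.\<close>

abbreviation keys :: "('a \<Rightarrow>\<^sub>0 'b::zero) \<Rightarrow> 'a set" where "keys \<equiv> Poly_Mapping.keys"
abbreviation lookup :: "('a \<Rightarrow>\<^sub>0 'b::zero) \<Rightarrow> 'a \<Rightarrow> 'b" where "lookup \<equiv> Poly_Mapping.lookup"
abbreviation single :: "'a \<Rightarrow> 'b \<Rightarrow> ('a \<Rightarrow>\<^sub>0 'b::zero)" where "single \<equiv> Poly_Mapping.single"

section \<open>Exponent vectors\<close>

lemma mem_monomials: "m \<in> monomials V \<longleftrightarrow> keys m \<subseteq> V"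
  by (simp add: monomials_def)

lemma keys_add_nat: "keys (m + n) = keys m \<union> keys (n :: 'v monom)"
  by (auto simp: in_keys_iff lookup_add)

lemma monomials_add: "m + n \<in> monomials V \<longleftrightarrow> m \<in> monomials V \<and> n \<in> monomials V"
  by (auto simp: mem_monomials keys_add_nat)

lemma monomials_mono: "V \<subseteq> W \<Longrightarrow> m \<in> monomials V \<Longrightarrow> m \<in> monomials W"
  by (auto simp: mem_monomials)

lemma monom_le_imp_add:
  fixes m n :: "'v monom"
  assumes "\<And>v. lookup n v \<le> lookup m v"
  shows "n + (m - n) = m"
  by (rule poly_mapping_eqI) (use assms in \<open>simp add: lookup_add lookup_minus\<close>)

lemma poly_mapping_sum_single: "(\<Sum>m\<in>keys f. single m (lookup f m)) = f"
proof (rule poly_mapping_eqI)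
  fix k
  have "lookup (\<Sum>m\<in>keys f. single m (lookup f m)) k = (\<Sum>m\<in>keys f. if m = k then lookup f m else 0)"
    unfolding lookup_sum by (rule sum.cong) (auto simp: lookup_single when_def)
  also have "\<dots> = lookup f k"
    by (simp add: in_keys_iff)
  finally show "lookup (\<Sum>m\<in>keys f. single m (lookup f m)) k = lookup f k" .
qed

lemma poly_mapping_induct [case_names zero single add]:
  fixes f :: "'a \<Rightarrow>\<^sub>0 'b::comm_monoid_add"
  assumes "P 0" and "\<And>m c. m \<in> keys f \<Longrightarrow> P (single m c)" and "\<And>g h. P g \<Longrightarrow> P h \<Longrightarrow> P (g + h)"
  shows "P f"
proof -
  have "P (\<Sum>m\<in>M. single m (lookup f m))" if "M \<subseteq> keys f" for M
    using finite_subset[OF that finite_keys] that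
    by (induction M rule: finite_induct) (auto intro: assms)
  from this[OF order.refl] show ?thesis
    by (simp add: poly_mapping_sum_single)
qed

lemma keys_diff_subset: "keys (f - g) \<subseteq> keys f \<union> keys (g :: 'a \<Rightarrow>\<^sub>0 'b::ab_group_add)"
  by (auto simp: in_keys_iff lookup_minus)

section \<open>The rings K[V] and their ideals\<close>

abbreviation polys :: "'v set \<Rightarrow> ('v, 'k::field) mpoly set" where
  "polys V \<equiv> carrier (poly_ring V)"

lemma carrier_iff: "f \<in> polys V \<longleftrightarrow> (\<forall>m\<in>keys f. m \<in> monomials V)"
  by (auto simp: poly_ring_def)

lemma poly_ring_simps [simp]:
  "mult (poly_ring V) = (*)" "one (poly_ring V) = 1" "zero (poly_ring V) = 0"
  "add (poly_ring V) = (+)"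
  by (simp_all add: poly_ring_def)

lemma carrier_add: "f \<in> polys V \<Longrightarrow> g \<in> polys V \<Longrightarrow> f + g \<in> polys V"
  using keys_add by (fastforce simp: carrier_iff)

lemma carrier_uminus: "- f \<in> polys V \<longleftrightarrow> f \<in> polys V"
  by (simp add: carrier_iff in_keys_iff)

lemma carrier_diff: "f \<in> polys V \<Longrightarrow> g \<in> polys V \<Longrightarrow> f - g \<in> polys V"
  using keys_diff_subset by (fastforce simp: carrier_iff)

lemma carrier_mult:
  assumes "f \<in> polys V" "g \<in> polys V"
  shows "f * g \<in> polys V"
  unfolding carrier_iff
proof
  fix m assume "m \<in> keys (f * g)"
  then obtain a b where "m = a + b" "a \<in> keys f" "b \<in> keys g"
    using keys_mult[of f g] by auto
  then show "m \<in> monomials V"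
    using assms by (auto simp: carrier_iff monomials_add)
qed

lemma carrier_zero [simp]: "0 \<in> polys V"
  and carrier_one [simp]: "1 \<in> polys V"
  by (auto simp: carrier_iff mem_monomials)

lemma carrier_single: "m \<in> monomials V \<Longrightarrow> single m c \<in> polys V"
  by (simp add: carrier_iff)

lemma carrier_sum: "(\<And>i. i \<in> A \<Longrightarrow> f i \<in> polys V) \<Longrightarrow> sum f A \<in> polys V"
  by (induction A rule: infinite_finite_induct) (auto intro: carrier_add)

lemma carrier_mono: "V \<subseteq> W \<Longrightarrow> f \<in> polys V \<Longrightarrow> f \<in> polys W"
  by (auto simp: carrier_iff intro: monomials_mono)

lemma carrier_Const [simp]: "Const a \<in> polys V"
  by (simp add: Const_def carrier_single mem_monomials)

lemma carrier_Var: "x \<in> V \<Longrightarrow> Var x \<in> polys V"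
  by (simp add: Var_def carrier_single mem_monomials)

lemma Const_mult_single: "Const a * single m c = single m (a * c)"
  by (simp add: Const_def mult_single)

lemma cring_poly_ring: "cring (poly_ring V :: ('v, 'k::field) mpoly ring)"
proof (rule cringI)
  show "abelian_group (poly_ring V :: ('v, 'k) mpoly ring)"
  proof (rule abelian_groupI)
    fix x :: "('v, 'k) mpoly" assume "x \<in> polys V"
    then show "\<exists>y\<in>polys V. y \<oplus>\<^bsub>poly_ring V\<^esub> x = \<zero>\<^bsub>poly_ring V\<^esub>"
      by (intro bexI[of _ "- x"]) (simp_all add: carrier_uminus)
  qed (simp_all add: carrier_add add.assoc add.commute)
  show "comm_monoid (poly_ring V :: ('v, 'k) mpoly ring)"
    by (rule comm_monoidI) (simp_all add: carrier_mult mult.assoc mult.commute)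
qed (simp add: distrib_right)

lemma a_inv_poly_ring:
  assumes "f \<in> polys V"
  shows "\<ominus>\<^bsub>poly_ring V\<^esub> f = - f"
proof -
  interpret cring "poly_ring V" by (rule cring_poly_ring)
  have "- f \<in> polys V" "- f \<oplus>\<^bsub>poly_ring V\<^esub> f = \<zero>\<^bsub>poly_ring V\<^esub>"
    using assms by (simp_all add: carrier_uminus)
  then show ?thesis
    using assms minus_equality by blast
qed

lemma poly_idealI:
  fixes I :: "('v, 'k::field) mpoly set"
  assumes "I \<subseteq> polys V" and "0 \<in> I"
    and "\<And>f g. f \<in> I \<Longrightarrow> g \<in> I \<Longrightarrow> f + g \<in> I"
    and "\<And>f g. f \<in> polys V \<Longrightarrow> g \<in> I \<Longrightarrow> f * g \<in> I"
  shows "ideal I (poly_ring V)"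
proof -
  interpret cring "poly_ring V :: ('v, 'k) mpoly ring" by (rule cring_poly_ring)
  show ?thesis
  proof (rule idealI)
    show "ring (poly_ring V :: ('v, 'k) mpoly ring)" by unfold_locales
    show "subgroup I (add_monoid (poly_ring V))"
    proof (rule add.subgroupI)
      fix f assume f: "f \<in> I"
      then have "\<ominus>\<^bsub>poly_ring V\<^esub> f = Const (- 1) * f"
        using assms(1) by (simp add: a_inv_poly_ring subset_iff Const_def single_uminus)
      then show "\<ominus>\<^bsub>poly_ring V\<^esub> f \<in> I"
        using assms(4)[OF _ f] by simp
    qed (use assms in auto)
  next
    fix f g :: "('v, 'k) mpoly" assume "f \<in> I" "g \<in> polys V"
    then have "g * f \<in> I" by (rule assms(4)[rotated])
    then show "g \<otimes>\<^bsub>poly_ring V\<^esub> f \<in> I" "f \<otimes>\<^bsub>poly_ring V\<^esub> g \<in> I"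
      by (simp_all add: mult.commute)
  qed
qed

lemma poly_idealD:
  fixes I :: "('v, 'k::field) mpoly set"
  assumes "ideal I (poly_ring V)"
  shows "I \<subseteq> polys V" "0 \<in> I"
    "f \<in> I \<Longrightarrow> g \<in> I \<Longrightarrow> f + g \<in> I"
    "f \<in> polys V \<Longrightarrow> g \<in> I \<Longrightarrow> f * g \<in> I"
    "f \<in> I \<Longrightarrow> g \<in> I \<Longrightarrow> f - g \<in> I"
proof -
  interpret ideal I "poly_ring V" by (rule assms)
  show 1: "I \<subseteq> polys V" by auto
  show "0 \<in> I" using additive_subgroup.zero_closed[OF is_additive_subgroup] by simp
  show 2: "f \<in> I \<Longrightarrow> g \<in> I \<Longrightarrow> f + g \<in> I" for f g using additive_subgroup.a_closed[OF is_additive_subgroup] by simp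
  show 3: "f \<in> polys V \<Longrightarrow> g \<in> I \<Longrightarrow> f * g \<in> I" for f g using I_l_closed by simp
  assume "f \<in> I" "g \<in> I"
  then have "f + Const (- 1) * g \<in> I" by (intro 2 3) auto
  then show "f - g \<in> I" by (simp add: Const_def single_uminus)
qed

lemma poly_ideal_sum:
  "ideal I (poly_ring V) \<Longrightarrow> (\<And>i. i \<in> A \<Longrightarrow> f i \<in> I) \<Longrightarrow> sum f A \<in> I"
  by (induction A rule: infinite_finite_induct) (auto simp: poly_idealD)

lemma genideal_minimal': "ideal I R \<Longrightarrow> S \<subseteq> I \<Longrightarrow> Idl\<^bsub>R\<^esub> S \<subseteq> I"
  by (auto simp: genideal_def)

lemma poly_genideal:
  assumes "S \<subseteq> polys V"
  shows "ideal (Idl\<^bsub>poly_ring V\<^esub> S) (poly_ring V)" "S \<subseteq> Idl\<^bsub>poly_ring V\<^esub> S"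
proof -
  interpret cring "poly_ring V" by (rule cring_poly_ring)
  show "ideal (Idl\<^bsub>poly_ring V\<^esub> S) (poly_ring V)" "S \<subseteq> Idl\<^bsub>poly_ring V\<^esub> S"
    using genideal_ideal[OF assms] genideal_self[OF assms] by auto
qed

text \<open>For fixed \<open>S\<close> a linear functional of \<open>f\<close>. Every toric ideal
  below is a common kernel of such functionals, so that membership is a matter of sets of monomials
  and not of generators.\<close>

definition zsum :: "('v, 'k::field) mpoly \<Rightarrow> 'v monom set \<Rightarrow> 'k" where
  "zsum f S = (\<Sum>m\<in>keys f \<inter> S. lookup f m)"

lemma zsum_superset:
  assumes "finite T" "keys f \<subseteq> T"
  shows "zsum f S = (\<Sum>m\<in>T. if m \<in> S then lookup f m else 0)"
proof -
  have "zsum f S = (\<Sum>m\<in>keys f. if m \<in> S then lookup f m else 0)"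
    by (simp add: zsum_def sum.inter_restrict)
  also have "\<dots> = (\<Sum>m\<in>T. if m \<in> S then lookup f m else 0)"
    by (rule sum.mono_neutral_left) (use assms in \<open>auto simp: in_keys_iff\<close>)
  finally show ?thesis .
qed

lemma zsum_zero [simp]: "zsum 0 S = 0"
  by (simp add: zsum_def)

lemma zsum_add: "zsum (f + g) S = zsum f S + zsum g S"
proof -
  let ?T = "keys f \<union> keys g"
  have "finite ?T" "keys f \<subseteq> ?T" "keys g \<subseteq> ?T" "keys (f + g) \<subseteq> ?T"
    using keys_add[of f g] by auto
  then show ?thesis
    by (simp add: zsum_superset[of ?T] flip: sum.distrib) (auto simp: lookup_add intro!: sum.cong)
qed

lemma zsum_uminus: "zsum (- f) S = - zsum f S"
  by (simp add: zsum_def keys_def sum_negf uminus_poly_mapping.rep_eq)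

lemma zsum_diff: "zsum (f - g) S = zsum f S - zsum g S"
  using zsum_add[of f "- g" S] by (simp add: zsum_uminus)

lemma zsum_sum: "zsum (sum f A) S = (\<Sum>i\<in>A. zsum (f i) S)"
  by (induction A rule: infinite_finite_induct) (auto simp: zsum_add)

lemma zsum_single: "zsum (single m c) S = (if m \<in> S then c else 0)"
  by (cases "c = 0") (auto simp: zsum_def Int_insert_left)

lemma zsum_Un_disjoint:
  assumes "S \<inter> T = {}"
  shows "zsum f (S \<union> T) = zsum f S + zsum f T"
  unfolding zsum_def Int_Un_distrib using assms by (intro sum.union_disjoint) auto

lemma zsum_cong: "keys f \<inter> S = keys f \<inter> T \<Longrightarrow> zsum f S = zsum f T"
  by (simp add: zsum_def)

lemma zsum_monom_mult: "zsum (single u c * f) S = c * zsum f {m. u + m \<in> S}"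
proof (induction f rule: poly_mapping_induct)
  case (add g h)
  then show ?case by (simp add: distrib_left zsum_add)
qed (simp_all add: mult_single zsum_single)

text \<open>On the monomials of \<open>f\<close>, the set \<open>S \<inter> T\<close> is a disjoint
  union of fibres of \<open>\<kappa>\<close> on \<open>T\<close>, since \<open>sat\<close> forbids
  \<open>S\<close> to cut through a fibre.\<close>

lemma zsum_eq_0_of_fibres:
  fixes \<kappa> :: "'v monom \<Rightarrow> 'c"
  assumes fib: "\<And>\<mu>. zsum f {m \<in> T. \<kappa> m = \<mu>} = 0"
    and sat: "\<And>m m'. m \<in> keys f \<inter> T \<inter> S \<Longrightarrow> m' \<in> keys f \<inter> T \<Longrightarrow> \<kappa> m = \<kappa> m' \<Longrightarrow> m' \<in> S"
  shows "zsum f (S \<inter> T) = 0"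
proof -
  let ?M = "keys f \<inter> (S \<inter> T)"
  have "zsum f (S \<inter> T) = (\<Sum>\<mu>\<in>\<kappa> ` ?M. \<Sum>m | m \<in> ?M \<and> \<kappa> m = \<mu>. lookup f m)"
    unfolding zsum_def by (rule sum.group[symmetric]) auto
  also have "\<dots> = (\<Sum>\<mu>\<in>\<kappa> ` ?M. 0)"
  proof (rule sum.cong)
    fix \<mu> assume "\<mu> \<in> \<kappa> ` ?M"
    then obtain m0 where m0: "m0 \<in> ?M" "\<kappa> m0 = \<mu>" by auto
    have "{m. m \<in> ?M \<and> \<kappa> m = \<mu>} = keys f \<inter> {m \<in> T. \<kappa> m = \<mu>}"
      using sat[of m0] m0 by auto
    then show "(\<Sum>m | m \<in> ?M \<and> \<kappa> m = \<mu>. lookup f m) = 0"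
      using fib[of \<mu>] by (simp add: zsum_def)
  qed simp
  finally show ?thesis by simp
qed

section \<open>Multiplicative linear extensions\<close>

text \<open>\<open>single 0 c\<close> is the constant c of the target algebra. The target is any
  monoid algebra, so that \<open>h\<close> can send a monomial to an invariant of its class.\<close>

definition lin :: "('v monom \<Rightarrow> ('g::comm_monoid_add \<Rightarrow>\<^sub>0 'k)) \<Rightarrow> ('v, 'k::field) mpoly \<Rightarrow> ('g \<Rightarrow>\<^sub>0 'k)" where
  "lin h f = (\<Sum>m\<in>keys f. single 0 (lookup f m) * h m)"

lemma lin_superset:
  "finite T \<Longrightarrow> keys f \<subseteq> T \<Longrightarrow> lin h f = (\<Sum>m\<in>T. single 0 (lookup f m) * h m)"
  unfolding lin_def by (rule sum.mono_neutral_left) (auto simp: in_keys_iff)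

lemma lin_zero [simp]: "lin h 0 = 0"
  by (simp add: lin_def)

lemma lin_add: "lin h (f + g) = lin h f + lin h g"
proof -
  let ?T = "keys f \<union> keys g"
  have "finite ?T" "keys f \<subseteq> ?T" "keys g \<subseteq> ?T" "keys (f + g) \<subseteq> ?T"
    using keys_add[of f g] by auto
  then show ?thesis
    by (simp add: lin_superset[of ?T] lookup_add single_add distrib_right sum.distrib)
qed

lemma lin_single: "lin h (single m c) = single 0 c * h m"
  by (cases "c = 0") (auto simp: lin_def)

lemma lin_mult:
  assumes "\<And>m n. h (m + n) = h m * h n"
  shows "lin h (f * g) = lin h f * lin h g"
proof (induction f rule: poly_mapping_induct)
  case (single m c)
  show ?case
  proof (induction g rule: poly_mapping_induct)
    case (single n d)
    have "single (0::'b) (c * d) = single 0 c * single 0 d" by (simp add: mult_single)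
    then show ?case by (simp add: mult_single lin_single assms mult_ac)
  qed (simp_all add: distrib_left lin_add)
qed (simp_all add: distrib_right lin_add)

text \<open>The linear order on the exponent monoid makes the target algebra a domain, so the kernel
  of the homomorphism is prime; \<open>h 0 = 1\<close> keeps it proper.\<close>

lemma primeideal_lin_kernel:
  fixes h :: "'v monom \<Rightarrow> ('g::{ordered_cancel_comm_monoid_add, linorder} \<Rightarrow>\<^sub>0 'k::field)"
  assumes h: "\<And>m n. h (m + n) = h m * h n" "h 0 = 1"
  shows "primeideal {f \<in> polys V. lin h f = 0} (poly_ring V)"
proof (rule primeidealI)
  show "cring (poly_ring V :: ('v, 'k) mpoly ring)" by (rule cring_poly_ring)
  show "ideal {f \<in> polys V. lin h f = 0} (poly_ring V)"
    by (rule poly_idealI) (auto simp: lin_add lin_mult[of h, OF h(1)] carrier_add carrier_mult)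
  have "lin h (single 0 1) = 1" unfolding lin_single by (simp add: h)
  then have "lin h 1 = 1" by simp
  then have "1 \<notin> {f \<in> polys V. lin h f = 0}" by simp
  then show "polys V \<noteq> {f \<in> polys V. lin h f = 0}"
    using carrier_one by blast
qed (auto simp: lin_mult[of h, OF h(1)])

text \<open>Sending the monomials outside \<open>Q\<close> to 0 lets the kernel contain variables;
  the others are grouped by \<open>\<pi>\<close>, so each coefficient of the image collects one
  fibre.\<close>

lemma lookup_lin_fibre:
  fixes \<pi> :: "'v monom \<Rightarrow> 'g::comm_monoid_add"
  shows "lookup (lin (\<lambda>m. if Q m then single (\<pi> m) 1 else 0) f) \<mu> = zsum f {m. Q m \<and> \<pi> m = \<mu>}"
proof (induction f rule: poly_mapping_induct)
  case (single m c)
  show ?case by (simp add: lin_single zsum_single mult_single lookup_single when_def)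
qed (simp_all add: lin_add zsum_add lookup_add)

section \<open>Coefficients with respect to one variable\<close>

lemma lookup_monom_mult:
  fixes f :: "('v, 'k::field) mpoly"
  shows "lookup (single u c * f) (u + n) = c * lookup f n"
proof (induction f rule: poly_mapping_induct)
  case (single m d)
  show ?case by (cases "m = n") (auto simp: mult_single lookup_single when_def)
qed (simp_all add: distrib_left lookup_add)

lemma keys_monom_mult_subset: "keys (single u c * f) \<subseteq> (+) u ` keys f"
  using keys_mult[of "single u c" f] by (cases "c = 0") auto

lemma Var_power: "Var y ^ i = single (single y i) 1"
proof (induction i)
  case (Suc i)
  then show ?case by (simp add: Var_def mult_single flip: single_add)
qed simp

lemma y_coeff_eq_sum:
  assumes "finite T" "keys f \<subseteq> T"
  shows "y_coeff y i f = (\<Sum>m\<in>T. if lookup m y = i then single (m - single y i) (lookup f m) else 0)"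
proof -
  have "y_coeff y i f = (\<Sum>m\<in>keys f. if lookup m y = i then single (m - single y i) (lookup f m) else 0)"
    unfolding y_coeff_def by (subst sum.inter_filter) auto
  also have "\<dots> = (\<Sum>m\<in>T. if lookup m y = i then single (m - single y i) (lookup f m) else 0)"
    by (rule sum.mono_neutral_left) (use assms in \<open>auto simp: in_keys_iff\<close>)
  finally show ?thesis .
qed

lemma y_coeff_zero [simp]: "y_coeff y i 0 = 0"
  by (simp add: y_coeff_def)

lemma y_coeff_add: "y_coeff y i (f + g) = y_coeff y i f + y_coeff y i g"
proof -
  let ?T = "keys f \<union> keys g"
  have "finite ?T" "keys f \<subseteq> ?T" "keys g \<subseteq> ?T" "keys (f + g) \<subseteq> ?T"
    using keys_add[of f g] by auto
  then show ?thesis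
    by (simp add: y_coeff_eq_sum[of ?T] flip: sum.distrib) (auto simp: lookup_add single_add intro!: sum.cong)
qed

lemma y_coeff_single:
  "y_coeff y i (single m c) = (if lookup m y = i then single (m - single y i) c else 0)"
  by (cases "c = 0") (auto simp: y_coeff_eq_sum[of "{m}"])

lemma y_coeff_uminus: "y_coeff y i (- f) = - y_coeff y i f"
proof -
  have "y_coeff y i (- f) + y_coeff y i f = y_coeff y i (- f + f)" by (simp only: y_coeff_add)
  then show ?thesis by (simp add: eq_neg_iff_add_eq_0)
qed

lemma y_coeff_diff: "y_coeff y i (f - g) = y_coeff y i f - y_coeff y i g"
  using y_coeff_add[of y i f "- g"] by (simp add: y_coeff_uminus)

lemma y_coeff_sum: "y_coeff y i (sum f A) = (\<Sum>a\<in>A. y_coeff y i (f a))"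
  by (induction A rule: infinite_finite_induct) (auto simp: y_coeff_add)

lemma zsum_y_coeff: "zsum (y_coeff y i f) S = zsum f {m. lookup m y = i \<and> m - single y i \<in> S}"
proof (induction f rule: poly_mapping_induct)
  case (add g h)
  then show ?case by (simp add: y_coeff_add zsum_add)
qed (simp_all add: y_coeff_single zsum_single)

lemma lookup_eq_zsum: "lookup f m = zsum f {m}"
  by (cases "m \<in> keys f") (simp_all add: zsum_def in_keys_iff)

lemma monom_split:
  fixes m :: "'v monom"
  shows "m - single y (lookup m y) + single y (lookup m y) = m" "lookup (m - single y i) y = lookup m y - i"
  by (rule poly_mapping_eqI) (auto simp: lookup_add lookup_minus lookup_single when_def)

text \<open>Subtraction of exponents is truncated; only when the exponent of \<open>y\<close> is
  exactly \<open>i\<close> can \<open>m\<close> be recovered from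
  \<open>m - single y i\<close>.\<close>

lemma minus_single_eq_iff:
  fixes m n :: "'v monom"
  shows "lookup m y = i \<and> m - single y i = n \<longleftrightarrow> lookup n y = 0 \<and> m = n + single y i"
  by (auto simp: monom_split lookup_add)

lemma lookup_y_coeff:
  "lookup (y_coeff y i f) n = (if lookup n y = 0 then lookup f (n + single y i) else 0)"
proof -
  have "{m. lookup m y = i \<and> m - single y i \<in> {n}} =
      (if lookup n y = 0 then {n + single y i} else {})"
    using minus_single_eq_iff[of _ y i n] by auto
  then show ?thesis
    by (simp only: lookup_eq_zsum zsum_y_coeff) (simp add: zsum_def)
qed

lemma keys_y_coeff: "n \<in> keys (y_coeff y i f) \<longleftrightarrow> lookup n y = 0 \<and> n + single y i \<in> keys f"
  by (simp add: in_keys_iff lookup_y_coeff)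

lemma monomials_minus_y: "n \<in> monomials (V - {y}) \<longleftrightarrow> n \<in> monomials V \<and> lookup n y = 0"
  by (auto simp: mem_monomials in_keys_iff)

lemma single_mem_monomials: "y \<in> V \<Longrightarrow> single y i \<in> monomials V"
  by (simp add: mem_monomials)

lemma y_coeff_carrier:
  "f \<in> polys V \<Longrightarrow> y_coeff y i f \<in> polys (V - {y})"
  by (fastforce simp: carrier_iff keys_y_coeff monomials_minus_y monomials_add)

lemma y_coeff_eq_0: "(\<And>m. m \<in> keys f \<Longrightarrow> lookup m y \<noteq> i) \<Longrightarrow> y_coeff y i f = 0"
  unfolding y_coeff_def by (rule sum.neutral) auto

lemma y_coeff_of_carrier:
  assumes "f \<in> polys (V - {y})"
  shows "y_coeff y i f = (if i = 0 then f else 0)"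
proof -
  have "lookup m y = 0" if "m \<in> keys f" for m using assms that by (auto simp: carrier_iff monomials_minus_y)
  then have *: "lookup f m = 0" if "lookup m y \<noteq> 0" for m
    using that by (metis in_keys_iff)
  have "lookup (y_coeff y i f) m = lookup (if i = 0 then f else 0) m" for m
    by (simp add: lookup_y_coeff lookup_add * del: neq0_conv)
  then show ?thesis by (rule poly_mapping_eqI)
qed

lemma y_coeff_monom_mult:
  "y_coeff y i (single m c * f) =
     (if lookup m y \<le> i then single (m - single y (lookup m y)) c * y_coeff y (i - lookup m y) f else 0)"
proof (induction f rule: poly_mapping_induct)
  case (single n d)
  have "m + n - single y (lookup m y + lookup n y) = m - single y (lookup m y) + (n - single y (lookup n y))"
    by (rule poly_mapping_eqI) (auto simp: lookup_add lookup_minus lookup_single when_def)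
  then show ?case
    by (auto simp: mult_single y_coeff_single lookup_add)
qed (simp_all add: distrib_left y_coeff_add)

lemma y_coeff_mult_Var_power:
  assumes "q \<in> polys (V - {y})"
  shows "y_coeff y i (q * Var y ^ j) = (if i = j then q else 0)"
proof -
  have "y_coeff y i (q * Var y ^ j) = y_coeff y i (single (single y j) 1 * q)"
    by (simp add: Var_power mult.commute)
  then show ?thesis
    using assms by (auto simp: y_coeff_monom_mult y_coeff_of_carrier[OF assms])
qed

text \<open>Any bound \<open>d\<close> on the exponents of \<open>y\<close> is allowed, so that
  \<open>f = 0\<close>, where \<open>y_degree\<close> is the \<open>Max\<close> of the empty set, is
  covered as well.\<close>

lemma y_expansion:
  fixes f :: "('v, 'k::field) mpoly"
  assumes "\<And>m. m \<in> keys f \<Longrightarrow> lookup m y \<le> d"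
  shows "f = (\<Sum>i\<le>d. y_coeff y i f * Var y ^ i)"
proof -
  have "(\<Sum>i\<le>d. y_coeff y i f * Var y ^ i) =
      (\<Sum>i\<le>d. \<Sum>m\<in>keys f. if lookup m y = i then single m (lookup f m) else 0)"
  proof (rule sum.cong)
    fix i
    have "single (m - single y (lookup m y)) c * single (single y (lookup m y)) 1 = single m c" for m :: "'v monom" and c :: 'k
      by (simp add: mult_single monom_split)
    then show "y_coeff y i f * Var y ^ i =
        (\<Sum>m\<in>keys f. if lookup m y = i then single m (lookup f m) else 0)"
      unfolding y_coeff_eq_sum[OF finite_keys order.refl] sum_distrib_right Var_power
      by (intro sum.cong) auto
  qed simp
  also have "\<dots> = (\<Sum>m\<in>keys f. \<Sum>i\<le>d. if lookup m y = i then single m (lookup f m) else 0)"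
    by (rule sum.swap)
  also have "\<dots> = (\<Sum>m\<in>keys f. single m (lookup f m))"
    by (rule sum.cong) (use assms in auto)
  finally show ?thesis by (simp add: poly_mapping_sum_single)
qed

lemma y_bound_exists: "\<exists>d. \<forall>m\<in>keys f. lookup m y \<le> (d :: nat)"
  using finite_imageI[OF finite_keys[of f], of "\<lambda>m. lookup m y"]
  by (meson finite_nat_set_iff_bounded_le imageI)

lemma y_degree_eqI:
  assumes "\<And>m. m \<in> keys f \<Longrightarrow> lookup m y \<le> d" and "y_coeff y d f \<noteq> 0"
  shows "y_degree y f = d"
  unfolding y_degree_def
proof (rule Max_eqI)
  show "d \<in> (\<lambda>m. lookup m y) ` keys f"
    using assms(2) y_coeff_eq_0[of f y d] by force
qed (use assms(1) in auto)

lemma le_y_degree: "m \<in> keys f \<Longrightarrow> lookup m y \<le> y_degree y f"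
  unfolding y_degree_def by simp

lemma initial_y_form_eqI:
  assumes "\<And>m. m \<in> keys f \<Longrightarrow> lookup m y \<le> d" and "y_coeff y d f \<noteq> 0"
  shows "initial_y_form y f = y_coeff y d f * Var y ^ d"
  using y_degree_eqI[of f y d] assms by (simp add: initial_y_form_def y_lead_coeff_def)

lemma lookup_initial_y_form:
  "lookup (initial_y_form y f) m = (if lookup m y = y_degree y f then lookup f m else 0)"
proof (cases "\<exists>n. m = single y (y_degree y f) + n")
  case True
  then obtain n where n: "m = single y (y_degree y f) + n" by blast
  have "initial_y_form y f = single (single y (y_degree y f)) 1 * y_lead_coeff y f"
    by (simp add: initial_y_form_def Var_power mult.commute)
  then have "lookup (initial_y_form y f) m = lookup (y_lead_coeff y f) n"
    by (simp add: n lookup_monom_mult)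
  then show ?thesis
    by (simp add: n y_lead_coeff_def lookup_y_coeff lookup_add add.commute)
next
  case False
  then have "m \<notin> keys (initial_y_form y f)"
    using keys_monom_mult_subset[of "single y (y_degree y f)" 1 "y_lead_coeff y f"]
    by (auto simp: initial_y_form_def Var_power mult.commute[of "y_lead_coeff y f"])
  moreover have "lookup m y \<noteq> y_degree y f"
    using False minus_single_eq_iff[of m y "y_degree y f"] by (metis add.commute)
  ultimately show ?thesis by (simp add: in_keys_iff)
qed

section \<open>Monomial orders and Dickson's lemma\<close>

text \<open>Past any index the sequence attains its minimum over the remaining tail; hopping from
  one such index to the next gives the subsequence.\<close>

lemma mono_subseq_nat:
  fixes s :: "nat \<Rightarrow> nat"
  shows "\<exists>h :: nat \<Rightarrow> nat. strict_mono h \<and> mono (s \<circ> h)"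
proof -
  have ex: "\<exists>x>a. \<forall>k\<ge>x. s x \<le> s k" for a
  proof -
    obtain x where x: "x > a" "\<And>k. k > a \<Longrightarrow> s x \<le> s k"
      using ex_has_least_nat[of "\<lambda>x. x > a" "Suc a" s] by auto
    then show ?thesis by (intro exI[of _ x]) auto
  qed
  have "\<exists>h. \<forall>n. (\<forall>k\<ge>h n. s (h n) \<le> s k) \<and> h n < h (Suc n)"
    by (rule dependent_nat_choice) (use ex in blast)+
  then obtain h where h: "\<And>n k. k \<ge> h n \<Longrightarrow> s (h n) \<le> s k" "\<And>n. h n < h (Suc n)" by blast
  have "strict_mono h" using h(2) by (rule strict_mono_Suc_iff[THEN iffD2, rule_format])
  moreover have "mono (s \<circ> h)"
    using h by (simp add: mono_iff_le_Suc order.strict_implies_order)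
  ultimately show ?thesis by blast
qed

text \<open>Each new coordinate is made monotone by thinning out the subsequence, which keeps the
  earlier coordinates monotone.\<close>

lemma mono_subseq_family:
  fixes s :: "nat \<Rightarrow> 'v \<Rightarrow> nat"
  assumes "finite V"
  shows "\<exists>h :: nat \<Rightarrow> nat. strict_mono h \<and> (\<forall>v\<in>V. mono (\<lambda>n. s (h n) v))"
  using assms
proof (induction V rule: finite_induct)
  case empty
  show ?case by (rule exI[of _ "\<lambda>n. n"]) (simp add: strict_mono_def)
next
  case (insert v V)
  then obtain h :: "nat \<Rightarrow> nat" where h: "strict_mono h" "\<forall>v\<in>V. mono (\<lambda>n. s (h n) v)" by blast
  obtain k :: "nat \<Rightarrow> nat" where k: "strict_mono k" "mono ((\<lambda>n. s (h n) v) \<circ> k)"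
    using mono_subseq_nat by blast
  have "mono k" using k(1) by (rule strict_mono_mono)
  moreover have "strict_mono (\<lambda>n. h (k n))" using strict_mono_o[OF h(1) k(1)] by (simp add: o_def)
  ultimately show ?case
    using h k by (intro exI[of _ "\<lambda>n. h (k n)"]) (auto simp: mono_def)
qed

text \<open>If no finite subset works, one can keep choosing elements of \<open>S\<close> that are
  not divisible by any earlier choice. A subsequence monotone in all exponents contradicts
  this.\<close>

lemma dickson:
  fixes S :: "'v monom set"
  assumes "finite V" "S \<subseteq> monomials V"
  shows "\<exists>F\<subseteq>S. finite F \<and> (\<forall>m\<in>S. \<exists>n\<in>F. \<forall>v. lookup n v \<le> lookup m v)"
proof (rule ccontr)
  assume "\<not> ?thesis"
  then have "\<forall>F. \<exists>m. finite F \<and> F \<subseteq> S \<longrightarrow> m \<in> S \<and> (\<forall>n\<in>F. \<not> (\<forall>v. lookup n v \<le> lookup m v))"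
    by meson
  then obtain p where p: "\<And>F. finite F \<Longrightarrow> F \<subseteq> S \<Longrightarrow>
      p F \<in> S \<and> (\<forall>n\<in>F. \<not> (\<forall>v. lookup n v \<le> lookup (p F) v))"
    by metis
  define F where "F = rec_nat {} (\<lambda>_ F. insert (p F) F)"
  have F0: "F 0 = {}" and FSuc: "F (Suc n) = insert (p (F n)) (F n)" for n
    by (simp_all add: F_def)
  have FS: "finite (F n) \<and> F n \<subseteq> S" for n
    by (induction n) (use p in \<open>auto simp: F0 FSuc\<close>)
  have mem: "p (F i) \<in> F j" if "i < j" for i j
    using that by (induction j) (auto simp: FSuc less_Suc_eq)
  obtain h :: "nat \<Rightarrow> nat" where h: "strict_mono h" "\<forall>v\<in>V. mono (\<lambda>n. lookup (p (F (h n))) v)"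
    using mono_subseq_family[OF assms(1), of "\<lambda>n v. lookup (p (F n)) v"] by blast
  have "lookup (p (F (h 0))) v \<le> lookup (p (F (h 1))) v" for v
  proof (cases "v \<in> V")
    case True
    then show ?thesis using h(2) by (simp add: mono_def)
  next
    case False
    then have "v \<notin> keys (p (F (h 0)))"
      using p FS assms(2) by (meson in_mono mem_monomials)
    then show ?thesis by (simp add: in_keys_iff)
  qed
  moreover have "p (F (h 0)) \<in> F (h 1)" using h(1) by (intro mem) (simp add: strict_mono_def)
  ultimately show False using p FS by blast
qed

text \<open>Carries monomials to those in variables indexed by natural numbers, where the order of
  the type is lexicographic with index 0 most significant. Monomial orders are pulled back from
  there.\<close>

definition reindex :: "('v \<Rightarrow> nat) \<Rightarrow> 'v monom \<Rightarrow> nat monom" where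
  "reindex i m = (\<Sum>v\<in>keys m. single (i v) (lookup m v))"

lemma reindex_superset:
  "finite T \<Longrightarrow> keys m \<subseteq> T \<Longrightarrow> reindex i m = (\<Sum>v\<in>T. single (i v) (lookup m v))"
  unfolding reindex_def by (rule sum.mono_neutral_left) (auto simp: in_keys_iff)

lemma reindex_add: "reindex i (m + n) = reindex i m + reindex i n"
proof -
  have "finite (keys m \<union> keys n)" by simp
  then show ?thesis
    by (simp add: reindex_superset[of "keys m \<union> keys n"] keys_add_nat lookup_add single_add sum.distrib)
qed

lemma lookup_reindex:
  assumes "inj_on i V" "m \<in> monomials V" "v \<in> V"
  shows "lookup (reindex i m) (i v) = lookup m v"
proof -
  have "lookup (reindex i m) (i v) = (\<Sum>w\<in>keys m. if w = v then lookup m w else 0)"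
    unfolding reindex_def lookup_sum
    by (rule sum.cong) (use assms in \<open>auto simp: lookup_single when_def mem_monomials dest: inj_onD\<close>)
  then show ?thesis by (simp add: in_keys_iff)
qed

lemma inj_on_reindex:
  assumes "inj_on i V"
  shows "inj_on (reindex i) (monomials V)"
proof (rule inj_onI, rule poly_mapping_eqI)
  fix m n v assume *: "m \<in> monomials V" "n \<in> monomials V" "reindex i m = reindex i n"
  show "lookup m v = lookup n v"
  proof (cases "v \<in> V")
    case True
    then show ?thesis using * lookup_reindex[OF assms] by metis
  next
    case False
    then have "v \<notin> keys m" "v \<notin> keys n" using * by (auto simp: mem_monomials)
    then show ?thesis by (simp add: in_keys_iff)
  qed
qed

lemma zero_le_monom: "0 \<le> (m :: nat monom)"
proof (rule leI)
  show "\<not> m < 0" by transfer (simp add: less_fun_def)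
qed

lemma monom_le_imp_lookup_0_le:
  fixes m n :: "nat monom"
  assumes "m \<le> n"
  shows "lookup m 0 \<le> lookup n 0"
proof (rule ccontr)
  assume "\<not> ?thesis"
  then have "n < m" by transfer (auto simp: less_fun_def intro!: exI[of _ 0])
  then show False using assms by simp
qed

lemma ex_y_order:
  fixes y :: 'v
  assumes "finite V" "y \<in> V"
  obtains r where "monomial_order V r" "\<And>a b. (a, b) \<in> r \<Longrightarrow> lookup a y \<le> lookup b y"
proof -
  obtain j :: "'v \<Rightarrow> nat" where j: "inj_on j (V - {y})"
    using finite_imp_inj_to_nat_seg[of "V - {y}"] assms by auto
  \<comment> \<open>Index 0 is reserved for \<open>y\<close>, so that exponents of \<open>y\<close>
    are compared first.\<close>
  define i where "i v = (if v = y then 0 else Suc (j v))" for v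
  have i: "inj_on i V"
    using j unfolding inj_on_def i_def by auto
  define r where "r = {(a, b). a \<in> monomials V \<and> b \<in> monomials V \<and> reindex i a \<le> reindex i b}"
  have zero: "0 \<in> monomials V" by (simp add: mem_monomials)
  have "linear_order_on (monomials V) r"
    unfolding linear_order_on_def partial_order_on_def preorder_on_def refl_on_def trans_def antisym_def
      total_on_def
    using inj_on_reindex[OF i] by (auto simp: r_def dest: inj_onD)
  moreover have "\<forall>a\<in>monomials V. (0, a) \<in> r"
    using zero zero_le_monom by (auto simp: r_def reindex_def)
  moreover have "(a + c, b + c) \<in> r"
    if "a \<in> monomials V" "b \<in> monomials V" "c \<in> monomials V" "(a, b) \<in> r" for a b c
    using that by (auto simp: r_def reindex_add monomials_add intro: add_right_mono)
  ultimately have "monomial_order V r"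
    unfolding monomial_order_def by blast
  moreover have "lookup a y \<le> lookup b y" if "(a, b) \<in> r" for a b
  proof -
    have "lookup (reindex i a) (i y) \<le> lookup (reindex i b) (i y)"
      using that monom_le_imp_lookup_0_le by (auto simp: r_def i_def)
    then show ?thesis
      using that lookup_reindex[OF i _ assms(2)] by (auto simp: r_def)
  qed
  ultimately show ?thesis using that by blast
qed

section \<open>Minima and leading monomials for a given monomial order\<close>

lemma monomial_orderD:
  assumes "monomial_order V r"
  shows "a \<in> monomials V \<Longrightarrow> (a, a) \<in> r"
    and "(a, b) \<in> r \<Longrightarrow> (b, c) \<in> r \<Longrightarrow> (a, c) \<in> r"
    and "(a, b) \<in> r \<Longrightarrow> (b, a) \<in> r \<Longrightarrow> a = b"
    and "a \<in> monomials V \<Longrightarrow> b \<in> monomials V \<Longrightarrow> (a, b) \<in> r \<or> (b, a) \<in> r"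
    and "a \<in> monomials V \<Longrightarrow> (0, a) \<in> r"
    and "a \<in> monomials V \<Longrightarrow> b \<in> monomials V \<Longrightarrow> c \<in> monomials V \<Longrightarrow> (a, b) \<in> r \<Longrightarrow> (a + c, b + c) \<in> r"
proof -
  have r: "refl_on (monomials V) r" "trans r" "antisym r" "total_on (monomials V) r"
    using assms by (auto simp: monomial_order_def linear_order_on_def partial_order_on_def preorder_on_def)
  show refl: "a \<in> monomials V \<Longrightarrow> (a, a) \<in> r" for a using r(1) by (auto simp: refl_on_def)
  show "(a, b) \<in> r \<Longrightarrow> (b, c) \<in> r \<Longrightarrow> (a, c) \<in> r" using r(2) by (rule transD)
  show "(a, b) \<in> r \<Longrightarrow> (b, a) \<in> r \<Longrightarrow> a = b" using r(3) by (rule antisymD)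
  show "a \<in> monomials V \<Longrightarrow> b \<in> monomials V \<Longrightarrow> (a, b) \<in> r \<or> (b, a) \<in> r"
    using r(4) refl by (cases "a = b") (auto simp: total_on_def)
  show "a \<in> monomials V \<Longrightarrow> (0, a) \<in> r"
    and "a \<in> monomials V \<Longrightarrow> b \<in> monomials V \<Longrightarrow> c \<in> monomials V \<Longrightarrow> (a, b) \<in> r \<Longrightarrow> (a + c, b + c) \<in> r"
    using assms by (simp_all add: monomial_order_def)
qed

lemma linear_order_ex_max:
  assumes "finite M" "M \<noteq> {}" "\<And>a b. a \<in> M \<Longrightarrow> b \<in> M \<Longrightarrow> (a, b) \<in> r \<or> (b, a) \<in> r"
    and trans: "\<And>a b c. (a, b) \<in> r \<Longrightarrow> (b, c) \<in> r \<Longrightarrow> (a, c) \<in> r"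
  shows "\<exists>m\<in>M. \<forall>m'\<in>M. (m', m) \<in> r"
  using assms(1-3)
proof (induction M rule: finite_ne_induct)
  case (insert x M)
  then obtain m where m: "m \<in> M" "\<forall>m'\<in>M. (m', m) \<in> r" by auto
  have "(x, m) \<in> r \<or> (m, x) \<in> r" "(x, x) \<in> r" using insert.prems m(1) by blast+
  then show ?case
    using m trans by blast
qed blast

lemma monomial_order_ex_max:
  assumes r: "monomial_order V r" and "finite M" "M \<noteq> {}" "M \<subseteq> monomials V"
  shows "\<exists>m\<in>M. \<forall>m'\<in>M. (m', m) \<in> r"
  using assms(2-) monomial_orderD(2,4)[OF r] by (intro linear_order_ex_max) blast+

lemma monomial_order_ex_min_finite:
  assumes r: "monomial_order V r" and "finite M" "M \<noteq> {}" "M \<subseteq> monomials V"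
  shows "\<exists>m\<in>M. \<forall>m'\<in>M. (m, m') \<in> r"
proof -
  have "\<exists>m\<in>M. \<forall>m'\<in>M. (m', m) \<in> r\<inverse>"
    using assms(2-) monomial_orderD(2,4)[OF r] by (intro linear_order_ex_max) blast+
  then show ?thesis by simp
qed

lemma monomial_order_le_add:
  assumes r: "monomial_order V r" and "a \<in> monomials V" "b \<in> monomials V"
  shows "(a, a + b) \<in> r"
proof -
  have "(0 + a, b + a) \<in> r"
    using assms by (intro monomial_orderD(5,6)[OF r]) (auto simp: mem_monomials)
  then show ?thesis by (simp add: add.commute)
qed

text \<open>Divisibility implies the order, so the least element of the finite set from Dickson's
  lemma is least in all of \<open>S\<close>. Division arguments terminate for this reason.\<close>

lemma monomial_order_ex_min:
  assumes r: "monomial_order V r" and "finite V" "S \<noteq> {}" "S \<subseteq> monomials V"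
  shows "\<exists>m\<in>S. \<forall>m'\<in>S. (m, m') \<in> r"
proof -
  obtain F where F: "F \<subseteq> S" "finite F" "\<forall>m\<in>S. \<exists>n\<in>F. \<forall>v. lookup n v \<le> lookup m v"
    using dickson[OF assms(2,4)] by blast
  moreover have "F \<noteq> {}" using F assms(3) by blast
  ultimately obtain m where m: "m \<in> F" "\<forall>m'\<in>F. (m, m') \<in> r"
    using monomial_order_ex_min_finite[OF r, of F] assms(4) by blast
  have "(m, m') \<in> r" if m': "m' \<in> S" for m'
  proof -
    obtain n where n: "n \<in> F" "\<And>v. lookup n v \<le> lookup m' v" using F m' by blast
    then have "n + (m' - n) = m'" by (intro monom_le_imp_add)
    moreover have "m' \<in> monomials V" using m' assms(4) by blast
    ultimately have "(n, m') \<in> r"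
      using monomial_order_le_add[OF r, of n "m' - n"] monomials_add[of n "m' - n" V] by simp
    then show ?thesis using m n by (blast intro: monomial_orderD(2)[OF r])
  qed
  then show ?thesis using m F by blast
qed

lemma lead_monom_eqI:
  assumes "monomial_order V r" "m \<in> keys f" "\<And>m'. m' \<in> keys f \<Longrightarrow> (m', m) \<in> r"
  shows "lead_monom r f = m"
  unfolding lead_monom_def using assms monomial_orderD(3)[OF assms(1)] by (intro the_equality) auto

lemma lead_monom:
  assumes r: "monomial_order V r" and f: "f \<in> polys V" "f \<noteq> 0"
  shows "lead_monom r f \<in> keys f" "m \<in> keys f \<Longrightarrow> (m, lead_monom r f) \<in> r"
proof -
  have "keys f \<noteq> {}" using f(2) poly_mapping_sum_single[of f] by auto
  then obtain m0 where "m0 \<in> keys f" "\<forall>m'\<in>keys f. (m', m0) \<in> r"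
    using monomial_order_ex_max[OF r, of "keys f"] f by (auto simp: carrier_iff)
  moreover from this have "lead_monom r f = m0" by (intro lead_monom_eqI[OF r]) auto
  ultimately show "lead_monom r f \<in> keys f" "m \<in> keys f \<Longrightarrow> (m, lead_monom r f) \<in> r" by auto
qed

lemma y_degree_eq_lookup_lead_monom:
  assumes "monomial_order V r" "\<And>a b. (a, b) \<in> r \<Longrightarrow> lookup a y \<le> lookup b y"
    and "f \<in> polys V" "f \<noteq> 0"
  shows "y_degree y f = lookup (lead_monom r f) y"
  unfolding y_degree_def
  by (rule Max_eqI) (use lead_monom[OF assms(1,3,4)] assms(2) in auto)

text \<open>The leading monomial has the largest exponent of \<open>y\<close> in \<open>f\<close>,
  so it survives in \<open>initial_y_form y f\<close> and stays the leading one there.\<close>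

lemma y_compatibleI:
  assumes r: "monomial_order V r" and ry: "\<And>a b. (a, b) \<in> r \<Longrightarrow> lookup a y \<le> lookup b y"
  shows "y_compatible TYPE('k::field) V y r"
  unfolding y_compatible_def
proof
  fix f :: "('a, 'k) mpoly" assume f: "f \<in> polys V"
  show "initial_term r f = initial_term r (initial_y_form y f)"
  proof (cases "f = 0")
    case True
    then show ?thesis by (simp add: initial_term_def initial_y_form_def y_lead_coeff_def)
  next
    case False
    let ?m = "lead_monom r f"
    have d: "lookup ?m y = y_degree y f"
      using y_degree_eq_lookup_lead_monom[OF r ry f False] by simp
    have "lead_monom r (initial_y_form y f) = ?m"
      by (rule lead_monom_eqI[OF r])
        (use d lead_monom[OF r f False] in \<open>auto simp: in_keys_iff lookup_initial_y_form split: if_splits\<close>)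
    then show ?thesis by (simp add: initial_term_def lookup_initial_y_form d)
  qed
qed

text \<open>Dickson's lemma for the set of leading monomials. The divisibility in the second
  conclusion is what the division argument uses, in place of the equality of ideals in the
  definition.\<close>

lemma ex_groebner_basis:
  fixes I :: "('v, 'k::field) mpoly set"
  assumes "finite V" and r: "monomial_order V r" and I: "ideal I (poly_ring V)"
  obtains G where "groebner_basis V r I G"
    and "\<And>f. f \<in> I \<Longrightarrow> f \<noteq> 0 \<Longrightarrow> \<exists>g\<in>G. \<exists>u\<in>monomials V. lead_monom r f = u + lead_monom r g"
proof -
  have IC: "f \<in> polys V" if "f \<in> I" for f using poly_idealD(1)[OF I] that by blast
  define L where "L = lead_monom r ` (I - {0})"
  have LM: "lead_monom r f \<in> monomials V" if "f \<in> I" "f \<noteq> 0" for f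
    using lead_monom(1)[OF r IC[OF that(1)] that(2)] IC[OF that(1)] by (simp add: carrier_iff)
  then have "L \<subseteq> monomials V" unfolding L_def by blast
  from dickson[OF assms(1) this] obtain F
    where F: "F \<subseteq> L" "finite F" "\<forall>m\<in>L. \<exists>n\<in>F. \<forall>v. lookup n v \<le> lookup m v"
    by blast
  from finite_subset_image[OF F(2) F(1)[unfolded L_def]] obtain G
    where G: "G \<subseteq> I - {0}" "finite G" "F = lead_monom r ` G"
    by blast
  have red: "\<exists>g\<in>G. \<exists>u\<in>monomials V. lead_monom r f = u + lead_monom r g" if f: "f \<in> I" "f \<noteq> 0" for f
  proof -
    have "lead_monom r f \<in> L" using f unfolding L_def by blast
    then obtain n where n: "n \<in> F" "\<forall>v. lookup n v \<le> lookup (lead_monom r f) v"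
      using F(3) by blast
    then obtain g where g: "g \<in> G" "\<forall>v. lookup (lead_monom r g) v \<le> lookup (lead_monom r f) v"
      using G(3) by auto
    define u where "u = lead_monom r f - lead_monom r g"
    have u: "lead_monom r f = u + lead_monom r g"
      using monom_le_imp_add[of "lead_monom r g" "lead_monom r f"] g(2) by (simp add: u_def add.commute)
    then have "u \<in> monomials V" using LM[OF f] by (simp add: monomials_add)
    with u g(1) show ?thesis by blast
  qed
  have it_carrier: "initial_term r ` (I - {0}) \<subseteq> polys V"
    using LM by (auto simp: initial_term_def intro!: carrier_single)
  have "initial_term r f \<in> Idl\<^bsub>poly_ring V\<^esub> (initial_term r ` G)" if f: "f \<in> I" "f \<noteq> 0" for f
  proof -
    obtain g u where g: "g \<in> G" "u \<in> monomials V" "lead_monom r f = u + lead_monom r g"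
      using red[OF f] by blast
    then have g0: "g \<in> I" "g \<noteq> 0" using G by auto
    have *: "initial_term r ` G \<subseteq> polys V" using it_carrier G(1) by blast
    let ?c = "lookup f (lead_monom r f)" and ?d = "lookup g (lead_monom r g)"
    have "?d \<noteq> 0" using lead_monom(1)[OF r IC[OF g0(1)] g0(2)] by (simp add: in_keys_iff)
    then have "initial_term r f = single u (?c / ?d) * initial_term r g"
      by (simp add: initial_term_def g(3) mult_single)
    also have "\<dots> \<in> Idl\<^bsub>poly_ring V\<^esub> (initial_term r ` G)"
    proof (rule poly_idealD(4)[OF poly_genideal(1)[OF *]])
      show "initial_term r g \<in> Idl\<^bsub>poly_ring V\<^esub> (initial_term r ` G)" using poly_genideal(2)[OF *] g(1) by blast
    qed (rule carrier_single[OF g(2)])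
    finally show ?thesis .
  qed
  then have "initial_term r ` (I - {0}) \<subseteq> Idl\<^bsub>poly_ring V\<^esub> (initial_term r ` G)" by blast
  then have "Idl\<^bsub>poly_ring V\<^esub> (initial_term r ` (I - {0})) \<subseteq> Idl\<^bsub>poly_ring V\<^esub> (initial_term r ` G)"
    using it_carrier G(1) by (intro genideal_minimal' poly_genideal(1)) blast+
  moreover have "initial_term r ` G \<subseteq> Idl\<^bsub>poly_ring V\<^esub> (initial_term r ` (I - {0}))"
    using poly_genideal(2)[OF it_carrier] G(1) by blast
  then have "Idl\<^bsub>poly_ring V\<^esub> (initial_term r ` G) \<subseteq> Idl\<^bsub>poly_ring V\<^esub> (initial_term r ` (I - {0}))"
    by (rule genideal_minimal'[OF poly_genideal(1)[OF it_carrier]])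
  ultimately have "groebner_basis V r I G"
    using G(1,2) unfolding groebner_basis_def by (intro conjI subset_antisym) auto
  then show ?thesis using red by (rule that)
qed

section \<open>A criterion for a geometric vertex decomposition\<close>

text \<open>Division by \<open>G\<close> for an order that refines the degree in \<open>y\<close>:
  only elements of \<open>G\<close> of degree at most \<open>d\<close> in \<open>y\<close> take
  part, and each step changes the coefficient of y^d by a multiple of a leading coefficient from
  \<open>J\<close>. It is applied with \<open>d = 1\<close> for C and \<open>d = 0\<close> for
  N.\<close>

lemma y_coeff_mem_ideal:
  fixes I :: "('v, 'k::field) mpoly set"
  assumes V: "finite V" and r: "monomial_order V r"
    and ry: "\<And>a b. (a, b) \<in> r \<Longrightarrow> lookup a y \<le> lookup b y"
    and I: "ideal I (poly_ring V)" and J: "ideal J (poly_ring V)"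
    and G: "G \<subseteq> I" "0 \<notin> G"
    and red: "\<And>f. f \<in> I \<Longrightarrow> f \<noteq> 0 \<Longrightarrow> \<exists>g\<in>G. \<exists>u\<in>monomials V. lead_monom r f = u + lead_monom r g"
    and GJ: "\<And>g. g \<in> G \<Longrightarrow> y_degree y g \<le> d \<Longrightarrow> y_lead_coeff y g \<in> J"
    and f: "f \<in> I" "\<And>m. m \<in> keys f \<Longrightarrow> lookup m y \<le> d"
  shows "y_coeff y d f \<in> J"
proof (rule ccontr)
  assume fJ: "y_coeff y d f \<notin> J"
  have IC: "f \<in> polys V" if "f \<in> I" for f using poly_idealD(1)[OF I] that by blast
  \<comment> \<open>The counterexamples; one with least leading monomial is reduced by an element of
    \<open>G\<close> to a smaller one.\<close>
  define B where "B = {f \<in> I. (\<forall>m\<in>keys f. lookup m y \<le> d) \<and> y_coeff y d f \<notin> J}"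
  have nz: "f \<noteq> 0" if "f \<in> B" for f
    using that poly_idealD(2)[OF J] by (auto simp: B_def)
  have BI: "f \<in> I" if "f \<in> B" for f using that by (simp add: B_def)
  have "lead_monom r ` B \<subseteq> monomials V"
    using lead_monom(1)[OF r IC[OF BI] nz] IC[OF BI] by (auto simp: carrier_iff)
  moreover have "lead_monom r ` B \<noteq> {}" using f fJ by (auto simp: B_def)
  ultimately obtain f0 where f0: "f0 \<in> B" "\<And>f'. f' \<in> B \<Longrightarrow> (lead_monom r f0, lead_monom r f') \<in> r"
    using monomial_order_ex_min[OF r V, of "lead_monom r ` B"] by auto
  note f0I = BI[OF f0(1)] and f0nz = nz[OF f0(1)]
  let ?m = "lead_monom r f0"
  have m: "?m \<in> keys f0" "?m \<in> monomials V"
    using lead_monom(1)[OF r IC[OF f0I] f0nz] IC[OF f0I] by (auto simp: carrier_iff)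
  obtain g u where g: "g \<in> G" "u \<in> monomials V" "?m = u + lead_monom r g"
    using red[OF f0I f0nz] by blast
  have gI: "g \<in> I" "g \<noteq> 0" using g G by auto
  let ?n = "lead_monom r g"
  have n: "?n \<in> keys g" "?n \<in> monomials V"
    using lead_monom(1)[OF r IC[OF gI(1)] gI(2)] IC[OF gI(1)] by (auto simp: carrier_iff)
  let ?c = "lookup f0 ?m / lookup g ?n"
  define h where "h = single u ?c * g"
  have hI: "h \<in> I" unfolding h_def using g gI by (intro poly_idealD(4)[OF I]) (auto intro: carrier_single)
  have keys_h: "m' \<in> monomials V \<and> (m', ?m) \<in> r" if m': "m' \<in> keys h" for m'
  proof -
    obtain n' where n': "n' \<in> keys g" "m' = u + n'"
      using m' keys_monom_mult_subset[of u ?c g] unfolding h_def by blast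
    then have "n' \<in> monomials V" "(n', ?n) \<in> r"
      using lead_monom(2)[OF r IC[OF gI(1)] gI(2)] IC[OF gI(1)] by (auto simp: carrier_iff)
    then show ?thesis
      using n' n g monomial_orderD(6)[OF r, of n' ?n u] by (simp add: monomials_add add.commute)
  qed
  have f0_deg: "\<And>m'. m' \<in> keys f0 \<Longrightarrow> lookup m' y \<le> d" using f0(1) by (auto simp: B_def)
  have deg_sum: "lookup u y + y_degree y g \<le> d"
    using f0_deg[OF m(1)] y_degree_eq_lookup_lead_monom[OF r ry IC[OF gI(1)] gI(2)] g(3)
    by (simp add: lookup_add)
  \<comment> \<open>The degree of \<open>h\<close> in \<open>y\<close> is at most \<open>d\<close>.
    If it equals \<open>d\<close>, the coefficient is a multiple of the leading coefficient of
    \<open>g\<close>; otherwise it is 0.\<close>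
  have "y_coeff y d h \<in> J"
  proof (cases "d - lookup u y = y_degree y g")
    case True
    moreover have "single (u - single y (lookup u y)) ?c \<in> polys V"
      using g(2) by (intro carrier_single) (auto simp: mem_monomials in_keys_iff lookup_minus)
    moreover have "y_lead_coeff y g \<in> J" using GJ[OF g(1)] deg_sum by simp
    ultimately show ?thesis
      using deg_sum unfolding h_def y_coeff_monom_mult
      by (auto simp: y_lead_coeff_def intro!: poly_idealD(4)[OF J])
  next
    case False
    then have "y_coeff y (d - lookup u y) g = 0"
      using deg_sum le_y_degree[of _ g y] by (intro y_coeff_eq_0) force
    then show ?thesis
      using poly_idealD(2)[OF J] by (simp add: h_def y_coeff_monom_mult)
  qed
  define f1 where "f1 = f0 - h"
  have "y_coeff y d f1 \<notin> J"
  proof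
    assume "y_coeff y d f1 \<in> J"
    then have "y_coeff y d f1 + y_coeff y d h \<in> J" using \<open>y_coeff y d h \<in> J\<close> by (rule poly_idealD(3)[OF J])
    then show False using f0(1) by (simp add: f1_def y_coeff_diff B_def)
  qed
  moreover have f1I: "f1 \<in> I" unfolding f1_def using f0I hI by (rule poly_idealD(5)[OF I])
  moreover have keys_f1: "m' \<in> keys f0 \<union> keys h" if "m' \<in> keys f1" for m'
    using that keys_diff_subset[of f0 h] by (auto simp: f1_def)
  moreover have "lookup m' y \<le> d" if "m' \<in> keys f1" for m'
    using keys_f1[OF that] f0_deg keys_h ry f0_deg[OF m(1)] by (meson UnE order.trans)
  ultimately have f1: "f1 \<in> B" by (simp add: B_def)
  let ?k = "lead_monom r f1"
  have k: "?k \<in> keys f1" using lead_monom(1)[OF r IC[OF f1I] nz[OF f1]] .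
  \<comment> \<open>\<open>?c\<close> was chosen to cancel the leading terms, so the leading
    monomial of \<open>f1\<close> is strictly smaller than \<open>?m\<close>.\<close>
  have "lookup f1 ?m = 0"
    using n(1) lookup_monom_mult[of u ?c g ?n] by (simp add: f1_def lookup_minus h_def g(3) in_keys_iff)
  then have "?k \<noteq> ?m" using k by (auto simp: in_keys_iff)
  moreover have "(?k, ?m) \<in> r"
    using keys_f1[OF k] keys_h lead_monom(2)[OF r IC[OF f0I] f0nz] by blast
  ultimately show False using f0(2)[OF f1] monomial_orderD(3)[OF r] by blast
qed

text \<open>For an ideal \<open>J\<close> of K[V - {y}] this is its extension to K[V], written
  coefficientwise so that contracting it returns \<open>J\<close> at once.\<close>

definition extend_ideal :: "'v set \<Rightarrow> 'v \<Rightarrow> ('v, 'k::field) mpoly set \<Rightarrow> ('v, 'k) mpoly set" where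
  "extend_ideal V y J = {f \<in> polys V. \<forall>i. y_coeff y i f \<in> J}"

lemma ideal_extend_ideal:
  fixes J :: "('v, 'k::field) mpoly set"
  assumes J: "ideal J (poly_ring (V - {y}))"
  shows "ideal (extend_ideal V y J) (poly_ring V)"
proof (rule poly_idealI)
  fix f g :: "('v, 'k) mpoly"
  assume f: "f \<in> polys V" and g: "g \<in> extend_ideal V y J"
  have "y_coeff y i (single m c * g) \<in> J" if "m \<in> monomials V" for m c i
  proof -
    have "m - single y (lookup m y) \<in> monomials (V - {y})"
      using that by (auto simp: mem_monomials in_keys_iff lookup_minus lookup_single when_def)
    then show ?thesis
      using g poly_idealD(2)[OF J]
      by (auto simp: y_coeff_monom_mult extend_ideal_def intro!: poly_idealD(4)[OF J] carrier_single)
  qed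
  then have "y_coeff y i (\<Sum>m\<in>keys f. single m (lookup f m) * g) \<in> J" for i
    unfolding y_coeff_sum using f by (intro poly_ideal_sum[OF J]) (auto simp: carrier_iff)
  then have "y_coeff y i (f * g) \<in> J" for i
    by (simp add: poly_mapping_sum_single flip: sum_distrib_right)
  then show "f * g \<in> extend_ideal V y J"
    using f g by (auto simp: extend_ideal_def carrier_mult)
qed (auto simp: extend_ideal_def carrier_add y_coeff_add poly_idealD[OF J])

lemma extend_ideal_contract:
  assumes J: "ideal J (poly_ring (V - {y}))"
  shows "extend_ideal V y J \<inter> polys (V - {y}) = J"
proof -
  have JC: "f \<in> polys (V - {y})" if "f \<in> J" for f
    using that poly_idealD(1)[OF J] by blast
  have "f \<in> extend_ideal V y J \<longleftrightarrow> f \<in> J" if f: "f \<in> polys (V - {y})" for f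
  proof -
    have "f \<in> polys V" using f carrier_mono[of "V - {y}" V] by blast
    then have "f \<in> extend_ideal V y J \<longleftrightarrow> (\<forall>i :: nat. (if i = 0 then f else 0) \<in> J)"
      by (simp add: extend_ideal_def y_coeff_of_carrier[OF f])
    then show ?thesis
      using poly_idealD(2)[OF J] by auto
  qed
  then show ?thesis using JC by blast
qed

text \<open>Every term of positive degree in \<open>y\<close> is a multiple of its coefficient times
  \<open>y\<close>. The constant coefficient is treated apart because it will come from N, the
  others from C.\<close>

lemma mem_ideal_if_y_coeff_mem:
  assumes I: "ideal I (poly_ring V)" and y: "y \<in> V" and f: "f \<in> polys V"
    and "y_coeff y 0 f \<in> I" and "\<And>i. y_coeff y (Suc i) f * Var y \<in> I"
  shows "f \<in> I"
proof -
  obtain d where d: "\<And>m. m \<in> keys f \<Longrightarrow> lookup m y \<le> d" using y_bound_exists[of f y] by blast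
  have "y_coeff y i f * Var y ^ i \<in> I" for i
  proof (cases i)
    case (Suc j)
    have "Var y ^ j \<in> polys V"
      using y by (simp add: Var_power carrier_single single_mem_monomials)
    then have "Var y ^ j * (y_coeff y (Suc j) f * Var y) \<in> I"
      using assms(5) by (rule poly_idealD(4)[OF I])
    then show ?thesis by (simp add: Suc mult_ac)
  qed (use assms(4) in simp)
  then have "(\<Sum>i\<le>d. y_coeff y i f * Var y ^ i) \<in> I" by (intro poly_ideal_sum[OF I])
  then show ?thesis using y_expansion[of f y d] d by simp
qed

text \<open>The ideals \<open>C\<close> and \<open>N\<close> of the smaller ring are guessed in
  advance. By \<open>top\<close> and \<open>elim\<close>, the initial form of an element of
  \<open>I\<close> has its coefficient in \<open>C\<close>, and in \<open>N\<close> if its degree in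
  \<open>y\<close> is 0. Conversely, \<open>lift\<close> produces q y as an initial form for every q
  in \<open>C\<close>. Hence the initial ideal consists of the polynomials with all coefficients in
  \<open>C\<close> and constant coefficient in \<open>N\<close>, which is the required
  intersection.\<close>

theorem GVD_decomposeI:
  fixes I :: "('v, 'k::field) mpoly set"
  assumes V: "finite V" "y \<in> V" and I: "ideal I (poly_ring V)" "unmixed (poly_ring V) I"
    and C: "ideal C (poly_ring (V - {y}))" "GVD (V - {y}) C"
    and N: "ideal N (poly_ring (V - {y}))" "GVD (V - {y}) N"
    and top: "\<And>f d. f \<in> I \<Longrightarrow> (\<And>m. m \<in> keys f \<Longrightarrow> lookup m y \<le> d) \<Longrightarrow> y_coeff y d f \<in> C"
    and elim: "I \<inter> polys (V - {y}) = N"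
    and lift: "\<And>q. q \<in> C \<Longrightarrow> \<exists>r\<in>polys (V - {y}). q * Var y - r \<in> I"
  shows "GVD V I"
proof -
  obtain r where r: "monomial_order V r" and ry: "\<And>a b. (a, b) \<in> r \<Longrightarrow> lookup a y \<le> lookup b y"
    using ex_y_order[OF V] by blast
  obtain G where G: "groebner_basis V r I G"
    and red: "\<And>f. f \<in> I \<Longrightarrow> f \<noteq> 0 \<Longrightarrow> \<exists>g\<in>G. \<exists>u\<in>monomials V. lead_monom r f = u + lead_monom r g"
    using ex_groebner_basis[OF V(1) r I(1)] by blast
  have GI: "G \<subseteq> I" "0 \<notin> G" using G by (auto simp: groebner_basis_def)
  have IC: "f \<in> polys V" if "f \<in> I" for f using poly_idealD(1)[OF I(1)] that by blast
  have CC: "q \<in> polys (V - {y})" if "q \<in> C" for q using poly_idealD(1)[OF C(1)] that by blast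
  have up: "q \<in> polys V" if "q \<in> polys (V - {y})" for q
    using that carrier_mono[of "V - {y}" V] by blast
  have Vy: "Var y \<in> polys V" using V(2) by (rule carrier_Var)
  have mem: "y_coeff y d f \<in> J"
    if "ideal J (poly_ring V)" "\<And>g. g \<in> G \<Longrightarrow> y_degree y g \<le> d \<Longrightarrow> y_lead_coeff y g \<in> J"
      and "f \<in> I" "\<And>m. m \<in> keys f \<Longrightarrow> lookup m y \<le> d" for J d f
    by (rule y_coeff_mem_ideal[OF V(1) r ry I(1) that(1) GI red that(2-4)])
  have lead_C: "y_lead_coeff y f \<in> C" if "f \<in> I" for f
    unfolding y_lead_coeff_def using that le_y_degree by (rule top)
  have low: "f \<in> N" if "f \<in> I" "\<And>m. m \<in> keys f \<Longrightarrow> lookup m y = 0" for f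
  proof -
    have "f \<in> polys (V - {y})"
      using IC[OF that(1)] that(2) by (auto simp: carrier_iff monomials_minus_y)
    then show ?thesis using elim that(1) by blast
  qed
  have NI: "N \<subseteq> I" using elim by blast
  have NC: "N \<subseteq> C"
  proof
    fix f assume f: "f \<in> N"
    then have fc: "f \<in> polys (V - {y})" "f \<in> I" using elim by auto
    then have "y_coeff y 0 f \<in> C" by (intro top) (auto simp: carrier_iff monomials_minus_y)
    then show "f \<in> C" using y_coeff_of_carrier[OF fc(1)] by simp
  qed
  let ?CG = "C_ideal V y G" and ?NG = "N_ideal V y G"
  have lc_carrier: "y_lead_coeff y ` G \<subseteq> polys V"
    using lead_C CC up GI by blast
  then have lc_carrier': "y_lead_coeff y ` {g \<in> G. y_degree y g = 0} \<subseteq> polys V" by blast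
  note CG = poly_genideal[OF lc_carrier, folded C_ideal_def]
  note NG = poly_genideal[OF lc_carrier', folded N_ideal_def]
  \<comment> \<open>The lifted element has degree at most 1 in \<open>y\<close>, and q is its
    coefficient of \<open>y\<close>; q may be 0.\<close>
  have lift': "\<exists>f\<in>I. (\<forall>m\<in>keys f. lookup m y \<le> 1) \<and> y_coeff y 1 f = q" if q: "q \<in> C" for q
  proof -
    obtain s where s: "s \<in> polys (V - {y})" "q * Var y - s \<in> I" using lift[OF q] by blast
    have "lookup m y \<le> 1" if m: "m \<in> keys (q * Var y - s)" for m
    proof -
      have "m \<in> (+) (single y 1) ` keys q \<union> keys s"
        using m keys_diff_subset[of "q * Var y" s] keys_monom_mult_subset[of "single y 1" 1 q]
        by (auto simp: Var_def mult.commute)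
      then show ?thesis
        using s(1) CC[OF q] by (auto simp: carrier_iff monomials_minus_y lookup_add)
    qed
    moreover have "y_coeff y 1 (q * Var y - s) = q"
      using y_coeff_mult_Var_power[OF CC[OF q], of 1 1] y_coeff_of_carrier[OF s(1), of 1]
      by (simp add: y_coeff_diff)
    ultimately show ?thesis using s(2) by blast
  qed
  \<comment> \<open>\<open>mem\<close> with \<open>d = 1\<close>: the coefficient of
    \<open>y\<close> in a lifted element is generated by leading coefficients from
    \<open>G\<close>.\<close>
  have C_CG: "C \<subseteq> ?CG"
  proof
    fix q assume "q \<in> C"
    from lift'[OF this] obtain f
      where f: "f \<in> I" "\<forall>m\<in>keys f. lookup m y \<le> 1" "y_coeff y 1 f = q" by blast
    have "y_coeff y 1 f \<in> ?CG"
      using CG(2) f by (intro mem[OF CG(1)]) auto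
    then show "q \<in> ?CG" by (simp only: f(3))
  qed
  \<comment> \<open>\<open>mem\<close> with \<open>d = 0\<close>, where only the elements of
    \<open>G\<close> free of \<open>y\<close> are used.\<close>
  have N_NG: "N \<subseteq> ?NG"
  proof
    fix f assume "f \<in> N"
    then have f: "f \<in> polys (V - {y})" "f \<in> I" using elim by auto
    then have "lookup m y \<le> 0" if "m \<in> keys f" for m
      using that by (simp add: carrier_iff monomials_minus_y)
    then have "y_coeff y 0 f \<in> ?NG"
      using NG(2) f(2) by (intro mem[OF NG(1)]) auto
    then show "f \<in> ?NG" using y_coeff_of_carrier[OF f(1)] by simp
  qed
  \<comment> \<open>An ideal between \<open>J\<close> and its extension is the whole extension, as
    it contains all coefficients and with them their multiples by powers of
    \<open>y\<close>.\<close>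
  have ext_eq: "J' = extend_ideal V y J"
    if J: "ideal J (poly_ring (V - {y}))" and J': "ideal J' (poly_ring V)" "J \<subseteq> J'" "J' \<subseteq> extend_ideal V y J"
    for J J' :: "('v, 'k) mpoly set"
  proof
    show "extend_ideal V y J \<subseteq> J'"
    proof
      fix f assume f: "f \<in> extend_ideal V y J"
      then have *: "y_coeff y i f \<in> J'" for i using J'(2) by (auto simp: extend_ideal_def)
      have "Var y * y_coeff y (Suc i) f \<in> J'" for i using poly_idealD(4)[OF J'(1) Vy *] .
      then show "f \<in> J'"
        using f * by (simp add: mem_ideal_if_y_coeff_mem[OF J'(1) V(2)] extend_ideal_def mult.commute)
    qed
  qed (rule J'(3))
  have CG_eq: "?CG = extend_ideal V y C"
  proof (rule ext_eq[OF C(1) CG(1) C_CG])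
    have "C \<subseteq> extend_ideal V y C" using extend_ideal_contract[OF C(1)] by blast
    then show "?CG \<subseteq> extend_ideal V y C"
      unfolding C_ideal_def using lead_C GI(1)
      by (intro genideal_minimal' ideal_extend_ideal C(1)) auto
  qed
  have deg0: "f \<in> N \<and> y_lead_coeff y f = f" if "f \<in> I" "y_degree y f = 0" for f
  proof -
    have "lookup m y = 0" if "m \<in> keys f" for m using le_y_degree[OF that, of y] \<open>y_degree y f = 0\<close> by simp
    then have "f \<in> N" using low \<open>f \<in> I\<close> by blast
    then have "f \<in> polys (V - {y})" using elim by blast
    then show ?thesis using \<open>f \<in> N\<close> that(2) by (simp add: y_lead_coeff_def y_coeff_of_carrier)
  qed
  have NG_eq: "?NG = extend_ideal V y N"
  proof (rule ext_eq[OF N(1) NG(1) N_NG])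
    have "N \<subseteq> extend_ideal V y N" using extend_ideal_contract[OF N(1)] by blast
    moreover have "y_lead_coeff y g \<in> N" if "g \<in> G" "y_degree y g = 0" for g
      using deg0[of g] that GI(1) by auto
    ultimately show "?NG \<subseteq> extend_ideal V y N"
      unfolding N_ideal_def by (intro genideal_minimal' ideal_extend_ideal N(1)) auto
  qed
  have Vy': "{Var y} \<subseteq> carrier (poly_ring V :: ('v, 'k) mpoly ring)" using Vy by simp
  note YI = poly_genideal[OF Vy']
  have Y_sub: "Idl\<^bsub>poly_ring V\<^esub> {Var y} \<subseteq> {f \<in> polys V. y_coeff y 0 f = (0 :: ('v, 'k) mpoly)}"
  proof (rule genideal_minimal')
    show "ideal {f \<in> polys V. y_coeff y 0 f = (0 :: ('v, 'k) mpoly)} (poly_ring V)"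
    proof (rule poly_idealI)
      fix f g :: "('v, 'k) mpoly"
      assume f: "f \<in> polys V" and g: "g \<in> {f \<in> polys V. y_coeff y 0 f = 0}"
      have "y_coeff y 0 (f * g) = (\<Sum>m\<in>keys f. y_coeff y 0 (single m (lookup f m) * g))"
        by (simp add: poly_mapping_sum_single flip: sum_distrib_right y_coeff_sum)
      also have "\<dots> = 0"
        by (rule sum.neutral) (use g in \<open>simp add: y_coeff_monom_mult\<close>)
      finally have "y_coeff y 0 (f * g) = 0" .
      then show "f * g \<in> {f \<in> polys V. y_coeff y 0 f = 0}"
        using f g by (simp add: carrier_mult)
    qed (auto simp: carrier_add y_coeff_add)
    show "{Var y} \<subseteq> {f \<in> polys V. y_coeff y 0 f = 0}"
      using Vy by (simp add: Var_def y_coeff_single)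
  qed
  \<comment> \<open>Modulo \<open>y\<close> only the constant coefficient remains.\<close>
  have NY: "?NG <+>\<^bsub>poly_ring V\<^esub> Idl\<^bsub>poly_ring V\<^esub> {Var y} =
      {f \<in> polys V. y_coeff y 0 f \<in> N}" (is "?l = ?r")
  proof
    show "?l \<subseteq> ?r"
    proof
      fix f assume "f \<in> ?l"
      then obtain n h where nh: "f = n + h" "n \<in> ?NG" "h \<in> Idl\<^bsub>poly_ring V\<^esub> {Var y}"
        by (auto simp: set_add_def')
      then have "h \<in> polys V" "y_coeff y 0 h = 0" using Y_sub by auto
      then show "f \<in> ?r" using nh(1,2) by (auto simp: NG_eq extend_ideal_def carrier_add y_coeff_add)
    qed
    show "?r \<subseteq> ?l"
    proof
      fix f assume f: "f \<in> ?r"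
      let ?f0 = "y_coeff y 0 f"
      have f0c: "?f0 \<in> polys (V - {y})" using f by (simp add: y_coeff_carrier)
      have "f - ?f0 \<in> Idl\<^bsub>poly_ring V\<^esub> {Var y}"
      proof (rule mem_ideal_if_y_coeff_mem[OF YI(1) V(2)])
        show "f - ?f0 \<in> polys V" using f up[OF f0c] by (intro carrier_diff) auto
        show "y_coeff y 0 (f - ?f0) \<in> Idl\<^bsub>poly_ring V\<^esub> {Var y}"
          using poly_idealD(2)[OF YI(1)] by (simp add: y_coeff_diff y_coeff_of_carrier[OF f0c])
        fix i
        have "y_coeff y (Suc i) (f - ?f0) \<in> polys V"
          using \<open>f - ?f0 \<in> polys V\<close> by (rule up[OF y_coeff_carrier])
        then show "y_coeff y (Suc i) (f - ?f0) * Var y \<in> Idl\<^bsub>poly_ring V\<^esub> {Var y}"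
          using YI(2) by (intro poly_idealD(4)[OF YI(1)]) auto
      qed
      moreover have "?f0 \<in> ?NG" using f N_NG by auto
      moreover have "f = ?f0 + (f - ?f0)" by simp
      ultimately show "f \<in> ?l" by (force simp: set_add_def')
    qed
  qed
  have form_carrier: "initial_y_form y f \<in> polys V" if "f \<in> I" for f
    unfolding initial_y_form_def using lead_C[OF that] CC up V(2)
    by (intro carrier_mult) (auto simp: Var_power intro: carrier_single single_mem_monomials)
  have IY: "initial_y_form y ` (I - {0}) \<subseteq> polys V" using form_carrier by blast
  note IYI = poly_genideal[OF IY, folded initial_y_ideal_def]
  have in_eq: "initial_y_ideal V y I = ?CG \<inter> (?NG <+>\<^bsub>poly_ring V\<^esub> Idl\<^bsub>poly_ring V\<^esub> {Var y})"
  proof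
    \<comment> \<open>The initial form has a single coefficient that can be nonzero, the leading
      one.\<close>
    have "initial_y_form y f \<in> extend_ideal V y C \<inter> {f \<in> polys V. y_coeff y 0 f \<in> N}"
      if f: "f \<in> I" for f
    proof -
      have *: "y_coeff y i (initial_y_form y f) = (if i = y_degree y f then y_lead_coeff y f else 0)" for i
        unfolding initial_y_form_def using CC[OF lead_C[OF f]] by (simp add: y_coeff_mult_Var_power)
      then have "y_coeff y 0 (initial_y_form y f) \<in> N"
        using deg0[OF f] poly_idealD(2)[OF N(1)] by auto
      then show ?thesis
        using lead_C[OF f] form_carrier[OF f] poly_idealD(2)[OF C(1)] by (auto simp: extend_ideal_def *)
    qed
    moreover have "ideal {f \<in> polys V. y_coeff y 0 f \<in> N} (poly_ring V)"
    proof -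
      interpret cring "poly_ring V :: ('v, 'k) mpoly ring" by (rule cring_poly_ring)
      show ?thesis unfolding NY[symmetric] by (rule add_ideals[OF NG(1) YI(1)])
    qed
    then have "ideal (extend_ideal V y C \<inter> {f \<in> polys V. y_coeff y 0 f \<in> N}) (poly_ring V)"
      using ideal_extend_ideal[OF C(1)] by (rule ring.i_intersect[OF cring.axioms(1)[OF cring_poly_ring], rotated])
    ultimately show "initial_y_ideal V y I \<subseteq> ?CG \<inter> (?NG <+>\<^bsub>poly_ring V\<^esub> Idl\<^bsub>poly_ring V\<^esub> {Var y})"
      unfolding NY CG_eq initial_y_ideal_def by (intro genideal_minimal') auto
    show "?CG \<inter> (?NG <+>\<^bsub>poly_ring V\<^esub> Idl\<^bsub>poly_ring V\<^esub> {Var y}) \<subseteq> initial_y_ideal V y I"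
      unfolding NY CG_eq
    proof safe
      \<comment> \<open>Expand \<open>f\<close> in powers of \<open>y\<close>: the constant
        coefficient is in \<open>N\<close> and is its own initial form, and each other coefficient
        times \<open>y\<close> is the initial form of a lifted element.\<close>
      fix f assume f: "f \<in> extend_ideal V y C" "f \<in> polys V" "y_coeff y 0 f \<in> N"
      have mem0: "q \<in> initial_y_ideal V y I" if "q \<in> N" for q
      proof (cases "q = 0")
        case False
        have "q \<in> I" and q: "q \<in> polys (V - {y})" using that elim by auto
        have "lookup m y \<le> 0" if "m \<in> keys q" for m
          using q that by (simp add: carrier_iff monomials_minus_y)
        then have "initial_y_form y q = q"
          using initial_y_form_eqI[of q y 0] False by (simp add: y_coeff_of_carrier[OF q])
        then have "q \<in> initial_y_form y ` (I - {0})" using \<open>q \<in> I\<close> False by force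
        then show ?thesis using IYI(2) by blast
      qed (use poly_idealD(2)[OF IYI(1)] in simp)
      have mem1: "q * Var y \<in> initial_y_ideal V y I" if q: "q \<in> C" for q
      proof (cases "q = 0")
        case False
        obtain h where h: "h \<in> I" "\<forall>m\<in>keys h. lookup m y \<le> 1" "y_coeff y 1 h = q" using lift'[OF q] by blast
        then have "initial_y_form y h = q * Var y"
          using initial_y_form_eqI[of h y 1] False by auto
        moreover have "h \<noteq> 0" using h(3) False by auto
        ultimately have "q * Var y \<in> initial_y_form y ` (I - {0})" using h(1) by force
        then show ?thesis using IYI(2) by blast
      qed (use poly_idealD(2)[OF IYI(1)] in simp)
      show "f \<in> initial_y_ideal V y I"
        using f(1) by (intro mem_ideal_if_y_coeff_mem[OF IYI(1) V(2) f(2) mem0[OF f(3)]] mem1)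
          (simp add: extend_ideal_def)
    qed
  qed
  show ?thesis
    using C(2) N(2)
    by (intro GVD.decompose[OF I V(2) r y_compatibleI[OF r ry] G in_eq])
      (simp_all add: CG_eq NG_eq extend_ideal_contract C(1) N(1))
qed

section \<open>Heights of prime ideals\<close>

text \<open>The bound is on each exponent and not on the total degree, so that the number of
  monomials is exactly a power, with the number of variables as exponent.\<close>

definition exponents_le :: "nat \<Rightarrow> ('v, 'k::field) mpoly \<Rightarrow> bool" where
  "exponents_le d f \<longleftrightarrow> (\<forall>m\<in>keys f. \<forall>v. lookup m v \<le> d)"

lemma exponents_le_mult:
  assumes "exponents_le d f" "exponents_le e g"
  shows "exponents_le (d + e) (f * g)"
  unfolding exponents_le_def
proof (intro ballI allI)
  fix m v assume "m \<in> keys (f * g)"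
  then obtain a b where "m = a + b" "a \<in> keys f" "b \<in> keys g"
    using keys_mult[of f g] by auto
  then show "lookup m v \<le> d + e"
    using assms by (simp add: exponents_le_def lookup_add add_mono)
qed

lemma exponents_le_power: "exponents_le d f \<Longrightarrow> exponents_le (n * d) (f ^ n)"
proof (induction n)
  case 0
  show ?case by (simp add: exponents_le_def)
next
  case (Suc n)
  then show ?case using exponents_le_mult[of d f "n * d" "f ^ n"] by simp
qed

lemma exponents_le_mono: "exponents_le d f \<Longrightarrow> d \<le> e \<Longrightarrow> exponents_le e f"
  unfolding exponents_le_def using order.trans by blast

lemma ex_exponents_le: "\<exists>d. exponents_le d f"
proof -
  have "lookup m v \<le> (\<Sum>m\<in>keys f. \<Sum>v\<in>keys m. lookup m v)" if "m \<in> keys f" for m v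
  proof (cases "v \<in> keys m")
    case True
    have "lookup m v \<le> (\<Sum>v\<in>keys m. lookup m v)" using True by (intro member_le_sum) auto
    also have "\<dots> \<le> (\<Sum>m\<in>keys f. \<Sum>v\<in>keys m. lookup m v)"
      using that by (intro member_le_sum[where f = "\<lambda>m. \<Sum>v\<in>keys m. lookup m v"]) auto
    finally show ?thesis .
  next
    case False
    then show ?thesis by (simp add: in_keys_iff)
  qed
  then show ?thesis unfolding exponents_le_def by blast
qed

lemma card_bounded_monomials:
  assumes V: "finite V"
  shows "finite {m \<in> monomials V. \<forall>v. lookup m v \<le> d}" (is "finite ?M")
    and "card {m \<in> monomials V. \<forall>v. lookup m v \<le> d} = Suc d ^ card V"
proof -
  have bij: "bij_betw (\<lambda>m. restrict (lookup m) V) ?M (V \<rightarrow>\<^sub>E {..d})"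
    unfolding bij_betw_def
  proof
    show "inj_on (\<lambda>m. restrict (lookup m) V) ?M"
    proof (rule inj_onI, rule poly_mapping_eqI)
      fix m n v assume *: "m \<in> ?M" "n \<in> ?M" "restrict (lookup m) V = restrict (lookup n) V"
      show "lookup m v = lookup n v"
      proof (cases "v \<in> V")
        case True
        then show ?thesis using fun_cong[OF *(3), of v] by simp
      next
        case False
        then have "v \<notin> keys m" "v \<notin> keys n" using * by (auto simp: mem_monomials)
        then show ?thesis by (simp add: in_keys_iff)
      qed
    qed
    show "(\<lambda>m. restrict (lookup m) V) ` ?M = V \<rightarrow>\<^sub>E {..d}"
    proof
      show "V \<rightarrow>\<^sub>E {..d} \<subseteq> (\<lambda>m. restrict (lookup m) V) ` ?M"
      proof
        fix h assume h: "h \<in> V \<rightarrow>\<^sub>E {..d}"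
        define m where "m = Abs_poly_mapping (\<lambda>v. if v \<in> V then h v else 0)"
        have "finite {v. (if v \<in> V then h v else 0) \<noteq> 0}"
          by (rule finite_subset[OF _ V]) auto
        then have m: "lookup m v = (if v \<in> V then h v else 0)" for v
          by (simp add: m_def)
        have "restrict (lookup m) V = h"
          using h by (intro ext) (auto simp: m restrict_def PiE_iff extensional_def)
        moreover have "m \<in> ?M"
          using h by (auto simp: mem_monomials in_keys_iff m PiE_iff split: if_splits)
        ultimately show "h \<in> (\<lambda>m. restrict (lookup m) V) ` ?M" by blast
      qed
    qed auto
  qed
  have fin: "finite (V \<rightarrow>\<^sub>E {..d})" using V by (intro finite_PiE) auto
  then show "finite ?M" using bij_betw_finite[OF bij] by simp
  show "card ?M = Suc d ^ card V"
    using bij_betw_same_card[OF bij] card_PiE[OF V, of "\<lambda>_. {..d}"] by simp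
qed

text \<open>There are \<open>n\<close> polynomials with exponents at most \<open>d\<close> that are
  linearly independent over K modulo \<open>P\<close>. How \<open>n\<close> can grow with
  \<open>d\<close> measures the dimension of the quotient by \<open>P\<close>.\<close>

definition ex_independent_mod ::
    "'v set \<Rightarrow> ('v, 'k::field) mpoly set \<Rightarrow> nat \<Rightarrow> nat \<Rightarrow> bool" where
  "ex_independent_mod V P n d \<longleftrightarrow>
     (\<exists>g. (\<forall>j<n. g j \<in> polys V \<and> exponents_le d (g j)) \<and>
        (\<forall>a. (\<Sum>j<n. Const (a j) * g j) \<in> P \<longrightarrow> (\<forall>j<n. a j = 0)))"

text \<open>No nonzero polynomial in the variables of \<open>S\<close> lies in \<open>P\<close>, so
  the bounded monomials in these variables are independent.\<close>

lemma ex_independent_mod_monomials: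
  fixes P :: "('v, 'k::field) mpoly set"
  assumes S: "finite S" "S \<subseteq> V" and P: "P \<inter> polys S \<subseteq> {0}"
  shows "ex_independent_mod V P (Suc d ^ card S) d"
proof -
  let ?M = "{m \<in> monomials S. \<forall>v. lookup m v \<le> d}" and ?n = "Suc d ^ card S"
  obtain h where h: "bij_betw h {..<?n} ?M"
    using ex_bij_betw_nat_finite[OF card_bounded_monomials(1)[OF S(1), of d]]
    by (auto simp: card_bounded_monomials(2)[OF S(1)] lessThan_atLeast0)
  have hM: "h j \<in> ?M" if "j < ?n" for j using bij_betwE[OF h] that by blast
  define g :: "nat \<Rightarrow> ('v, 'k) mpoly" where "g j = single (h j) 1" for j
  have "a j = 0" if a: "(\<Sum>j<?n. Const (a j) * g j) \<in> P" and j: "j < ?n" for a j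
  proof -
    have "(\<Sum>j<?n. Const (a j) * g j) \<in> polys S"
      using hM by (intro carrier_sum) (auto simp: g_def Const_mult_single intro!: carrier_single)
    then have "(\<Sum>j<?n. Const (a j) * g j) = 0" using a P by blast
    then have "lookup (\<Sum>i<?n. Const (a i) * g i) (h j) = 0" by simp
    moreover have "lookup (\<Sum>i<?n. Const (a i) * g i) (h j) = (\<Sum>i<?n. if i = j then a i else 0)"
      unfolding lookup_sum
    proof (rule sum.cong)
      fix i assume "i \<in> {..<?n}"
      then have "h i = h j \<longleftrightarrow> i = j" using h j by (auto simp: bij_betw_def dest: inj_onD)
      then show "lookup (Const (a i) * g i) (h j) = (if i = j then a i else 0)"
        by (simp add: g_def Const_mult_single lookup_single when_def)
    qed simp
    ultimately show ?thesis using j by simp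
  qed
  moreover have "g j \<in> polys V \<and> exponents_le d (g j)" if "j < ?n" for j
    using hM[OF that] monomials_mono[OF S(2)]
    by (auto simp: g_def exponents_le_def intro!: carrier_single)
  ultimately show ?thesis unfolding ex_independent_mod_def by blast
qed

text \<open>Modulo \<open>Q\<close> only the term with f^0 survives, so its coefficients vanish.
  What remains is a multiple of \<open>f\<close>; as \<open>P\<close> is prime and \<open>f\<close>
  is not in it, \<open>f\<close> can be cancelled and the argument repeated.\<close>

lemma power_combination_independent:
  fixes P :: "('v, 'k::field) mpoly set"
  assumes P: "primeideal P (poly_ring V)" and Q: "ideal Q (poly_ring V)" and "P \<subseteq> Q"
    and f: "f \<in> Q" "f \<notin> P"
    and g: "\<And>j. j < n \<Longrightarrow> g j \<in> polys V"
    and ind: "\<And>a j. (\<Sum>j<n. Const (a j) * g j) \<in> Q \<Longrightarrow> j < n \<Longrightarrow> a j = 0"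
    and "(\<Sum>i<k. f ^ i * (\<Sum>j<n. Const (b i j) * g j)) \<in> P" and "i < k" "j < n"
  shows "b i j = 0"
  using assms(8-)
proof (induction k arbitrary: b i)
  case (Suc k)
  have fc: "f \<in> polys V" using f(1) poly_idealD(1)[OF Q] by blast
  have gc: "(\<Sum>j<n. Const (a j) * g j) \<in> polys V" for a
    using g by (intro carrier_sum carrier_mult) auto
  have pc: "f ^ i \<in> polys V" for i
    using fc by (induction i) (auto intro: carrier_mult)
  define r where "r = (\<Sum>i<k. f ^ i * (\<Sum>j<n. Const (b (Suc i) j) * g j))"
  have rc: "r \<in> polys V"
    unfolding r_def by (intro carrier_sum carrier_mult pc gc)
  have eq: "(\<Sum>i<Suc k. f ^ i * (\<Sum>j<n. Const (b i j) * g j)) = (\<Sum>j<n. Const (b 0 j) * g j) + f * r"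
    unfolding sum.lessThan_Suc_shift r_def sum_distrib_left by (simp add: mult.assoc)
  then have mem: "(\<Sum>j<n. Const (b 0 j) * g j) + f * r \<in> P" using Suc.prems(1) by simp
  moreover have "r * f \<in> Q" using poly_idealD(4)[OF Q rc f(1)] .
  ultimately have "(\<Sum>j<n. Const (b 0 j) * g j) + f * r - f * r \<in> Q"
    using \<open>P \<subseteq> Q\<close> by (intro poly_idealD(5)[OF Q]) (auto simp: mult.commute)
  then have b0: "b 0 j = 0" if "j < n" for j using that ind[of "b 0"] by simp
  then have "f * r \<in> P" using mem by (simp add: Const_def)
  then have "r \<in> P"
    using primeideal.I_prime[OF P fc rc] f(2) by auto
  then show ?case
    using Suc.IH[of "\<lambda>i. b (Suc i)"] b0 Suc.prems(2,3) by (cases i) (auto simp: r_def)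
qed simp

text \<open>A proper inclusion of \<open>P\<close> in \<open>Q\<close> acts like one more free
  variable \<open>f\<close>: multiplying by its powers from 0 to \<open>k\<close> turns
  \<open>n\<close> independent elements into (k + 1) n.\<close>

lemma ex_independent_mod_step:
  fixes P :: "('v, 'k::field) mpoly set"
  assumes P: "primeideal P (poly_ring V)" and Q: "ideal Q (poly_ring V)" and PQ: "P \<subseteq> Q"
    and f: "f \<in> Q" "f \<notin> P" "exponents_le e f" and ind: "ex_independent_mod V Q n d"
  shows "ex_independent_mod V P (Suc k * n) (k * e + d)"
proof (cases "n = 0")
  case True
  then show ?thesis by (simp add: ex_independent_mod_def)
next
  case False
  obtain g where g: "\<And>j. j < n \<Longrightarrow> g j \<in> polys V" "\<And>j. j < n \<Longrightarrow> exponents_le d (g j)"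
    and g_ind: "\<And>a j. (\<Sum>j<n. Const (a j) * g j) \<in> Q \<Longrightarrow> j < n \<Longrightarrow> a j = 0"
    using ind unfolding ex_independent_mod_def by blast
  have fc: "f \<in> polys V" using f(1) poly_idealD(1)[OF Q] by blast
  have pc: "f ^ i \<in> polys V" for i
    using fc by (induction i) (auto intro: carrier_mult)
  \<comment> \<open>The index \<open>l\<close> encodes the pair of the power of \<open>f\<close> and
    the index in \<open>g\<close>.\<close>
  define g' where "g' l = f ^ (l div n) * g (l mod n)" for l
  have "g' l \<in> polys V \<and> exponents_le (k * e + d) (g' l)" if "l < Suc k * n" for l
  proof
    have "l mod n < n" using False by simp
    moreover have "l div n \<le> k" using that False by (simp add: less_Suc_eq_le[symmetric] less_mult_imp_div_less)
    then have "exponents_le (k * e) (f ^ (l div n))"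
      using exponents_le_power[OF f(3), of "l div n"] by (rule exponents_le_mono[rotated, OF mult_le_mono1])
    ultimately show "g' l \<in> polys V" "exponents_le (k * e + d) (g' l)"
      using g by (auto simp: g'_def intro!: carrier_mult pc exponents_le_mult)
  qed
  moreover have "a l = 0" if a: "(\<Sum>l<Suc k * n. Const (a l) * g' l) \<in> P" and l: "l < Suc k * n" for a l
  proof -
    have "(\<Sum>l<Suc k * n. Const (a l) * g' l) =
        (\<Sum>i<Suc k. \<Sum>l=i*n..<i*n+n. Const (a l) * g' l)"
      by (rule sum.nat_group[symmetric])
    also have "\<dots> = (\<Sum>i<Suc k. f ^ i * (\<Sum>j<n. Const (a (i * n + j)) * g j))"
    proof (rule sum.cong)
      fix i
      have "(\<Sum>l=i*n..<i*n+n. Const (a l) * g' l) = (\<Sum>j<n. Const (a (i * n + j)) * g' (i * n + j))"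
        unfolding sum.atLeastLessThan_shift_0[of _ "i * n"] by (simp add: lessThan_atLeast0)
      also have "\<dots> = (\<Sum>j<n. f ^ i * (Const (a (i * n + j)) * g j))"
        by (rule sum.cong) (auto simp: g'_def)
      finally show "(\<Sum>l=i*n..<i*n+n. Const (a l) * g' l) = f ^ i * (\<Sum>j<n. Const (a (i * n + j)) * g j)"
        by (simp add: sum_distrib_left)
    qed simp
    finally have *: "(\<Sum>i<Suc k. f ^ i * (\<Sum>j<n. Const (a (i * n + j)) * g j)) \<in> P" using a by simp
    have "l div n < Suc k" using l by (simp add: less_mult_imp_div_less)
    moreover have "l mod n < n" using False by simp
    ultimately have "a (l div n * n + l mod n) = 0"
    proof (intro power_combination_independent[where g = g and n = n and k = "Suc k"
          and b = "\<lambda>i j. a (i * n + j)", OF P Q PQ f(1,2)])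
      show "b j = 0" if "(\<Sum>j<n. Const (b j) * g j) \<in> Q" "j < n" for b j
        using that by (rule g_ind)
    qed (use g(1) * in auto)
    then show ?thesis by simp
  qed
  ultimately show ?thesis unfolding ex_independent_mod_def by blast
qed

text \<open>As 0 is in \<open>P\<close>, independence modulo \<open>P\<close> implies linear
  independence in the span of the bounded monomials.\<close>

lemma ex_independent_mod_bound:
  fixes P :: "('v, 'k::field) mpoly set"
  assumes V: "finite V" and P: "0 \<in> P" and ind: "ex_independent_mod V P n d"
  shows "n \<le> Suc d ^ card V"
proof -
  obtain g where g: "\<And>j. j < n \<Longrightarrow> g j \<in> polys V" "\<And>j. j < n \<Longrightarrow> exponents_le d (g j)"
    and g_ind: "\<And>a j. (\<Sum>j<n. Const (a j) * g j) \<in> P \<Longrightarrow> j < n \<Longrightarrow> a j = 0"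
    using ind unfolding ex_independent_mod_def by blast
  interpret vector_space "\<lambda>(a :: 'k) (p :: ('v, 'k) mpoly). Const a * p"
    by unfold_locales
      (simp_all add: Const_def distrib_left distrib_right single_add mult.assoc mult_single flip: mult.assoc)
  let ?M = "{m \<in> monomials V. \<forall>v. lookup m v \<le> d}"
  let ?T = "(\<lambda>m. single m (1 :: 'k)) ` ?M"
  \<comment> \<open>The bound counts a set of vectors, so a repetition must be excluded; it would
    give a relation with coefficients 1 and -1.\<close>
  have inj: "inj_on g {..<n}"
  proof (rule inj_onI, rule ccontr)
    fix i j assume ij: "i \<in> {..<n}" "j \<in> {..<n}" "g i = g j" "i \<noteq> j"
    let ?a = "\<lambda>l. if l = i then 1 else if l = j then - 1 else (0 :: 'k)"
    have "(\<Sum>l<n. Const (?a l) * g l) = (\<Sum>l\<in>{i, j}. Const (?a l) * g l)"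
      by (rule sum.mono_neutral_right) (use ij in \<open>auto simp: Const_def\<close>)
    also have "\<dots> = 0" using ij by (simp add: Const_def single_uminus)
    finally have "?a i = 0" using P g_ind[of ?a i] ij by simp
    then show False by simp
  qed
  have "independent (g ` {..<n})"
  proof
    assume "dependent (g ` {..<n})"
    then obtain u v where u: "v \<in> g ` {..<n}" "u v \<noteq> 0" "(\<Sum>v\<in>g ` {..<n}. Const (u v) * v) = 0"
      by (auto simp: dependent_finite)
    have "(\<Sum>j<n. Const (u (g j)) * g j) = 0"
      using u(3) by (simp add: sum.reindex[OF inj])
    then show False using P g_ind[of "\<lambda>j. u (g j)"] u(1,2) by auto
  qed
  moreover have "g ` {..<n} \<subseteq> span ?T"
  proof safe
    fix j assume "j < n"
    have "Const (lookup (g j) m) * single m 1 \<in> span ?T" if "m \<in> keys (g j)" for m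
      using g[OF \<open>j < n\<close>] that by (intro span_scale span_base) (auto simp: carrier_iff exponents_le_def)
    then have "(\<Sum>m\<in>keys (g j). Const (lookup (g j) m) * single m 1) \<in> span ?T"
      by (rule span_sum)
    then show "g j \<in> span ?T"
      by (simp add: Const_mult_single poly_mapping_sum_single)
  qed
  ultimately have "card (g ` {..<n}) \<le> card ?T"
    using independent_span_bound[of ?T "g ` {..<n}"] card_bounded_monomials(1)[OF V] by blast
  also have "\<dots> \<le> card ?M" by (rule card_image_le[OF card_bounded_monomials(1)[OF V]])
  finally show ?thesis by (simp add: card_bounded_monomials(2)[OF V] card_image[OF inj])
qed

definition prime_chain :: "('a, 'b) ring_scheme \<Rightarrow> (nat \<Rightarrow> 'a set) \<Rightarrow> nat \<Rightarrow> bool" where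
  "prime_chain R c n \<longleftrightarrow> (\<forall>i\<le>n. primeideal (c i) R) \<and> (\<forall>i<n. c i \<subset> c (Suc i))"

text \<open>The chain and \<open>S\<close> yield (k + 1)^(n + |S|) independent elements whose
  exponents are bounded linearly in k, inside a space whose dimension grows only like k^|V|.\<close>

lemma prime_chain_length_bound:
  fixes c :: "nat \<Rightarrow> ('v, 'k::field) mpoly set"
  assumes V: "finite V" and S: "S \<subseteq> V" "c n \<inter> polys S \<subseteq> {0}"
    and c: "prime_chain (poly_ring V) c n"
  shows "n + card S \<le> card V"
proof (rule ccontr)
  assume neg: "\<not> ?thesis"
  have prime: "primeideal (c i) (poly_ring V)" if "i \<le> n" for i using c that by (simp add: prime_chain_def)
  then have ideal: "ideal (c i) (poly_ring V)" if "i \<le> n" for i using that primeideal.axioms(1) by blast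
  have "\<forall>i<n. \<exists>f. f \<in> c (Suc i) - c i" using c by (auto simp: prime_chain_def)
  then obtain f where f: "\<And>i. i < n \<Longrightarrow> f i \<in> c (Suc i) - c i" by metis
  have "\<forall>i. \<exists>d. exponents_le d (f i)" using ex_exponents_le by blast
  then obtain e where e0: "\<forall>i. exponents_le (e i) (f i)" by (rule choice[THEN exE])
  have e: "exponents_le (sum e {..<n}) (f i)" if "i < n" for i
    using e0[rule_format] by (rule exponents_le_mono) (use that in \<open>auto intro: member_le_sum\<close>)
  \<comment> \<open>A common bound for the exponents of all witnesses of strict inclusion,
    independent of \<open>k\<close>.\<close>
  let ?e = "sum e {..<n}"
  have fin: "finite S" using V S(1) finite_subset by blast
  \<comment> \<open>Going down the chain, each inclusion multiplies the number of elements by k + 1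
    and adds k times \<open>?e\<close> to the bound on exponents.\<close>
  have "ex_independent_mod V (c (n - i)) (Suc k ^ (i + card S)) (k * (i * ?e) + k)" if "i \<le> n" for i k
    using that
  proof (induction i)
    case 0
    show ?case using ex_independent_mod_monomials[OF fin S, of k] by simp
  next
    case (Suc i)
    then have i: "n - Suc i < n" "Suc (n - Suc i) = n - i" by auto
    have "ex_independent_mod V (c (n - Suc i)) (Suc k * Suc k ^ (i + card S)) (k * ?e + (k * (i * ?e) + k))"
    proof (rule ex_independent_mod_step)
      show "c (n - Suc i) \<subseteq> c (n - i)" using c i unfolding prime_chain_def by (metis psubset_imp_subset)
      show "f (n - Suc i) \<in> c (n - i)" "f (n - Suc i) \<notin> c (n - Suc i)" using f[OF i(1)] i(2) by auto
    qed (use Suc i e prime ideal in auto)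
    then show ?case by (simp add: algebra_simps)
  qed
  from this[of n] have bound: "Suc k ^ (n + card S) \<le> Suc (k * (n * ?e) + k) ^ card V" for k
    using ex_independent_mod_bound[OF V, of "c 0"] poly_idealD(2)[OF ideal[of 0]] by simp
  \<comment> \<open>Taking k = C, the right-hand side of \<open>bound\<close> is at most (Suc (n *
    ?e) * Suc C)^|V|, which is C times Suc C^|V| by the choice of C; the left-hand side is at least
    Suc C times it.\<close>
  define C where "C = Suc (n * ?e) ^ card V"
  have "Suc C * Suc C ^ card V \<le> Suc C ^ (n + card S)"
    using neg power_increasing[of "Suc (card V)" "n + card S" "Suc C"] by simp
  also have "\<dots> \<le> Suc (C * (n * ?e) + C) ^ card V" by (rule bound)
  also have "\<dots> \<le> (Suc (n * ?e) * Suc C) ^ card V" by (intro power_mono) (simp_all add: algebra_simps)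
  also have "\<dots> = C * Suc C ^ card V" by (simp only: power_mult_distrib C_def)
  finally show False by simp
qed

lemma prime_chain_extend:
  assumes "prime_chain R c n" "c n \<subset> Q" "primeideal Q R"
  shows "prime_chain R (c(Suc n := Q)) (Suc n)"
  using assms by (auto simp: prime_chain_def less_Suc_eq le_Suc_eq)

text \<open>The given chain bounds the height from below; the independent set \<open>S\<close> of
  complementary size bounds all chains from above.\<close>

lemma height_eqI:
  fixes P :: "('v, 'k::field) mpoly set"
  assumes V: "finite V" and S: "S \<subseteq> V" "P \<inter> polys S \<subseteq> {0}" "n + card S = card V"
    and c: "prime_chain (poly_ring V) c n" "c n = P"
  shows "height (poly_ring V) P = enat n"
  unfolding height_def
proof (rule antisym)
  show "Sup {enat n |n. \<exists>c. (\<forall>i\<le>n. primeideal (c i) (poly_ring V)) \<and> (\<forall>i<n. c i \<subset> c (Suc i)) \<and> c n = P}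
      \<le> enat n"
  proof (rule Sup_least, clarify)
    fix m c' assume "\<forall>i\<le>m. primeideal (c' i) (poly_ring V)" "\<forall>i<m. c' i \<subset> c' (Suc i)" "P = c' m"
    then have "m + card S \<le> card V"
      using S by (intro prime_chain_length_bound[OF V S(1)]) (auto simp: prime_chain_def)
    then show "enat m \<le> enat n" using S(3) by simp
  qed
  show "enat n \<le> Sup {enat n |n. \<exists>c. (\<forall>i\<le>n. primeideal (c i) (poly_ring V)) \<and> (\<forall>i<n. c i \<subset> c (Suc i)) \<and> c n = P}"
    using c by (intro Sup_upper) (auto simp: prime_chain_def)
qed

section \<open>Unmixedness of finite intersections of prime ideals\<close>

lemma prime_contains_factor:
  fixes Q :: "('v, 'k::field) mpoly set"
  assumes "finite F" and Q: "primeideal Q (poly_ring V)"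
    and "\<And>P. P \<in> F \<Longrightarrow> ideal P (poly_ring V)" and "polys V \<inter> \<Inter>F \<subseteq> Q"
  shows "\<exists>P\<in>F. P \<subseteq> Q"
  using assms(1,3,4)
proof (induction F rule: finite_induct)
  case empty
  \<comment> \<open>Intersecting with \<open>polys V\<close> makes the empty intersection the whole
    ring, which no prime contains.\<close>
  then have "polys V \<subseteq> Q" by simp
  moreover have "Q \<subseteq> polys V"
    using primeideal.axioms(1)[OF Q] by (rule poly_idealD(1))
  ultimately show ?case using primeideal.I_notcarr[OF Q] by blast
next
  case (insert P F)
  show ?case
  proof (cases "P \<subseteq> Q")
    case False
    then obtain g where g: "g \<in> P" "g \<notin> Q" by blast
    have gc: "g \<in> polys V" using g(1) insert.prems(1)[of P] poly_idealD(1) by blast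
    have "polys V \<inter> \<Inter>F \<subseteq> Q"
    proof
      fix x assume x: "x \<in> polys V \<inter> \<Inter>F"
      have "x * g \<in> P" using x g(1) insert.prems(1)[of P] poly_idealD(4)[of P V x g] by auto
      moreover have "g * x \<in> P'" if "P' \<in> F" for P'
        using x that insert.prems(1)[of P'] poly_idealD(4)[of P' V g x] gc by auto
      ultimately have "g * x \<in> polys V \<inter> \<Inter>(insert P F)"
        using x gc by (auto simp: mult.commute carrier_mult)
      then have "g * x \<in> Q" using insert.prems(2) by blast
      then show "x \<in> Q" using primeideal.I_prime[OF Q gc, of x] x g(2) by auto
    qed
    then show ?thesis using insert.IH insert.prems(1) by blast
  qed blast
qed

lemma ideal_Inter_carrier:
  fixes F :: "('v, 'k::field) mpoly set set"
  assumes "\<And>P. P \<in> F \<Longrightarrow> ideal P (poly_ring V)"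
  shows "ideal (polys V \<inter> \<Inter>F) (poly_ring V)"
proof (rule poly_idealI)
  show "0 \<in> polys V \<inter> \<Inter>F" using poly_idealD(2)[OF assms] by auto
  show "f + g \<in> polys V \<inter> \<Inter>F"
    if "f \<in> polys V \<inter> \<Inter>F" "g \<in> polys V \<inter> \<Inter>F" for f g
    using that poly_idealD(3)[OF assms] by (auto simp: carrier_add)
  show "f * g \<in> polys V \<inter> \<Inter>F"
    if "f \<in> polys V" "g \<in> polys V \<inter> \<Inter>F" for f g
    using that poly_idealD(4)[OF assms] by (auto simp: carrier_mult)
qed auto

text \<open>An associated prime is a colon ideal by some f, hence the intersection of those members
  of \<open>F\<close> that do not contain f; being prime, it is one of them. The family may be
  redundant, since only heights matter.\<close>

lemma unmixed_Inter_primes: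
  fixes F :: "('v, 'k::field) mpoly set set"
  assumes "finite F" and prime: "\<And>P. P \<in> F \<Longrightarrow> primeideal P (poly_ring V)"
    and ht: "\<And>P. P \<in> F \<Longrightarrow> height (poly_ring V) P = h"
  shows "unmixed (poly_ring V) (polys V \<inter> \<Inter>F)"
proof -
  let ?I = "polys V \<inter> \<Inter>F"
  have ideal: "ideal P (poly_ring V)" if "P \<in> F" for P using prime[OF that] primeideal.axioms(1) by blast
  have "Q \<in> F" if Q: "Q \<in> assoc_primes (poly_ring V) ?I" for Q
  proof -
    obtain f where Q: "primeideal Q (poly_ring V)" and f: "f \<in> polys V"
      and Qf: "Q = {g \<in> polys V. g * f \<in> ?I}"
      using Q unfolding assoc_primes_def mem_Collect_eq poly_ring_simps by blast
    let ?F = "{P \<in> F. f \<notin> P}"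
    have "Q = polys V \<inter> \<Inter>?F"
    proof (intro subset_antisym subsetI)
      fix g assume g: "g \<in> Q"
      then have "g \<in> P" if "P \<in> ?F" for P
        using that f primeideal.I_prime[OF prime[of P], of g f] by (auto simp: Qf)
      then show "g \<in> polys V \<inter> \<Inter>?F" using g by (auto simp: Qf)
    next
      fix g assume g: "g \<in> polys V \<inter> \<Inter>?F"
      have "g * f \<in> P" if P: "P \<in> F" for P
      proof (cases "f \<in> P")
        case True
        then show ?thesis using poly_idealD(4)[OF ideal[OF P], of g f] g by auto
      next
        case False
        then have "g \<in> P" using g P by auto
        then show ?thesis using poly_idealD(4)[OF ideal[OF P] f, of g] by (simp add: mult.commute)
      qed
      then show "g \<in> Q" using g f by (auto simp: Qf carrier_mult)
    qed
    moreover from this obtain P where "P \<in> ?F" "P \<subseteq> Q"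
      using prime_contains_factor[of ?F Q V] Q ideal \<open>finite F\<close> by auto
    ultimately have "P = Q" by blast
    then show "Q \<in> F" using \<open>P \<in> ?F\<close> by blast
  qed
  then show ?thesis unfolding unmixed_def using ht by metis
qed

section \<open>Toric ideals of two-row matrices of monomials\<close>

text \<open>A matrix with two rows whose entries are products over pairwise disjoint sets of
  variables. The case \<open>i = j\<close> separates the two entries of one column.\<close>

definition columns :: "(nat \<Rightarrow> 'v set) \<Rightarrow> (nat \<Rightarrow> 'v set) \<Rightarrow> nat set \<Rightarrow> bool" where
  "columns A B X \<longleftrightarrow> finite X \<and>
     (\<forall>i\<in>X. finite (A i) \<and> finite (B i) \<and> A i \<noteq> {} \<and> B i \<noteq> {}) \<and>
     (\<forall>i\<in>X. \<forall>j\<in>X. A i \<inter> B j = {} \<and> (i \<noteq> j \<longrightarrow> A i \<inter> A j = {} \<and> B i \<inter> B j = {}))"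

definition support :: "(nat \<Rightarrow> 'v set) \<Rightarrow> (nat \<Rightarrow> 'v set) \<Rightarrow> nat set \<Rightarrow> 'v set" where
  "support A B X = (\<Union>i\<in>X. A i \<union> B i)"

text \<open>As monomials, m is n times the product of (A_i / B_i)^(c_i), with exponents adding up to
  0. These differences form the lattice spanned by those of the minors A_i B_j - A_j B_i.\<close>

definition col_shift ::
    "(nat \<Rightarrow> 'v set) \<Rightarrow> (nat \<Rightarrow> 'v set) \<Rightarrow> nat set \<Rightarrow> (nat \<Rightarrow> int) \<Rightarrow>
      'v monom \<Rightarrow> 'v monom \<Rightarrow> bool" where
  "col_shift A B X c m n \<longleftrightarrow> (\<Sum>i\<in>X. c i) = 0 \<and>
     (\<forall>i\<in>X. (\<forall>v\<in>A i. int (lookup m v) = int (lookup n v) + c i) \<and>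
             (\<forall>v\<in>B i. int (lookup m v) = int (lookup n v) - c i)) \<and>
     (\<forall>v. v \<notin> support A B X \<longrightarrow> lookup m v = lookup n v)"

definition col_rel ::
    "(nat \<Rightarrow> 'v set) \<Rightarrow> (nat \<Rightarrow> 'v set) \<Rightarrow> nat set \<Rightarrow> 'v monom \<Rightarrow> 'v monom \<Rightarrow> bool" where
  "col_rel A B X m n \<longleftrightarrow> (\<exists>c. col_shift A B X c m n)"

text \<open>The unions of classes of \<open>col_rel\<close>. They are stable under intersection, so
  a class can be cut down by any further condition that is constant on classes.\<close>

definition saturated ::
    "(nat \<Rightarrow> 'v set) \<Rightarrow> (nat \<Rightarrow> 'v set) \<Rightarrow> nat set \<Rightarrow> 'v monom set \<Rightarrow> bool" where
  "saturated A B X S \<longleftrightarrow> (\<forall>m n. m \<in> S \<longrightarrow> col_rel A B X m n \<longrightarrow> n \<in> S)"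

text \<open>The ideal generated by the variables in \<open>Z\<close> and the $2 \times 2$ minors of the matrix whose rows
  are the products over \<open>A i\<close> and over \<open>B i\<close>. It is described without generators: modulo
  the minors, two monomials agree iff they are related by \<open>col_rel\<close>, so that the coefficients over
  each class have to add up to 0.\<close>

definition toric ::
    "(nat \<Rightarrow> 'v set) \<Rightarrow> (nat \<Rightarrow> 'v set) \<Rightarrow> 'v set \<Rightarrow> nat set \<Rightarrow> 'v set \<Rightarrow> ('v, 'k::field) mpoly set" where
  "toric A B V X Z = {f \<in> polys V.
     \<forall>S. saturated A B X S \<longrightarrow> zsum f (S \<inter> {m. keys m \<inter> Z = {}}) = 0}"

lemma columns_subset: "columns A B X \<Longrightarrow> X' \<subseteq> X \<Longrightarrow> columns A B X'"
  unfolding columns_def by (meson finite_subset subsetD)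

lemma columns_empty [simp]: "columns A B {}"
  by (simp add: columns_def)

lemma finite_columns: "columns A B X \<Longrightarrow> finite X"
  by (simp add: columns_def)

lemma columns_disjoint:
  assumes "columns A B X" "i \<in> X" "j \<in> X"
  shows "v \<in> A i \<Longrightarrow> v \<notin> B j" "v \<in> A i \<Longrightarrow> v \<in> A j \<Longrightarrow> i = j" "v \<in> B i \<Longrightarrow> v \<in> B j \<Longrightarrow> i = j"
  using assms unfolding columns_def by blast+

lemma support_mono: "X \<subseteq> Y \<Longrightarrow> support A B X \<subseteq> support A B Y"
  by (auto simp: support_def)

lemma col_relI:
  fixes c :: "nat \<Rightarrow> int"
  assumes "(\<Sum>i\<in>X. c i) = 0"
    and "\<And>i v. i \<in> X \<Longrightarrow> v \<in> A i \<Longrightarrow> int (lookup m v) = int (lookup n v) + c i"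
    and "\<And>i v. i \<in> X \<Longrightarrow> v \<in> B i \<Longrightarrow> int (lookup m v) = int (lookup n v) - c i"
    and "\<And>v. v \<notin> support A B X \<Longrightarrow> lookup m v = lookup n v"
  shows "col_rel A B X m n"
  unfolding col_rel_def col_shift_def using assms by (intro exI[of _ c]) auto

lemma col_shiftD:
  assumes "col_shift A B X c m n"
  shows "(\<Sum>i\<in>X. c i) = 0"
    and "\<And>i v. i \<in> X \<Longrightarrow> v \<in> A i \<Longrightarrow> int (lookup m v) = int (lookup n v) + c i"
    and "\<And>i v. i \<in> X \<Longrightarrow> v \<in> B i \<Longrightarrow> int (lookup m v) = int (lookup n v) - c i"
    and "\<And>v. v \<notin> support A B X \<Longrightarrow> lookup m v = lookup n v"
  using assms unfolding col_shift_def by blast+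

lemma col_rel_refl: "col_rel A B X m m"
  by (rule col_relI[where c = "\<lambda>_. 0"]) auto

lemma col_rel_sym:
  assumes "col_rel A B X m n"
  shows "col_rel A B X n m"
proof -
  from assms obtain c where "col_shift A B X c m n" unfolding col_rel_def by blast
  from col_shiftD[OF this] show ?thesis by (intro col_relI[where c = "\<lambda>i. - c i"]) (auto simp: sum_negf)
qed

lemma col_rel_trans:
  assumes "col_rel A B X m n" "col_rel A B X n p"
  shows "col_rel A B X m p"
proof -
  from assms(1) obtain c where "col_shift A B X c m n" unfolding col_rel_def by blast
  note c = col_shiftD[OF this]
  from assms(2) obtain d where "col_shift A B X d n p" unfolding col_rel_def by blast
  note d = col_shiftD[OF this]
  show ?thesis
    by (rule col_relI[where c = "\<lambda>i. c i + d i"]) (use c d in \<open>auto simp: sum.distrib\<close>)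
qed

lemma saturatedD: "saturated A B X S \<Longrightarrow> col_rel A B X m n \<Longrightarrow> m \<in> S \<longleftrightarrow> n \<in> S"
  unfolding saturated_def using col_rel_sym by blast

lemma saturatedI: "(\<And>m n. m \<in> S \<Longrightarrow> col_rel A B X m n \<Longrightarrow> n \<in> S) \<Longrightarrow> saturated A B X S"
  unfolding saturated_def by blast

lemma saturated_class: "saturated A B X {n. col_rel A B X m n}"
  by (rule saturatedI) (auto intro: col_rel_trans)

lemma saturated_Int: "saturated A B X S \<Longrightarrow> saturated A B X T \<Longrightarrow> saturated A B X (S \<inter> T)"
  unfolding saturated_def by blast

lemma col_rel_outside: "col_rel A B X m n \<Longrightarrow> v \<notin> support A B X \<Longrightarrow> lookup m v = lookup n v"
  by (auto simp: col_rel_def col_shift_def)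

text \<open>The relation never changes exponents outside the columns, so any condition on these is
  constant on classes.\<close>

lemma saturated_outside:
  assumes "Y \<inter> support A B X = {}" and "\<And>m n. (\<And>v. v \<in> Y \<Longrightarrow> lookup m v = lookup n v) \<Longrightarrow> P m \<longleftrightarrow> P n"
  shows "saturated A B X {m. P m}"
proof (rule saturatedI)
  fix m n assume "m \<in> {m. P m}" "col_rel A B X m n"
  moreover from this have "P m \<longleftrightarrow> P n"
    by (intro assms(2) col_rel_outside[of A B X]) (use assms(1) in auto)
  ultimately show "n \<in> {m. P m}" by simp
qed

lemma col_rel_mono:
  assumes "columns A B Y" "X \<subseteq> Y" "col_rel A B X m n"
  shows "col_rel A B Y m n"
proof -
  from assms(3) obtain c where "col_shift A B X c m n" unfolding col_rel_def by blast
  note c = col_shiftD[OF this]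
  let ?c = "\<lambda>i. if i \<in> X then c i else 0"
  have "(\<Sum>i\<in>Y. ?c i) = (\<Sum>i\<in>X. c i)"
    using assms(2) finite_columns[OF assms(1)] by (simp add: sum.If_cases Int_absorb1)
  moreover have "v \<notin> support A B X" if "i \<in> Y" "i \<notin> X" "v \<in> A i \<union> B i" for i v
    using that assms(2) columns_disjoint[OF assms(1)] unfolding support_def by blast
  moreover have "lookup m v = lookup n v" if "v \<notin> support A B Y" for v
    using that support_mono[OF assms(2), of A B] by (intro c(4)) blast
  ultimately show ?thesis
    using c(1-4) by (intro col_relI[where c = ?c]) (auto split: if_splits)
qed

lemma saturated_mono: "columns A B Y \<Longrightarrow> X \<subseteq> Y \<Longrightarrow> saturated A B Y S \<Longrightarrow> saturated A B X S"
  unfolding saturated_def using col_rel_mono by blast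

lemma toric_mono: "columns A B Y \<Longrightarrow> X \<subseteq> Y \<Longrightarrow> toric A B V X Z \<subseteq> toric A B V Y Z"
  using saturated_mono unfolding toric_def by blast

text \<open>One unchanged exponent per column makes its shift 0. A single column \<open>i0\<close>
  may be left out, because the shifts add up to 0.\<close>

lemma col_rel_eqI:
  assumes "col_rel A B X m n" and "\<And>i. i \<in> X \<Longrightarrow> i \<noteq> i0 \<Longrightarrow> \<exists>v\<in>A i \<union> B i. lookup m v = lookup n v"
    and "finite X"
  shows "m = n"
proof -
  from assms(1) obtain c where "col_shift A B X c m n" unfolding col_rel_def by blast
  note c = col_shiftD[OF this]
  have c0: "c i = 0" if "i \<in> X" "i \<noteq> i0" for i
    using assms(2)[OF that] c(2,3)[OF that(1)] by force
  have "c i = 0" if "i \<in> X" for i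
  proof (cases "i = i0")
    case True
    have "(\<Sum>i\<in>X. c i) = c i0 + (\<Sum>i\<in>X - {i0}. c i)"
      using that True assms(3) by (intro sum.remove) auto
    then show ?thesis using c0 c(1) True by simp
  qed (use c0 that in auto)
  then have "lookup m v = lookup n v" for v
    using c by (cases "v \<in> support A B X") (force simp: support_def)+
  then show ?thesis by (rule poly_mapping_eqI)
qed

lemma col_rel_empty: "col_rel A B {} m n \<longleftrightarrow> m = n"
  using col_rel_eqI[of A B "{}" m n] col_rel_refl[of A B "{}" m] by auto

lemma col_rel_singleton: "col_rel A B {i} m n \<longleftrightarrow> m = n"
  using col_rel_eqI[of A B "{i}" m n i] col_rel_refl[of A B "{i}" m] by auto

lemma toric_singleton: "toric A B V {i} Z = toric A B V {} Z"
  by (simp add: toric_def saturated_def col_rel_empty col_rel_singleton)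

text \<open>Without columns all classes are singletons, and what is left is the ideal generated by
  the variables in \<open>Z\<close>.\<close>

lemma toric_empty: "toric A B V {} Z = {f \<in> polys V. \<forall>m\<in>keys f. keys m \<inter> Z \<noteq> {}}"
proof -
  have "(\<forall>S. saturated A B {} S \<longrightarrow> zsum f (S \<inter> {m. keys m \<inter> Z = {}}) = 0) \<longleftrightarrow>
      (\<forall>m\<in>keys f. keys m \<inter> Z \<noteq> {})" (is "?l \<longleftrightarrow> ?r") for f :: "('a, 'b) mpoly"
  proof
    assume l: ?l
    show ?r
    proof (intro ballI notI)
      fix m assume m: "m \<in> keys f" "keys m \<inter> Z = {}"
      have "zsum f ({m} \<inter> {m. keys m \<inter> Z = {}}) = 0"
        using l by (simp add: saturated_def col_rel_empty)
      then show False using m by (simp add: in_keys_iff lookup_eq_zero_in_keys_contradict zsum_def)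
    qed
  next
    assume r: ?r
    then have "keys f \<inter> (S \<inter> {m. keys m \<inter> Z = {}}) = {}" for S by blast
    then show ?l by (simp add: zsum_def)
  qed
  then show ?thesis by (simp add: toric_def)
qed

text \<open>The values of \<open>m v + m (b i)\<close> for \<open>v \<in> A i\<close>, of \<open>m v + m (a i)\<close> for \<open>v \<in> B i\<close>, of \<open>m v\<close> for
  the other \<open>v\<close>, and of the sum of all \<open>m (a i)\<close> form a complete set of invariants of \<open>col_rel\<close>,
  where \<open>a i\<close> and \<open>b i\<close> are fixed elements of \<open>A i\<close> and \<open>B i\<close>.\<close>

lemma ex_col_rel_invariant:
  fixes A B :: "nat \<Rightarrow> 'v set"
  assumes V: "finite V" and col: "columns A B X" and sup: "support A B X \<subseteq> V"
  obtains \<pi> :: "'v monom \<Rightarrow> nat monom" where "\<And>m n. \<pi> (m + n) = \<pi> m + \<pi> n" "\<pi> 0 = 0"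
    "\<And>m n. m \<in> monomials V \<Longrightarrow> n \<in> monomials V \<Longrightarrow> \<pi> m = \<pi> n \<longleftrightarrow> col_rel A B X m n"
proof -
  have "\<exists>a b. \<forall>i\<in>X. a i \<in> A i \<and> b i \<in> B i"
    using col unfolding columns_def by (intro exI[of _ "\<lambda>i. SOME v. v \<in> A i"] exI[of _ "\<lambda>i. SOME v. v \<in> B i"])
      (auto simp: some_in_eq)
  then obtain a b where ab: "\<And>i. i \<in> X \<Longrightarrow> a i \<in> A i" "\<And>i. i \<in> X \<Longrightarrow> b i \<in> B i" by blast
  obtain ix :: "'v \<Rightarrow> nat" where ix: "inj_on ix V"
    using finite_imp_inj_to_nat_seg[OF V] by auto
  note fin = finite_columns[OF col]
  \<comment> \<open>By disjointness at most one summand of the two sums is present. Writing them as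
    sums over all columns makes additivity in \<open>m\<close> evident.\<close>
  define \<phi> where "\<phi> v m = lookup m v + (\<Sum>i\<in>X. if v \<in> A i then lookup m (b i) else 0)
      + (\<Sum>i\<in>X. if v \<in> B i then lookup m (a i) else 0)" for v and m :: "'v monom"
  define \<sigma> where "\<sigma> m = (\<Sum>i\<in>X. lookup m (a i))" for m :: "'v monom"
  \<comment> \<open>The invariants are packed into one monomial, with index 0 for the total over the
    \<open>a i\<close>; such exponents are linearly ordered, as needed for a domain.\<close>
  define \<pi> where "\<pi> m = (\<Sum>v\<in>V. single (Suc (ix v)) (\<phi> v m)) + single 0 (\<sigma> m)" for m
  have \<phi>_A: "\<phi> v m = lookup m v + lookup m (b i)" if "i \<in> X" "v \<in> A i" for i v m
  proof -
    have "(\<Sum>j\<in>X. if v \<in> A j then lookup m (b j) else 0) = (\<Sum>j\<in>X. if j = i then lookup m (b j) else 0)"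
      using columns_disjoint(2)[OF col] that by (intro sum.cong) auto
    moreover have "(\<Sum>j\<in>X. if v \<in> B j then lookup m (a j) else 0) = 0"
      using columns_disjoint(1)[OF col] that by (intro sum.neutral) auto
    ultimately show ?thesis using that fin by (simp add: \<phi>_def)
  qed
  have \<phi>_B: "\<phi> v m = lookup m v + lookup m (a i)" if "i \<in> X" "v \<in> B i" for i v m
  proof -
    have "(\<Sum>j\<in>X. if v \<in> B j then lookup m (a j) else 0) = (\<Sum>j\<in>X. if j = i then lookup m (a j) else 0)"
      using columns_disjoint(3)[OF col] that by (intro sum.cong) auto
    moreover have "(\<Sum>j\<in>X. if v \<in> A j then lookup m (b j) else 0) = 0"
      using columns_disjoint(1)[OF col] that by (intro sum.neutral) auto
    ultimately show ?thesis using that fin by (simp add: \<phi>_def)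
  qed
  have \<phi>_out: "\<phi> v m = lookup m v" if "v \<notin> support A B X" for v m
    using that by (auto simp: \<phi>_def support_def intro!: sum.neutral)
  have "\<pi> (m + n) = \<pi> m + \<pi> n" for m n
  proof -
    have "\<phi> v (m + n) = \<phi> v m + \<phi> v n" for v
    proof -
      have "(\<Sum>i\<in>X. if v \<in> A i then lookup (m + n) (b i) else 0) =
          (\<Sum>i\<in>X. if v \<in> A i then lookup m (b i) else 0) + (\<Sum>i\<in>X. if v \<in> A i then lookup n (b i) else 0)"
        unfolding sum.distrib[symmetric] by (rule sum.cong) (auto simp: lookup_add)
      moreover have "(\<Sum>i\<in>X. if v \<in> B i then lookup (m + n) (a i) else 0) =
          (\<Sum>i\<in>X. if v \<in> B i then lookup m (a i) else 0) + (\<Sum>i\<in>X. if v \<in> B i then lookup n (a i) else 0)"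
        unfolding sum.distrib[symmetric] by (rule sum.cong) (auto simp: lookup_add)
      ultimately show ?thesis by (simp add: \<phi>_def lookup_add)
    qed
    then show ?thesis
      by (simp add: \<pi>_def \<sigma>_def lookup_add sum.distrib single_add add_ac)
  qed
  moreover have "\<phi> v 0 = 0" for v by (auto simp: \<phi>_def intro!: sum.neutral)
  then have "\<pi> 0 = 0" by (simp add: \<pi>_def \<sigma>_def)
  moreover have "\<pi> m = \<pi> n \<longleftrightarrow> col_rel A B X m n" if mn: "m \<in> monomials V" "n \<in> monomials V" for m n
  proof
    assume eq: "\<pi> m = \<pi> n"
    have lookup_\<pi>: "lookup (\<pi> m) (Suc (ix v)) = \<phi> v m" if v: "v \<in> V" for v m
    proof -
      have "lookup (\<pi> m) (Suc (ix v)) = (\<Sum>w\<in>V. if w = v then \<phi> w m else 0)"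
        unfolding \<pi>_def lookup_add lookup_sum lookup_single
        using inj_onD[OF ix _ _ v] by (auto simp: when_def intro!: sum.cong)
      then show ?thesis using V v by simp
    qed
    have "lookup (\<pi> m) 0 = \<sigma> m" for m
      by (simp add: \<pi>_def lookup_add lookup_sum lookup_single)
    then have \<sigma>: "\<sigma> m = \<sigma> n" using eq by metis
    have \<phi>: "\<phi> v m = \<phi> v n" if "v \<in> V" for v using eq lookup_\<pi>[OF that] by metis
    have abV: "a i \<in> V" "b i \<in> V" "A i \<subseteq> V" "B i \<subseteq> V" if "i \<in> X" for i
      using ab[OF that] that sup by (auto simp: support_def)
    show "col_rel A B X m n"
    proof (rule col_relI[where c = "\<lambda>i. int (lookup m (a i)) - int (lookup n (a i))"])
      have "int (\<sigma> m) = int (\<sigma> n)" using \<sigma> by simp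
      then show "(\<Sum>i\<in>X. int (lookup m (a i)) - int (lookup n (a i))) = 0"
        by (simp add: \<sigma>_def sum_subtractf)
      fix i assume i: "i \<in> X"
      have ai: "lookup m (a i) + lookup m (b i) = lookup n (a i) + lookup n (b i)"
        using \<phi>[of "a i"] abV[OF i] \<phi>_A[OF i ab(1)[OF i]] by simp
      show "int (lookup m v) = int (lookup n v) + (int (lookup m (a i)) - int (lookup n (a i)))" if "v \<in> A i" for v
        using \<phi>[of v] \<phi>_A[OF i that] abV[OF i] that ai by auto
      show "int (lookup m v) = int (lookup n v) - (int (lookup m (a i)) - int (lookup n (a i)))" if "v \<in> B i" for v
        using \<phi>[of v] \<phi>_B[OF i that] abV[OF i] that by auto
    next
      fix v assume v: "v \<notin> support A B X"
      show "lookup m v = lookup n v"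
      proof (cases "v \<in> V")
        case True
        then show ?thesis using \<phi>[of v] \<phi>_out[OF v] by simp
      next
        case False
        then have "v \<notin> keys m" "v \<notin> keys n" using mn by (auto simp: mem_monomials)
        then show ?thesis by (simp add: in_keys_iff)
      qed
    qed
  next
    assume "col_rel A B X m n"
    then obtain c where "col_shift A B X c m n" unfolding col_rel_def by blast
    note c = col_shiftD[OF this]
    have "\<phi> v m = \<phi> v n" for v
    proof (cases "v \<in> support A B X")
      case True
      then obtain i where i: "i \<in> X" "v \<in> A i \<or> v \<in> B i" by (auto simp: support_def)
      then show ?thesis
        using c(2,3)[OF i(1), of v] c(3)[OF i(1) ab(2)[OF i(1)]] c(2)[OF i(1) ab(1)[OF i(1)]]
          \<phi>_A[OF i(1)] \<phi>_B[OF i(1)] by auto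
    qed (use \<phi>_out c(4) in simp)
    moreover have "int (\<sigma> m) = int (\<sigma> n) + (\<Sum>i\<in>X. c i)"
      unfolding \<sigma>_def of_nat_sum sum.distrib[symmetric] by (rule sum.cong) (use c(2) ab(1) in auto)
    ultimately show "\<pi> m = \<pi> n" using c(1) by (simp add: \<pi>_def)
  qed
  ultimately show ?thesis using that by blast
qed

text \<open>Links saturated sets to kernels of monomial maps. Any complete invariant of the classes
  will do: one with values in a linearly ordered monoid gives primality, and
  \<open>edge_monom\<close> gives the toric ideal of the graph.\<close>

lemma toric_eq_fibre_sums:
  fixes \<pi> :: "'v monom \<Rightarrow> 'c"
  assumes "\<And>m n. m \<in> monomials V \<Longrightarrow> n \<in> monomials V \<Longrightarrow> \<pi> m = \<pi> n \<longleftrightarrow> col_rel A B X m n"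
  shows "(toric A B V X Z :: ('v, 'k::field) mpoly set) =
    {f \<in> polys V. \<forall>\<mu>. zsum f {m. keys m \<inter> Z = {} \<and> \<pi> m = \<mu>} = 0}"
  unfolding toric_def
proof (intro Collect_cong conj_cong refl)
  fix f :: "('v, 'k) mpoly" assume "f \<in> polys V"
  then have fV: "\<And>m. m \<in> keys f \<Longrightarrow> m \<in> monomials V" by (simp add: carrier_iff)
  let ?T = "{m :: 'v monom. keys m \<inter> Z = {}}"
  show "(\<forall>S. saturated A B X S \<longrightarrow> zsum f (S \<inter> ?T) = 0) \<longleftrightarrow>
      (\<forall>\<mu>. zsum f {m. keys m \<inter> Z = {} \<and> \<pi> m = \<mu>} = 0)" (is "?l \<longleftrightarrow> ?r")
  proof
    assume l: ?l
    show ?r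
    proof
      fix \<mu>
      show "zsum f {m. keys m \<inter> Z = {} \<and> \<pi> m = \<mu>} = 0"
      proof (cases "\<exists>m0\<in>keys f. \<pi> m0 = \<mu>")
        case True
        then obtain m0 where m0: "m0 \<in> keys f" "\<pi> m0 = \<mu>" by blast
        have "zsum f {m. keys m \<inter> Z = {} \<and> \<pi> m = \<mu>} = zsum f ({m. col_rel A B X m0 m} \<inter> ?T)"
          using assms[OF fV fV] m0 by (intro zsum_cong) (auto intro: col_rel_sym)
        then show ?thesis using l[rule_format, OF saturated_class, of m0] by simp
      next
        case False
        then have "keys f \<inter> {m. keys m \<inter> Z = {} \<and> \<pi> m = \<mu>} = {}" by auto
        then show ?thesis by (simp add: zsum_def)
      qed
    qed
  next
    assume r: ?r
    show ?l
    proof (intro allI impI)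
      fix S assume S: "saturated A B X S"
      show "zsum f (S \<inter> ?T) = 0"
      proof (rule zsum_eq_0_of_fibres)
        show "zsum f {m \<in> ?T. \<pi> m = \<mu>} = 0" for \<mu> using r by simp
        show "n \<in> S" if "m \<in> keys f \<inter> ?T \<inter> S" "n \<in> keys f \<inter> ?T" "\<pi> m = \<pi> n" for m n
          using that assms[OF fV fV] saturatedD[OF S] by blast
      qed
    qed
  qed
qed

text \<open>The kernel of the homomorphism that sends a monomial meeting \<open>Z\<close> to 0 and
  any other one to its invariant.\<close>

lemma primeideal_toric:
  assumes "finite V" "columns A B X" "support A B X \<subseteq> V"
  shows "primeideal (toric A B V X Z :: ('v, 'k::field) mpoly set) (poly_ring V)"
proof -
  obtain \<pi> :: "'v monom \<Rightarrow> nat monom" where \<pi>: "\<And>m n. \<pi> (m + n) = \<pi> m + \<pi> n" "\<pi> 0 = 0"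
    "\<And>m n. m \<in> monomials V \<Longrightarrow> n \<in> monomials V \<Longrightarrow> \<pi> m = \<pi> n \<longleftrightarrow> col_rel A B X m n"
    using ex_col_rel_invariant[OF assms] by blast
  define h :: "'v monom \<Rightarrow> (nat monom \<Rightarrow>\<^sub>0 'k)"
    where "h m = (if keys m \<inter> Z = {} then single (\<pi> m) 1 else 0)" for m
  have "lookup (lin h f) \<mu> = zsum f {m. keys m \<inter> Z = {} \<and> \<pi> m = \<mu>}" for f \<mu>
    unfolding h_def by (rule lookup_lin_fibre)
  then have "lin h f = 0 \<longleftrightarrow> (\<forall>\<mu>. zsum f {m. keys m \<inter> Z = {} \<and> \<pi> m = \<mu>} = 0)" for f
    by (simp add: poly_mapping_eq_iff fun_eq_iff)
  then have "toric A B V X Z = {f \<in> polys V. lin h f = 0}"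
    using toric_eq_fibre_sums[of V \<pi>, OF \<pi>(3)] by simp
  moreover have "primeideal {f \<in> polys V. lin h f = 0} (poly_ring V)"
    by (rule primeideal_lin_kernel) (auto simp: h_def \<pi>(1,2) keys_add_nat mult_single Int_Un_distrib2)
  ultimately show ?thesis by simp
qed

lemma ideal_toric:
  assumes "finite V" "columns A B X" "support A B X \<subseteq> V"
  shows "ideal (toric A B V X Z :: ('v, 'k::field) mpoly set) (poly_ring V)"
  using primeideal_toric[OF assms] by (rule primeideal.axioms(1))

section \<open>Chains of toric primes and their heights\<close>

definition squarefree_monom :: "'v set \<Rightarrow> 'v monom" where
  "squarefree_monom S = (\<Sum>v\<in>S. single v 1)"

lemma lookup_squarefree_monom: "finite S \<Longrightarrow> lookup (squarefree_monom S) v = (if v \<in> S then 1 else 0)"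
  by (simp add: squarefree_monom_def lookup_sum lookup_single when_def)

lemma keys_squarefree_monom: "finite S \<Longrightarrow> keys (squarefree_monom S) = S"
  by (auto simp: in_keys_iff lookup_squarefree_monom split: if_splits)

lemma toric_psubset_insert_variable:
  assumes "z \<notin> Z" "z \<in> V"
  shows "toric A B V {} Z \<subset> (toric A B V {} (insert z Z) :: ('v, 'k::field) mpoly set)"
proof -
  have "Var z \<in> (toric A B V {} (insert z Z) :: ('v, 'k) mpoly set)"
    using assms by (simp add: toric_empty Var_def carrier_single mem_monomials)
  moreover have "Var z \<notin> (toric A B V {} Z :: ('v, 'k) mpoly set)"
    using assms by (simp add: toric_empty Var_def)
  moreover have "toric A B V {} Z \<subseteq> (toric A B V {} (insert z Z) :: ('v, 'k) mpoly set)"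
    by (auto simp: toric_empty)
  ultimately show ?thesis by blast
qed

text \<open>The minor of the columns \<open>i\<close> and \<open>j\<close> is new: without column
  \<open>i\<close> the exponents of the variables in \<open>A i\<close> are fixed on classes, and
  they separate the two terms.\<close>

lemma toric_psubset_insert_column:
  assumes V: "support A B (insert i X) \<subseteq> V" and col: "columns A B (insert i X)"
    and ij: "i \<notin> X" "j \<in> X" and Z: "Z \<inter> support A B (insert i X) = {}"
  shows "toric A B V X Z \<subset> (toric A B V (insert i X) Z :: ('v, 'k::field) mpoly set)"
proof -
  have fin: "finite (A i)" "finite (A j)" "finite (B i)" "finite (B j)" "finite X"
    using col ij by (auto simp: columns_def)
  have dis: "\<And>v. v \<in> A i \<Longrightarrow> v \<notin> B i \<and> v \<notin> B j \<and> v \<notin> A j" "\<And>v. v \<in> B i \<Longrightarrow> v \<notin> B j \<and> v \<notin> A j"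
    "\<And>v. v \<in> A j \<Longrightarrow> v \<notin> B i \<and> v \<notin> B j"
    using columns_disjoint[OF col] ij by (metis insertCI)+
  let ?m = "squarefree_monom (A i \<union> B j)" and ?n = "squarefree_monom (A j \<union> B i)"
  have lm: "lookup ?m v = (if v \<in> A i \<union> B j then 1 else 0)" for v
    using fin by (intro lookup_squarefree_monom) auto
  have ln: "lookup ?n v = (if v \<in> A j \<union> B i then 1 else 0)" for v
    using fin by (intro lookup_squarefree_monom) auto
  have keys: "keys ?m = A i \<union> B j" "keys ?n = A j \<union> B i"
    using fin by (intro keys_squarefree_monom; simp)+
  then have av: "keys ?m \<inter> Z = {}" "keys ?n \<inter> Z = {}"
    using Z ij by (auto simp: support_def)
  have rel: "col_rel A B (insert i X) ?m ?n"
  \<comment> \<open>The two terms of the minor differ by one shift up in column \<open>i\<close> and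
    one down in column \<open>j\<close>.\<close>
  proof (rule col_relI[where c = "\<lambda>l. if l = i then 1 else if l = j then - 1 else 0"])
    show "(\<Sum>l\<in>insert i X. if l = i then 1 else if l = j then - 1 else (0 :: int)) = 0"
    proof -
      have "(\<Sum>l\<in>X. if l = i then 1 else if l = j then - 1 else (0 :: int)) = (\<Sum>l\<in>X. if l = j then - 1 else 0)"
        using ij by (intro sum.cong) auto
      then show ?thesis using ij fin by simp
    qed
    fix l v assume l: "l \<in> insert i X"
    have other: "v \<notin> A i \<and> v \<notin> A j" if "l \<noteq> i" "l \<noteq> j" "v \<in> A l"
      using columns_disjoint(2)[OF col l, of i v] columns_disjoint(2)[OF col l, of j v] that ij by auto
    have other': "v \<notin> B i \<and> v \<notin> B j" if "l \<noteq> i" "l \<noteq> j" "v \<in> B l"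
      using columns_disjoint(3)[OF col l, of i v] columns_disjoint(3)[OF col l, of j v] that ij by auto
    show "int (lookup ?m v) = int (lookup ?n v) + (if l = i then 1 else if l = j then - 1 else 0)" if "v \<in> A l"
      using that dis other columns_disjoint(1)[OF col l, of i v] columns_disjoint(1)[OF col l, of j v] ij
      by (auto simp: lm ln)
    show "int (lookup ?m v) = int (lookup ?n v) - (if l = i then 1 else if l = j then - 1 else 0)" if "v \<in> B l"
      using that dis other' columns_disjoint(1)[OF col _ l, of i v] columns_disjoint(1)[OF col _ l, of j v] ij
      by (auto simp: lm ln)
  next
    fix v assume "v \<notin> support A B (insert i X)"
    then show "lookup ?m v = lookup ?n v" using ij by (auto simp: lm ln support_def)
  qed
  define f :: "('v, 'k) mpoly" where "f = single ?m 1 - single ?n 1"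
  have "f \<in> polys V"
    unfolding f_def using V ij by (intro carrier_diff carrier_single) (auto simp: mem_monomials keys support_def)
  then have "f \<in> toric A B V (insert i X) Z"
    using saturatedD[OF _ rel] av by (auto simp: toric_def f_def zsum_diff zsum_single)
  moreover have "f \<notin> toric A B V X Z"
  proof
    assume f: "f \<in> toric A B V X Z"
    obtain v where v: "v \<in> A i" using col by (auto simp: columns_def)
    then have "v \<notin> support A B X"
      using columns_disjoint[OF col] ij unfolding support_def by blast
    then have "saturated A B X {m. lookup m v = 1}"
      by (intro saturated_outside[of "{v}"]) auto
    then have "zsum f ({m. lookup m v = 1} \<inter> {m. keys m \<inter> Z = {}}) = 0" using f by (simp add: toric_def)
    moreover have "lookup ?m v = 1" "lookup ?n v = 0" using v dis by (auto simp: lm ln)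
    ultimately show False using av by (simp add: f_def zsum_diff zsum_single)
  qed
  moreover have "toric A B V X Z \<subseteq> toric A B V (insert i X) Z"
    using toric_mono[OF col] by blast
  ultimately show ?thesis by blast
qed

lemma ex_prime_chain_toric_variables:
  assumes V: "finite V" and Z: "Z \<subseteq> V"
  shows "\<exists>c :: nat \<Rightarrow> ('v, 'k::field) mpoly set.
    prime_chain (poly_ring V) c (card Z) \<and> c (card Z) = toric A B V {} Z"
  using finite_subset[OF Z V] Z
proof (induction Z rule: finite_induct)
  case empty
  show ?case
    using primeideal_toric[OF V, of A B "{}" "{}"]
    by (intro exI[of _ "\<lambda>_. toric A B V {} {}"]) (simp add: prime_chain_def support_def)
next
  case (insert z Z)
  then obtain c :: "nat \<Rightarrow> ('v, 'k) mpoly set"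
    where c: "prime_chain (poly_ring V) c (card Z)" "c (card Z) = toric A B V {} Z" by auto
  have "primeideal (toric A B V {} (insert z Z) :: ('v, 'k) mpoly set) (poly_ring V)"
    by (rule primeideal_toric[OF V]) (auto simp: support_def)
  moreover have "c (card Z) \<subset> toric A B V {} (insert z Z)"
    unfolding c(2) using insert by (intro toric_psubset_insert_variable) auto
  ultimately have "prime_chain (poly_ring V) (c(Suc (card Z) := toric A B V {} (insert z Z))) (Suc (card Z))"
    by (intro prime_chain_extend[OF c(1)])
  then show ?case using insert by auto
qed

text \<open>The first column creates no minor, so only the later ones lengthen the chain; for empty
  \<open>X\<close> the truncated \<open>card X - 1\<close> is 0.\<close>

lemma ex_prime_chain_toric:
  assumes V: "finite V" and Z: "Z \<subseteq> V" and "columns A B X" "support A B X \<subseteq> V" "Z \<inter> support A B X = {}"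
  shows "\<exists>c :: nat \<Rightarrow> ('v, 'k::field) mpoly set.
    prime_chain (poly_ring V) c (card Z + (card X - 1)) \<and> c (card Z + (card X - 1)) = toric A B V X Z"
  using finite_columns[OF assms(3)] assms(3-)
proof (induction X rule: finite_induct)
  case empty
  show ?case using ex_prime_chain_toric_variables[OF V Z] by simp
next
  case (insert i X)
  show ?case
  proof (cases "X = {}")
    case True
    then show ?thesis using ex_prime_chain_toric_variables[OF V Z] by (simp add: toric_singleton)
  next
    case False
    then obtain j where j: "j \<in> X" by blast
    let ?n = "card Z + (card X - 1)"
    have "support A B X \<subseteq> support A B (insert i X)" by (rule support_mono) blast
    then have sup: "support A B X \<subseteq> V" "Z \<inter> support A B X = {}" using insert.prems(2,3) by blast+
    have "columns A B X" using insert.prems(1) by (rule columns_subset) blast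
    from insert.IH[OF this sup] obtain c :: "nat \<Rightarrow> ('v, 'k) mpoly set"
      where c: "prime_chain (poly_ring V) c ?n" "c ?n = toric A B V X Z" by blast
    have "primeideal (toric A B V (insert i X) Z :: ('v, 'k) mpoly set) (poly_ring V)"
      by (rule primeideal_toric[OF V insert.prems(1,2)])
    moreover have "c ?n \<subset> toric A B V (insert i X) Z"
      unfolding c(2)
      by (rule toric_psubset_insert_column[OF insert.prems(2,1) insert.hyps(2) j insert.prems(3)])
    ultimately have chain: "prime_chain (poly_ring V) (c(Suc ?n := toric A B V (insert i X) Z)) (Suc ?n)"
      by (intro prime_chain_extend[OF c(1)])
    have "card X > 0" using insert.hyps(1) False by (simp add: card_gt_0_iff)
    then have eq: "card Z + (card (insert i X) - 1) = Suc ?n" using insert.hyps by simp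
    show ?thesis unfolding eq by (rule exI, rule conjI[OF chain]) simp
  qed
qed

text \<open>For the upper bound, pick one variable of \<open>B i\<close> in every column but one.
  The variables outside \<open>Z\<close> and outside this choice are independent: related monomials
  avoiding the choice agree by \<open>col_rel_eqI\<close>.\<close>

lemma height_toric:
  assumes V: "finite V" and Z: "Z \<subseteq> V" and col: "columns A B X" and sup: "support A B X \<subseteq> V"
    and dis: "Z \<inter> support A B X = {}"
  shows "height (poly_ring V) (toric A B V X Z :: ('v, 'k::field) mpoly set) = enat (card Z + (card X - 1))"
proof -
  obtain c :: "nat \<Rightarrow> ('v, 'k) mpoly set" where c: "prime_chain (poly_ring V) c (card Z + (card X - 1))"
    "c (card Z + (card X - 1)) = toric A B V X Z"
    using ex_prime_chain_toric[OF assms] by blast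
  have "\<exists>b. \<forall>i\<in>X. b i \<in> B i"
    using col unfolding columns_def by (intro exI[of _ "\<lambda>i. SOME v. v \<in> B i"]) (auto simp: some_in_eq)
  then obtain b where b: "\<And>i. i \<in> X \<Longrightarrow> b i \<in> B i" by blast
  obtain i0 where i0: "X \<noteq> {} \<Longrightarrow> i0 \<in> X" by blast
  define W where "W = b ` (X - {i0})"
  have inj: "inj_on b (X - {i0})"
    using b columns_disjoint(3)[OF col] by (intro inj_onI) (metis DiffD1)
  have card_W: "card W = card X - 1"
    unfolding W_def card_image[OF inj] using i0 finite_columns[OF col] by (cases "X = {}") auto
  have W: "W \<subseteq> support A B X" using b by (auto simp: W_def support_def)
  let ?S = "V - Z - W"
  have "W \<subseteq> V - Z" using W sup dis by blast
  then have "card ?S = card V - card Z - card W"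
    using V Z finite_subset[OF _ V] by (subst card_Diff_subset) (auto simp: card_Diff_subset intro: finite_subset)
  moreover have "card Z + card W \<le> card V"
  proof -
    have "card (Z \<union> W) = card Z + card W"
      using W dis finite_subset[OF Z V] finite_columns[OF col] by (intro card_Un_disjoint) (auto simp: W_def)
    moreover have "card (Z \<union> W) \<le> card V" using Z W sup by (intro card_mono[OF V]) blast
    ultimately show ?thesis by simp
  qed
  ultimately have "card Z + (card X - 1) + card ?S = card V" using card_W by simp
  moreover have "toric A B V X Z \<inter> polys ?S \<subseteq> ({0} :: ('v, 'k) mpoly set)"
  proof
    fix f :: "('v, 'k) mpoly" assume f: "f \<in> toric A B V X Z \<inter> polys ?S"
    have "m \<notin> keys f" for m
    proof
      assume m: "m \<in> keys f"
      have key: "lookup n w = 0" if "n \<in> keys f" "w \<in> Z \<union> W" for n w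
        using that f by (fastforce simp: carrier_iff mem_monomials in_keys_iff)
      \<comment> \<open>The class of \<open>m\<close> meets \<open>f\<close> only in
        \<open>m\<close>, so its vanishing sum is the coefficient of \<open>m\<close>
        itself.\<close>
      have "keys f \<inter> ({n. col_rel A B X m n} \<inter> {n. keys n \<inter> Z = {}}) = {m}"
      proof (intro subset_antisym subsetI)
        fix n assume n: "n \<in> keys f \<inter> ({n. col_rel A B X m n} \<inter> {n. keys n \<inter> Z = {}})"
        have "m = n"
        proof (rule col_rel_eqI)
          show "col_rel A B X m n" using n by blast
          show "\<exists>v\<in>A i \<union> B i. lookup m v = lookup n v" if "i \<in> X" "i \<noteq> i0" for i
            using key[OF m, of "b i"] key[of n "b i"] n that b[OF that(1)] by (auto simp: W_def intro!: bexI[of _ "b i"])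
        qed (rule finite_columns[OF col])
        then show "n \<in> {m}" by simp
      next
        fix n assume "n \<in> {m}"
        then show "n \<in> keys f \<inter> ({n. col_rel A B X m n} \<inter> {n. keys n \<inter> Z = {}})"
          using m key[OF m] col_rel_refl by (auto simp: in_keys_iff)
      qed
      then have "zsum f ({n. col_rel A B X m n} \<inter> {n. keys n \<inter> Z = {}}) = lookup f m"
        by (simp add: zsum_def)
      moreover have "zsum f ({n. col_rel A B X m n} \<inter> {n. keys n \<inter> Z = {}}) = 0"
        using f saturated_class[of A B X m] unfolding toric_def by blast
      ultimately have "lookup f m = 0" by simp
      then show False using m by (simp add: in_keys_iff)
    qed
    then have "f = 0" using poly_mapping_sum_single[of f] by (metis equals0I sum.empty)
    then show "f \<in> {0}" by simp
  qed
  ultimately show ?thesis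
    using c by (intro height_eqI[OF V, of ?S, where c = c]) auto
qed

section \<open>Monomial ideals generated by products over disjoint sets\<close>

text \<open>The ideal generated by the products over the \<open>B j\<close>; they are squarefree, so
  divisibility is inclusion in \<open>keys m\<close>. An empty \<open>B j\<close> gives the unit
  ideal.\<close>

definition mon_ideal :: "'v set \<Rightarrow> nat set \<Rightarrow> (nat \<Rightarrow> 'v set) \<Rightarrow> ('v, 'k::field) mpoly set" where
  "mon_ideal V X B = {f \<in> polys V. \<forall>m\<in>keys f. \<exists>j\<in>X. B j \<subseteq> keys m}"

lemma ideal_mon_ideal: "ideal (mon_ideal V X B :: ('v, 'k::field) mpoly set) (poly_ring V)"
proof (rule poly_idealI)
  fix f g :: "('v, 'k) mpoly"
  show "f + g \<in> mon_ideal V X B" if "f \<in> mon_ideal V X B" "g \<in> mon_ideal V X B"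
    using that keys_add[of f g] by (fastforce simp: mon_ideal_def intro: carrier_add)
  show "f * g \<in> mon_ideal V X B" if f: "f \<in> polys V" and g: "g \<in> mon_ideal V X B"
  proof -
    have "\<exists>j\<in>X. B j \<subseteq> keys m" if m: "m \<in> keys (f * g)" for m
    proof -
      obtain a b where ab: "m = a + b" "b \<in> keys g" using m keys_mult[of f g] by auto
      then obtain j where "j \<in> X" "B j \<subseteq> keys b" using g by (auto simp: mon_ideal_def)
      then show ?thesis using ab(1) by (auto simp: keys_add_nat)
    qed
    then show ?thesis using f g by (simp add: mon_ideal_def carrier_mult)
  qed
qed (auto simp: mon_ideal_def)

text \<open>A monomial outside the ideal misses a variable of every \<open>B j\<close>; choosing
  these gives a transversal whose prime does not contain the monomial.\<close>

lemma mon_ideal_eq_Inter: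
  "mon_ideal V X B = polys V \<inter> (\<Inter>b\<in>Pi\<^sub>E X B. toric A B' V {} (b ` X))"
proof (intro subset_antisym subsetI)
  fix f assume f: "f \<in> polys V \<inter> (\<Inter>b\<in>Pi\<^sub>E X B. toric A B' V {} (b ` X))"
  have "\<exists>j\<in>X. B j \<subseteq> keys m" if m: "m \<in> keys f" for m
  proof (rule ccontr)
    assume "\<not> ?thesis"
    then have "\<forall>j\<in>X. \<exists>v. v \<in> B j \<and> v \<notin> keys m" by blast
    then obtain b where b: "\<forall>j\<in>X. b j \<in> B j \<and> b j \<notin> keys m" by metis
    then have "restrict b X \<in> Pi\<^sub>E X B" by auto
    then have "f \<in> toric A B' V {} (restrict b X ` X)" using f by blast
    then have "keys m \<inter> restrict b X ` X \<noteq> {}" using m by (simp add: toric_empty)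
    then show False using b by auto
  qed
  then show "f \<in> mon_ideal V X B" using f by (simp add: mon_ideal_def)
next
  fix f assume f: "f \<in> mon_ideal V X B"
  have "f \<in> toric A B' V {} (b ` X)" if b: "b \<in> Pi\<^sub>E X B" for b
  proof -
    have "keys m \<inter> b ` X \<noteq> {}" if "m \<in> keys f" for m
    proof -
      obtain j where "j \<in> X" "B j \<subseteq> keys m" using f \<open>m \<in> keys f\<close> by (auto simp: mon_ideal_def)
      then have "b j \<in> keys m \<inter> b ` X" using b by (auto simp: PiE_iff)
      then show ?thesis by blast
    qed
    then show ?thesis using f by (simp add: toric_empty mon_ideal_def)
  qed
  then show "f \<in> polys V \<inter> (\<Inter>b\<in>Pi\<^sub>E X B. toric A B' V {} (b ` X))"
    using f by (simp add: mon_ideal_def)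
qed

text \<open>Disjointness makes the choice \<open>b\<close> injective, so all transversals have as
  many variables as there are sets.\<close>

lemma transversal_prime:
  fixes A B' :: "nat \<Rightarrow> 'v set"
  assumes V: "finite V" and B: "\<And>j. j \<in> X \<Longrightarrow> B j \<subseteq> V"
    and dis: "\<And>i j. i \<in> X \<Longrightarrow> j \<in> X \<Longrightarrow> i \<noteq> j \<Longrightarrow> B i \<inter> B j = {}" and b: "b \<in> Pi\<^sub>E X B"
  shows "primeideal (toric A B' V {} (b ` X) :: ('v, 'k::field) mpoly set) (poly_ring V)"
    and "height (poly_ring V) (toric A B' V {} (b ` X) :: ('v, 'k) mpoly set) = enat (card X)"
proof -
  show "primeideal (toric A B' V {} (b ` X) :: ('v, 'k) mpoly set) (poly_ring V)"
    by (rule primeideal_toric[OF V]) (auto simp: support_def)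
  have bB: "b j \<in> B j" if "j \<in> X" for j using b that by (auto simp: PiE_iff)
  then have "inj_on b X" using dis by (intro inj_onI) (metis disjoint_iff)
  then have "card (b ` X) = card X" by (rule card_image)
  moreover have "b ` X \<subseteq> V" using bB B by blast
  ultimately show "height (poly_ring V) (toric A B' V {} (b ` X) :: ('v, 'k) mpoly set) = enat (card X)"
    using height_toric[OF V, of "b ` X" A B' "{}"] by (simp add: support_def)
qed

lemma unmixed_mon_ideal:
  assumes V: "finite V" and X: "finite X" and B: "\<And>j. j \<in> X \<Longrightarrow> B j \<subseteq> V"
    and dis: "\<And>i j. i \<in> X \<Longrightarrow> j \<in> X \<Longrightarrow> i \<noteq> j \<Longrightarrow> B i \<inter> B j = {}"
  shows "unmixed (poly_ring V) (mon_ideal V X B :: ('v, 'k::field) mpoly set)"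
proof -
  let ?F = "(\<lambda>b. toric B B V {} (b ` X)) ` Pi\<^sub>E X B :: ('v, 'k) mpoly set set"
  have "finite (Pi\<^sub>E X B)" using X B V by (intro finite_PiE) (auto intro: finite_subset)
  then have "unmixed (poly_ring V) (polys V \<inter> \<Inter>?F)"
    using transversal_prime[OF V B dis]
    by (intro unmixed_Inter_primes[where h = "enat (card X)"]) auto
  then show ?thesis by (simp add: mon_ideal_eq_Inter[of V X B B B])
qed

lemma keys_mult_Var_subset: "keys (q * Var y) \<subseteq> (\<lambda>m. single y 1 + m) ` keys q"
  using keys_monom_mult_subset[of "single y 1" 1 q] by (simp add: Var_def mult.commute)

lemma keys_add_single_subset: "keys (m + single y d) \<subseteq> insert y (keys m)"
  by (auto simp: in_keys_iff lookup_add lookup_single when_def split: if_splits)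

text \<open>For \<open>y\<close> in \<open>B j\<close>, C has \<open>B j - {y}\<close> in place of
  \<open>B j\<close> and N omits \<open>j\<close>; both live in a ring with one variable less. The
  induction ends with an empty product, the unit ideal, or with no product, the zero ideal.\<close>

lemma GVD_mon_ideal:
  assumes "finite V" "finite X" "\<And>j. j \<in> X \<Longrightarrow> B j \<subseteq> V"
    and "\<And>i j. i \<in> X \<Longrightarrow> j \<in> X \<Longrightarrow> i \<noteq> j \<Longrightarrow> B i \<inter> B j = {}"
  shows "GVD V (mon_ideal V X B :: ('v, 'k::field) mpoly set)"
  using assms
proof (induction "card V" arbitrary: V X B rule: less_induct)
  case less
  note V = less.prems(1) and X = less.prems(2) and B = less.prems(3) and dis = less.prems(4)
  have ideal: "ideal (mon_ideal V X B :: ('v, 'k) mpoly set) (poly_ring V)" by (rule ideal_mon_ideal)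
  have unmixed: "unmixed (poly_ring V) (mon_ideal V X B :: ('v, 'k) mpoly set)"
    by (rule unmixed_mon_ideal[OF less.prems])
  interpret cring "poly_ring V :: ('v, 'k) mpoly ring" by (rule cring_poly_ring)
  consider (unit) j where "j \<in> X" "B j = {}" | (empty) "X = {}"
    | (step) j y where "j \<in> X" "y \<in> B j" by blast
  then show ?case
  proof cases
    case unit
    then have "mon_ideal V X B = (polys V :: ('v, 'k) mpoly set)"
      by (auto simp: mon_ideal_def)
    moreover have "(polys V :: ('v, 'k) mpoly set) = Idl\<^bsub>poly_ring V\<^esub> {1}"
      using genideal_one by simp
    ultimately show ?thesis by (intro GVD.unit[OF ideal unmixed]) (rule trans)
  next
    case empty
    have "mon_ideal V X B = ({0} :: ('v, 'k) mpoly set)"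
    proof -
      have "f = 0" if "f \<in> mon_ideal V X B" for f :: "('v, 'k) mpoly"
        using that empty poly_mapping_sum_single[of f] by (auto simp: mon_ideal_def)
      then show ?thesis using poly_idealD(2)[OF ideal] by blast
    qed
    moreover have "Idl\<^bsub>poly_ring V\<^esub> (Var ` {}) = ({0} :: ('v, 'k) mpoly set)"
      using zeroideal genideal_minimal'[of "{0}" "poly_ring V" "{}"] poly_idealD(2)[OF poly_genideal(1), of "{}" V]
      by auto
    ultimately show ?thesis by (intro GVD.variables[OF ideal unmixed, of "{}"]) simp_all
  next
    case step
    let ?B = "B(j := B j - {y})"
    have y: "y \<in> V" using step B by blast
    have yB: "y \<notin> B k" if "k \<in> X" "k \<noteq> j" for k using dis[of j k] step that by blast
    have card: "card (V - {y}) < card V" using V y by (rule card_Diff1_less)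
    have C: "GVD (V - {y}) (mon_ideal (V - {y}) X ?B :: ('v, 'k) mpoly set)"
    proof (rule less.hyps[OF card _ X])
      show "?B k \<subseteq> V - {y}" if "k \<in> X" for k using that B yB by auto
      show "?B i \<inter> ?B k = {}" if "i \<in> X" "k \<in> X" "i \<noteq> k" for i k using dis[OF that] by auto
    qed (use V in simp)
    have N: "GVD (V - {y}) (mon_ideal (V - {y}) (X - {j}) B :: ('v, 'k) mpoly set)"
    proof (rule less.hyps[OF card])
      show "B k \<subseteq> V - {y}" if "k \<in> X - {j}" for k using that B yB by blast
    qed (use V X dis in auto)
    show ?thesis
    proof (rule GVD_decomposeI[OF V y ideal unmixed ideal_mon_ideal C ideal_mon_ideal N])
      fix f :: "('v, 'k) mpoly" and d
      assume f: "f \<in> mon_ideal V X B" and "\<And>m. m \<in> keys f \<Longrightarrow> lookup m y \<le> d"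
      have "\<exists>k\<in>X. ?B k \<subseteq> keys n" if n: "n \<in> keys (y_coeff y d f)" for n
      proof -
        have "n + single y d \<in> keys f" using n by (simp add: keys_y_coeff)
        then obtain k where k: "k \<in> X" "B k \<subseteq> keys (n + single y d)" using f by (auto simp: mon_ideal_def)
        then have "?B k \<subseteq> keys n" using keys_add_single_subset[of n y d] yB[of k] by auto
        then show ?thesis using k by blast
      qed
      then show "y_coeff y d f \<in> mon_ideal (V - {y}) X ?B"
        using f y_coeff_carrier by (auto simp: mon_ideal_def)
    next
      show "mon_ideal V X B \<inter> polys (V - {y}) = (mon_ideal (V - {y}) (X - {j}) B :: ('v, 'k) mpoly set)"
      proof (intro subset_antisym subsetI)
        fix f :: "('v, 'k) mpoly" assume f: "f \<in> mon_ideal V X B \<inter> polys (V - {y})"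
        have "\<exists>k\<in>X - {j}. B k \<subseteq> keys m" if m: "m \<in> keys f" for m
        proof -
          obtain k where k: "k \<in> X" "B k \<subseteq> keys m" using f m by (auto simp: mon_ideal_def)
          have "y \<notin> keys m" using f m by (auto simp: carrier_iff mem_monomials)
          then show ?thesis using k step by blast
        qed
        then show "f \<in> mon_ideal (V - {y}) (X - {j}) B" using f by (simp add: mon_ideal_def)
      next
        fix f :: "('v, 'k) mpoly" assume f: "f \<in> mon_ideal (V - {y}) (X - {j}) B"
        then have "f \<in> polys V" using carrier_mono[of "V - {y}" V] by (auto simp: mon_ideal_def)
        then show "f \<in> mon_ideal V X B \<inter> polys (V - {y})" using f by (auto simp: mon_ideal_def)
      qed
    next
      fix q :: "('v, 'k) mpoly" assume q: "q \<in> mon_ideal (V - {y}) X ?B"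
      have qc: "q \<in> polys V" using q carrier_mono[of "V - {y}" V] by (auto simp: mon_ideal_def)
      have "\<exists>k\<in>X. B k \<subseteq> keys m" if m: "m \<in> keys (q * Var y)" for m
      proof -
        obtain n where n: "n \<in> keys q" "m = single y 1 + n" using m keys_mult_Var_subset[of q y] by blast
        then obtain k where k: "k \<in> X" "?B k \<subseteq> keys n" using q unfolding mon_ideal_def by blast
        then have "B k \<subseteq> keys m" using n(2) by (auto simp: keys_add_nat split: if_splits)
        then show ?thesis using k(1) by blast
      qed
      then have "q * Var y \<in> mon_ideal V X B"
        using carrier_mult[OF qc carrier_Var[OF y]] by (simp add: mon_ideal_def)
      then show "\<exists>r\<in>polys (V - {y}). q * Var y - r \<in> mon_ideal V X B"
        by (intro bexI[of _ 0]) auto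
    qed
  qed
qed

section \<open>Decomposition of the toric ideals\<close>

lemma col_rel_add:
  assumes "col_rel A B X m n"
  shows "col_rel A B X (u + m) (u + n)"
proof -
  from assms obtain c where "col_shift A B X c m n" unfolding col_rel_def by blast
  from col_shiftD[OF this] show ?thesis by (intro col_relI[where c = c]) (auto simp: lookup_add)
qed

text \<open>Both monomials have the same exponent of \<open>y\<close>, so truncation affects them
  alike.\<close>

lemma col_rel_minus_outside:
  assumes "col_rel A B X m n" "y \<notin> support A B X"
  shows "col_rel A B X (m - single y d) (n - single y d)"
proof -
  from assms(1) obtain c where "col_shift A B X c m n" unfolding col_rel_def by blast
  note c = col_shiftD[OF this]
  have l: "lookup (p - single y d) v = (if v = y then lookup p v - d else lookup p v)" for p :: "'a monom" and v
    by (simp add: lookup_minus lookup_single when_def)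
  have "v \<noteq> y" if "i \<in> X" "v \<in> A i \<union> B i" for i v using that assms(2) by (auto simp: support_def)
  then show ?thesis using c by (intro col_relI[where c = c]) (auto simp: l)
qed

text \<open>One unchanged exponent in \<open>A i\<close> forces the shift of column \<open>i\<close>
  to be 0, and the column drops out of the relation.\<close>

lemma col_rel_remove:
  assumes col: "columns A B X" and rel: "col_rel A B X m n" and i: "i \<in> X" "v \<in> A i" "lookup m v = lookup n v"
  shows "col_rel A B (X - {i}) m n" "\<And>w. w \<in> A i \<Longrightarrow> lookup m w = lookup n w"
proof -
  from rel obtain c where "col_shift A B X c m n" unfolding col_rel_def by blast
  note c = col_shiftD[OF this]
  have ci: "c i = 0" using c(2)[OF i(1,2)] i(3) by simp
  then show A: "\<And>w. w \<in> A i \<Longrightarrow> lookup m w = lookup n w" using c(2)[OF i(1)] by simp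
  show "col_rel A B (X - {i}) m n"
  proof (rule col_relI[where c = c])
    show "sum c (X - {i}) = 0"
      using sum.remove[OF finite_columns[OF col] i(1), of c] c(1) ci by simp
    fix w assume "w \<notin> support A B (X - {i})"
    then have "w \<notin> support A B X \<or> w \<in> A i \<or> w \<in> B i" by (auto simp: support_def)
    then show "lookup m w = lookup n w" using c(3)[OF i(1), of w] c(4) A ci by auto
  qed (use c in auto)
qed

text \<open>It is enough that \<open>S\<close> is saturated among the monomials of \<open>f\<close>:
  the union of the classes met by \<open>keys f \<inter> S\<close> is saturated and meets
  \<open>keys f\<close> in the same monomials.\<close>

lemma toric_zsum_eq_0:
  assumes f: "f \<in> toric A B V X {}"
    and "\<And>m n. m \<in> keys f \<Longrightarrow> n \<in> keys f \<Longrightarrow> m \<in> S \<Longrightarrow> col_rel A B X m n \<Longrightarrow> n \<in> S"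
  shows "zsum f S = 0"
proof -
  let ?S = "{n. \<exists>m\<in>keys f \<inter> S. col_rel A B X m n}"
  have "saturated A B X ?S" by (rule saturatedI) (blast intro: col_rel_trans)
  then have "zsum f (?S \<inter> {m. keys m \<inter> {} = {}}) = 0" using f unfolding toric_def by blast
  moreover have "zsum f (?S \<inter> {m. keys m \<inter> {} = {}}) = zsum f S"
    using assms(2) col_rel_refl by (intro zsum_cong) blast
  ultimately show ?thesis by simp
qed

lemma toric_saturated_zsum: "f \<in> toric A B V X {} \<Longrightarrow> saturated A B X S \<Longrightarrow> zsum f S = 0"
  by (auto simp: toric_def)

lemma toricI:
  "f \<in> polys V \<Longrightarrow> (\<And>S. saturated A B X S \<Longrightarrow> zsum f S = 0) \<Longrightarrow> f \<in> toric A B V X {}"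
  by (simp add: toric_def)

lemma toric_carrier: "f \<in> toric A B V X Z \<Longrightarrow> f \<in> polys V"
  by (simp add: toric_def)

text \<open>A class containing only one monomial of \<open>f\<close> would have a nonzero
  coefficient sum.\<close>

lemma toric_ex_related:
  assumes "f \<in> toric A B V X {}" "m \<in> keys f"
  obtains n where "n \<in> keys f" "n \<noteq> m" "col_rel A B X m n"
proof -
  have "\<exists>n\<in>keys f. n \<noteq> m \<and> col_rel A B X m n"
  proof (rule ccontr)
    assume "\<not> ?thesis"
    then have "zsum f {m} = 0" by (intro toric_zsum_eq_0[OF assms(1)]) auto
    then show False using assms(2) by (simp add: in_keys_iff flip: lookup_eq_zsum)
  qed
  then show ?thesis using that by blast
qed

text \<open>The shifts add up to 0 without all being 0, so one of them is negative. In particular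
  the product over that \<open>B j\<close> divides \<open>m\<close>.\<close>

lemma col_rel_ex_negative:
  assumes col: "columns A B X" and rel: "col_rel A B X m n" "m \<noteq> n"
  shows "\<exists>j\<in>X. (\<forall>v\<in>B j. lookup m v > lookup n v) \<and> (\<forall>v\<in>A j. lookup m v < lookup n v)"
proof -
  from rel obtain c where "col_shift A B X c m n" using rel(1) unfolding col_rel_def by blast
  note c = col_shiftD[OF this]
  have "\<exists>j\<in>X. c j < 0"
  proof (rule ccontr)
    assume "\<not> ?thesis"
    then have nn: "\<And>j. j \<in> X \<Longrightarrow> c j \<ge> 0" by (meson not_le)
    then have c0: "\<forall>j\<in>X. c j = 0" using c(1) sum_nonneg_eq_0_iff[OF finite_columns[OF col] nn] by simp
    have "lookup m v = lookup n v" for v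
    proof (cases "v \<in> support A B X")
      case True
      then obtain i where "i \<in> X" "v \<in> A i \<or> v \<in> B i" by (auto simp: support_def)
      then show ?thesis using c(2,3)[of i v] c0 by auto
    qed (rule c(4))
    then show False using rel(2) poly_mapping_eqI by blast
  qed
  then obtain j where j: "j \<in> X" "c j < 0" by blast
  have "int (lookup m v) > int (lookup n v)" if "v \<in> B j" for v using c(3)[OF j(1) that] j(2) by linarith
  moreover have "int (lookup m v) < int (lookup n v)" if "v \<in> A j" for v using c(2)[OF j(1) that] j(2) by linarith
  ultimately show ?thesis using j(1) by (intro bexI[of _ j]) auto
qed

lemma toric_subset_mon_ideal:
  assumes "columns A B X"
  shows "toric A B V X {} \<subseteq> mon_ideal V X B"
proof
  fix f assume f: "f \<in> toric A B V X {}"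
  have "\<exists>j\<in>X. B j \<subseteq> keys m" if m: "m \<in> keys f" for m
  proof -
    obtain n where "n \<noteq> m" "col_rel A B X m n" using toric_ex_related[OF f m] by blast
    then obtain j where "j \<in> X" "\<forall>v\<in>B j. lookup m v > lookup n v"
      using col_rel_ex_negative[OF assms, of m n] by blast
    then have "B j \<subseteq> keys m" by (auto simp: in_keys_iff)
    then show ?thesis using \<open>j \<in> X\<close> by blast
  qed
  then show "f \<in> mon_ideal V X B" using toric_carrier[OF f] by (simp add: mon_ideal_def)
qed

text \<open>The ideal $N + M \langle B_j : j \in X \rangle$, where $N$ is the toric ideal, \<open>M\<close> is the product of
  the variables in \<open>Y\<close> and $B_j$ the product over \<open>B j\<close>.\<close>

definition link_ideal ::
    "(nat \<Rightarrow> 'v set) \<Rightarrow> (nat \<Rightarrow> 'v set) \<Rightarrow> 'v set \<Rightarrow> nat set \<Rightarrow> 'v set \<Rightarrow> ('v, 'k::field) mpoly set" where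
  "link_ideal A B V X Y = {f \<in> mon_ideal V X B.
     \<forall>S. saturated A B X S \<longrightarrow> zsum f (S \<inter> {m. \<not> Y \<subseteq> keys m}) = 0}"

lemma saturated_keys:
  assumes "Y \<inter> support A B X = {}"
  shows "saturated A B X {m. P (Y \<inter> keys m)}"
proof (rule saturated_outside[OF assms])
  fix m n :: "'a monom" assume "\<And>v. v \<in> Y \<Longrightarrow> lookup m v = lookup n v"
  then have "Y \<inter> keys m = Y \<inter> keys n" by (auto simp: in_keys_iff)
  then show "P (Y \<inter> keys m) \<longleftrightarrow> P (Y \<inter> keys n)" by simp
qed

lemma saturated_not_superset:
  assumes "Y \<inter> support A B X = {}"
  shows "saturated A B X {m. \<not> Y \<subseteq> keys m}"
  using saturated_keys[OF assms, of "\<lambda>K. K \<noteq> Y"] by (simp add: inf.absorb_iff1[symmetric])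

text \<open>A monomial not divisible by the product over \<open>Y\<close> misses some variable of
  \<open>Y\<close>. As \<open>Y\<close> lies outside the columns, which variables are missing is
  constant on classes, and the coefficient sums can be split accordingly.\<close>

lemma link_ideal_eq_Inter:
  fixes A B :: "nat \<Rightarrow> 'v set"
  assumes Y: "finite Y" "Y \<inter> support A B X = {}"
  shows "link_ideal A B V X Y = polys V \<inter>
    \<Inter>((\<lambda>y. toric A B V X {y}) ` Y \<union> (\<lambda>b. toric A B V {} (b ` X)) ` Pi\<^sub>E X B :: ('v, 'k::field) mpoly set set)"
proof -
  have "(\<forall>S. saturated A B X S \<longrightarrow> zsum f (S \<inter> {m. \<not> Y \<subseteq> keys m}) = 0) \<longleftrightarrow>
      (\<forall>y\<in>Y. \<forall>S. saturated A B X S \<longrightarrow> zsum f (S \<inter> {m. keys m \<inter> {y} = {}}) = 0)" (is "?l \<longleftrightarrow> ?r")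
    for f :: "('v, 'k) mpoly"
  proof
    assume l: ?l
    show ?r
    proof (intro ballI allI impI)
      fix y S assume y: "y \<in> Y" and S: "saturated A B X S"
      have "saturated A B X {m. \<not> {y} \<subseteq> keys m}"
        using Y(2) y by (intro saturated_not_superset) blast
      then have "saturated A B X (S \<inter> {m. \<not> {y} \<subseteq> keys m})" by (rule saturated_Int[OF S])
      then have "zsum f (S \<inter> {m. \<not> {y} \<subseteq> keys m} \<inter> {m. \<not> Y \<subseteq> keys m}) = 0" using l by blast
      moreover have "S \<inter> {m. \<not> {y} \<subseteq> keys m} \<inter> {m. \<not> Y \<subseteq> keys m} = S \<inter> {m. keys m \<inter> {y} = {}}"
        using y by auto
      ultimately show "zsum f (S \<inter> {m. keys m \<inter> {y} = {}}) = 0" by simp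
    qed
  next
    assume ?r
    with Y show ?l
    proof (induction Y rule: finite_induct)
      case (insert y Y)
      show ?case
      proof (intro allI impI)
        fix S assume S: "saturated A B X S"
        have "saturated A B X {m. {y} \<inter> keys m = {y}}"
          using insert.prems(1) by (intro saturated_keys) blast
        then have "saturated A B X (S \<inter> {m. {y} \<inter> keys m = {y}})" by (rule saturated_Int[OF S])
        then have 1: "zsum f (S \<inter> {m. {y} \<inter> keys m = {y}} \<inter> {m. \<not> Y \<subseteq> keys m}) = 0"
          using insert.IH insert.prems by blast
        have 2: "zsum f (S \<inter> {m. keys m \<inter> {y} = {}}) = 0" using insert.prems(2) S by blast
        \<comment> \<open>The monomials that contain \<open>y\<close> but miss part of
          \<open>Y\<close>, and those that miss \<open>y\<close>.\<close>
        have "S \<inter> {m. \<not> insert y Y \<subseteq> keys m} =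
            (S \<inter> {m. {y} \<inter> keys m = {y}} \<inter> {m. \<not> Y \<subseteq> keys m}) \<union> (S \<inter> {m. keys m \<inter> {y} = {}})" by auto
        then show "zsum f (S \<inter> {m. \<not> insert y Y \<subseteq> keys m}) = 0"
          using 1 2 by (subst \<open>S \<inter> _ = _\<close>, subst zsum_Un_disjoint) auto
      qed
    qed (simp add: zsum_def)
  qed
  then have "(\<forall>S. saturated A B X S \<longrightarrow> zsum f (S \<inter> {m. \<not> Y \<subseteq> keys m}) = 0) \<longleftrightarrow>
      (\<forall>y\<in>Y. f \<in> toric A B V X {y})" if "f \<in> polys V" for f :: "('v, 'k) mpoly"
    using that by (simp add: toric_def)
  then have "f \<in> link_ideal A B V X Y \<longleftrightarrow> f \<in> mon_ideal V X B \<and> (\<forall>y\<in>Y. f \<in> toric A B V X {y})"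
    for f :: "('v, 'k) mpoly"
    by (cases "f \<in> polys V") (simp_all add: link_ideal_def mon_ideal_def)
  then show ?thesis
    unfolding set_eq_iff mon_ideal_eq_Inter[of V X B A B] Inter_Un_distrib Int_iff INT_iff by blast
qed

text \<open>All primes in the decomposition have height |X|: one variable adds 1 to the height |X| -
  1 of the minors, where \<open>X \<noteq> {}\<close> enters, and a transversal has |X|
  variables.\<close>

lemma link_ideal:
  assumes V: "finite V" and col: "columns A B X" "X \<noteq> {}" "support A B X \<subseteq> V"
    and Y: "Y \<subseteq> V" "Y \<inter> support A B X = {}"
  shows "ideal (link_ideal A B V X Y :: ('v, 'k::field) mpoly set) (poly_ring V)"
    and "unmixed (poly_ring V) (link_ideal A B V X Y :: ('v, 'k) mpoly set)"
proof -
  let ?F = "(\<lambda>y. toric A B V X {y}) ` Y \<union> (\<lambda>b. toric A B V {} (b ` X)) ` Pi\<^sub>E X B :: ('v, 'k) mpoly set set"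
  have fin: "finite X" "finite Y" using finite_columns[OF col(1)] finite_subset[OF Y(1) V] by auto
  have B: "B j \<subseteq> V" if "j \<in> X" for j using that col(3) by (auto simp: support_def)
  have dis: "B i \<inter> B j = {}" if "i \<in> X" "j \<in> X" "i \<noteq> j" for i j
    using that columns_disjoint(3)[OF col(1) that(1,2)] by blast
  have prime: "primeideal P (poly_ring V) \<and> height (poly_ring V) P = enat (card X)" if "P \<in> ?F" for P
    using that
  proof
    assume "P \<in> (\<lambda>y. toric A B V X {y}) ` Y"
    then obtain y where y: "y \<in> Y" "P = toric A B V X {y}" by blast
    have "primeideal P (poly_ring V)" unfolding y(2) by (rule primeideal_toric[OF V col(1,3)])
    moreover have "card {y} + (card X - 1) = card X" using col(2) fin by (simp add: card_gt_0_iff Suc_leI)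
    moreover have "{y} \<subseteq> V" "{y} \<inter> support A B X = {}" using y Y by blast+
    then have "height (poly_ring V) P = enat (card {y} + (card X - 1))"
      unfolding y(2) by (intro height_toric[OF V _ col(1,3)])
    ultimately show ?thesis by simp
  next
    assume "P \<in> (\<lambda>b. toric A B V {} (b ` X)) ` Pi\<^sub>E X B"
    then obtain b where b: "b \<in> Pi\<^sub>E X B" "P = toric A B V {} (b ` X)" by blast
    show ?thesis unfolding b(2) by (intro conjI transversal_prime[OF V B dis b(1)])
  qed
  have "ideal P (poly_ring V)" if "P \<in> ?F" for P
    using conjunct1[OF prime[OF that]] by (rule primeideal.axioms(1))
  then have "ideal (polys V \<inter> \<Inter>?F) (poly_ring V)" by (rule ideal_Inter_carrier)
  then show "ideal (link_ideal A B V X Y :: ('v, 'k) mpoly set) (poly_ring V)"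
    unfolding link_ideal_eq_Inter[OF fin(2) Y(2)] .
  have "finite (Pi\<^sub>E X B)" using fin(1) finite_subset[OF B V] by (rule finite_PiE)
  then have "finite ?F" using fin(2) by simp
  then have "unmixed (poly_ring V) (polys V \<inter> \<Inter>?F)"
    by (rule unmixed_Inter_primes[where h = "enat (card X)"]) (simp_all only: prime)
  then show "unmixed (poly_ring V) (link_ideal A B V X Y :: ('v, 'k) mpoly set)"
    unfolding link_ideal_eq_Inter[OF fin(2) Y(2)] .
qed

lemma saturated_translate: "saturated A B X S \<Longrightarrow> saturated A B X {m. u + m \<in> S}"
proof (rule saturatedI)
  fix m n assume S: "saturated A B X S" and mn: "m \<in> {m. u + m \<in> S}" "col_rel A B X m n"
  show "n \<in> {m. u + m \<in> S}"
    using saturatedD[OF S col_rel_add[OF mn(2)], of u] mn(1) by simp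
qed

lemma zsum_mult_Var: "zsum (q * Var y) S = zsum q {m. single y 1 + m \<in> S}"
  using zsum_monom_mult[of "single y 1" 1 q S] by (simp add: Var_def mult.commute)

lemma keys_minus_single: "v \<noteq> y \<Longrightarrow> v \<in> keys (m - single y d) \<longleftrightarrow> v \<in> keys (m :: 'v monom)"
  by (simp add: in_keys_iff lookup_minus lookup_single when_def)

text \<open>The decomposability of the toric ideal is assumed for every \<open>V\<close>, because
  the ring loses a variable with each element of \<open>Y\<close>. In \<open>GVD_toric\<close> the
  induction on the number of columns supplies it.\<close>

lemma GVD_link_ideal:
  fixes A B :: "nat \<Rightarrow> 'v set"
  assumes col: "columns A B X" "X \<noteq> {}"
    and toric: "\<And>V. finite V \<Longrightarrow> support A B X \<subseteq> V \<Longrightarrow> GVD V (toric A B V X {} :: ('v, 'k::field) mpoly set)"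
    and "finite Y" "finite V" "support A B X \<subseteq> V" "Y \<subseteq> V" "Y \<inter> support A B X = {}"
  shows "GVD V (link_ideal A B V X Y :: ('v, 'k) mpoly set)"
  using assms(4-)
proof (induction Y arbitrary: V rule: finite_induct)
  case empty
  have "link_ideal A B V X {} = (mon_ideal V X B :: ('v, 'k) mpoly set)"
    by (simp add: link_ideal_def zsum_def)
  moreover have "GVD V (mon_ideal V X B :: ('v, 'k) mpoly set)"
  proof (rule GVD_mon_ideal[OF empty(1) finite_columns[OF col(1)]])
    show "B j \<subseteq> V" if "j \<in> X" for j using that empty(2) by (auto simp: support_def)
    show "B i \<inter> B j = {}" if "i \<in> X" "j \<in> X" "i \<noteq> j" for i j
      using that columns_disjoint(3)[OF col(1) that(1,2)] by blast
  qed
  ultimately show ?case by simp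
next
  case (insert y Y)
  note V = insert.prems(1) and sup = insert.prems(2)
  have y: "y \<in> V" "y \<notin> support A B X" "y \<notin> Y" and Y: "Y \<inter> support A B X = {}" "Y \<subseteq> V - {y}"
    using insert.prems insert.hyps by auto
  have sup': "support A B X \<subseteq> V - {y}" and V': "finite (V - {y})" using sup y V by auto
  have yB: "y \<notin> B k" if "k \<in> X" for k using that y(2) by (auto simp: support_def)
  have up: "f \<in> polys V" if "f \<in> polys (V - {y})" for f :: "('v, 'k) mpoly"
    using that carrier_mono[of "V - {y}" V] by blast
  show ?case
  proof (rule GVD_decomposeI[OF V y(1) link_ideal[OF V col sup insert.prems(3,4)]
        link_ideal(1)[OF V' col sup' Y(2,1)] insert.IH[OF V' sup' Y(2,1)]
        ideal_toric[OF V' col(1) sup'] toric[OF V' sup']])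
    fix f :: "('v, 'k) mpoly" and d
    assume f: "f \<in> link_ideal A B V X (insert y Y)"
    have "\<exists>k\<in>X. B k \<subseteq> keys n" if n: "n \<in> keys (y_coeff y d f)" for n
    proof -
      have "n + single y d \<in> keys f" using n by (simp add: keys_y_coeff)
      then obtain k where k: "k \<in> X" "B k \<subseteq> keys (n + single y d)"
        using f by (auto simp: mon_ideal_def link_ideal_def)
      then have "B k \<subseteq> keys n" using keys_add_single_subset[of n y d] yB[of k] by auto
      then show ?thesis using k by blast
    qed
    moreover have "zsum (y_coeff y d f) (S \<inter> {m. \<not> Y \<subseteq> keys m}) = 0" if S: "saturated A B X S" for S
    proof -
      \<comment> \<open>The condition that part of \<open>Y\<close> is missing is put into
        \<open>?S\<close>; it implies the one for \<open>insert y Y\<close>, so the vanishing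
        condition on \<open>f\<close> gives exactly the sum for the coefficient.\<close>
      let ?S = "{m. lookup m y = d} \<inter> {m. m - single y d \<in> S} \<inter> {m. \<not> Y \<subseteq> keys m}"
      have "saturated A B X {m. lookup m y = d}"
        using y(2) by (intro saturated_outside[of "{y}"]) auto
      moreover have "saturated A B X {m. m - single y d \<in> S}"
      proof (rule saturatedI)
        fix m n assume "m \<in> {m. m - single y d \<in> S}" "col_rel A B X m n"
        then show "n \<in> {m. m - single y d \<in> S}"
          using saturatedD[OF S col_rel_minus_outside[OF _ y(2), of m n d]] by simp
      qed
      ultimately have "saturated A B X ?S"
        using saturated_not_superset[OF Y(1)] by (intro saturated_Int)
      then have "zsum f (?S \<inter> {m. \<not> insert y Y \<subseteq> keys m}) = 0" using f unfolding link_ideal_def by blast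
      moreover have "Y \<subseteq> keys (m - single y d) \<longleftrightarrow> Y \<subseteq> keys m" for m :: "'v monom"
      proof -
        have "v \<in> keys (m - single y d) \<longleftrightarrow> v \<in> keys m" if "v \<in> Y" for v
          using that y(3) by (intro keys_minus_single) auto
        then show ?thesis by (simp add: subset_iff)
      qed
      then have "?S \<inter> {m. \<not> insert y Y \<subseteq> keys m} =
          {m. lookup m y = d \<and> m - single y d \<in> S \<inter> {m. \<not> Y \<subseteq> keys m}}" by auto
      ultimately show ?thesis by (simp add: zsum_y_coeff)
    qed
    moreover have "y_coeff y d f \<in> polys (V - {y})"
      using f by (intro y_coeff_carrier) (simp add: mon_ideal_def link_ideal_def)
    ultimately show "y_coeff y d f \<in> link_ideal A B (V - {y}) X Y"
      by (simp add: mon_ideal_def link_ideal_def)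
  next
    show "link_ideal A B V X (insert y Y) \<inter> polys (V - {y}) =
        (toric A B (V - {y}) X {} :: ('v, 'k) mpoly set)"
    proof (intro subset_antisym subsetI)
      fix f :: "('v, 'k) mpoly" assume f: "f \<in> link_ideal A B V X (insert y Y) \<inter> polys (V - {y})"
      show "f \<in> toric A B (V - {y}) X {}"
      proof (rule toricI)
        fix S assume "saturated A B X S"
        then have "zsum f (S \<inter> {m. \<not> insert y Y \<subseteq> keys m}) = 0" using f unfolding link_ideal_def by blast
        \<comment> \<open>A monomial without \<open>y\<close> never contains
          \<open>insert y Y\<close>, so the restriction disappears and the toric condition
          remains.\<close>
        moreover have "zsum f (S \<inter> {m. \<not> insert y Y \<subseteq> keys m}) = zsum f S"
          using f by (intro zsum_cong) (auto simp: carrier_iff mem_monomials)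
        ultimately show "zsum f S = 0" by simp
      qed (use f in blast)
    next
      fix f :: "('v, 'k) mpoly" assume f: "f \<in> toric A B (V - {y}) X {}"
      have fc: "f \<in> polys (V - {y})" using toric_carrier[OF f] .
      have "f \<in> mon_ideal (V - {y}) X B" using f toric_subset_mon_ideal[OF col(1)] by blast
      then have "f \<in> mon_ideal V X B" using up[OF fc] by (simp add: mon_ideal_def)
      moreover have "zsum f (S \<inter> {m. \<not> insert y Y \<subseteq> keys m}) = 0" if "saturated A B X S" for S
        by (rule toric_saturated_zsum[OF f])
          (intro saturated_Int that saturated_not_superset insert.prems(4))
      ultimately show "f \<in> link_ideal A B V X (insert y Y) \<inter> polys (V - {y})"
        using fc by (simp add: link_ideal_def)
    qed
  next
    fix q :: "('v, 'k) mpoly" assume q: "q \<in> link_ideal A B (V - {y}) X Y"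
    then have qm: "q \<in> mon_ideal (V - {y}) X B"
      and qs: "\<And>S. saturated A B X S \<Longrightarrow> zsum q (S \<inter> {m. \<not> Y \<subseteq> keys m}) = 0"
      by (simp_all add: link_ideal_def)
    have qc: "q \<in> polys V" using qm by (intro up) (simp add: mon_ideal_def)
    have "\<exists>k\<in>X. B k \<subseteq> keys m" if m: "m \<in> keys (q * Var y)" for m
    proof -
      obtain n where n: "n \<in> keys q" "m = single y 1 + n" using m keys_mult_Var_subset[of q y] by blast
      then obtain k where k: "k \<in> X" "B k \<subseteq> keys n" using qm unfolding mon_ideal_def by blast
      then show ?thesis using n(2) by (auto simp: keys_add_nat)
    qed
    moreover have "zsum (q * Var y) (S \<inter> {m. \<not> insert y Y \<subseteq> keys m}) = 0" if "saturated A B X S" for S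
    proof -
      have "zsum q ({m. single y 1 + m \<in> S} \<inter> {m. \<not> Y \<subseteq> keys m}) = 0"
        by (rule qs[OF saturated_translate[OF that]])
      moreover have "insert y Y \<subseteq> keys (single y 1 + m) \<longleftrightarrow> Y \<subseteq> keys m" for m :: "'v monom"
        using y(3) by (auto simp: keys_add_nat)
      then have "{m. single y 1 + m \<in> S \<inter> {m. \<not> insert y Y \<subseteq> keys m}} =
          {m. single y 1 + m \<in> S} \<inter> {m. \<not> Y \<subseteq> keys m}"
        unfolding set_eq_iff Int_iff mem_Collect_eq by blast
      ultimately show ?thesis by (simp only: zsum_mult_Var)
    qed
    moreover have "q * Var y \<in> polys V" by (rule carrier_mult[OF qc carrier_Var[OF y(1)]])
    ultimately have "q * Var y \<in> link_ideal A B V X (insert y Y)"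
      unfolding mon_ideal_def link_ideal_def by blast
    then show "\<exists>r\<in>polys (V - {y}). q * Var y - r \<in> link_ideal A B V X (insert y Y)"
      by (intro bexI[of _ 0]) auto
  qed
qed

text \<open>The inclusion of top coefficients in C compares monomials with the largest exponent of
  \<open>y\<close>; the lift to an element linear in \<open>y\<close> exchanges the two terms of a
  minor, A_i B_j for A_j B_i.\<close>

lemma GVD_toric:
  fixes A B :: "nat \<Rightarrow> 'v set"
  assumes "finite V" "columns A B X" "support A B X \<subseteq> V"
  shows "GVD V (toric A B V X {} :: ('v, 'k::field) mpoly set)"
  using assms
proof (induction "card X" arbitrary: V X rule: less_induct)
  case less
  note V = less.prems(1) and col = less.prems(2) and sup = less.prems(3)
  note X = finite_columns[OF col]
  show ?case
  proof (cases "card X \<le> 1")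
    case True
    then have "X = {} \<or> (\<exists>i. X = {i})" using X by (auto simp: le_Suc_eq card_1_singleton_iff)
    then have "toric A B V X {} = (mon_ideal V {} B :: ('v, 'k) mpoly set)"
      by (auto simp: toric_singleton toric_empty mon_ideal_def)
    then show ?thesis using GVD_mon_ideal[OF V, of "{}" B] by simp
  next
    case False
    then obtain i where i: "i \<in> X" by fastforce
    have "A i \<noteq> {}" using col i unfolding columns_def by blast
    then obtain y where y: "y \<in> A i" by blast
    let ?X = "X - {i}" and ?Y = "A i - {y}"
    have fin: "finite (A i)" "finite (B i)" using col i by (auto simp: columns_def)
    have card: "card ?X < card X" using X i by (intro psubset_card_mono) auto
    have col': "columns A B ?X" using col by (rule columns_subset) blast
    have "card ?X > 0" using False X i by simp
    then have ne: "?X \<noteq> {}" by force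
    have yV: "y \<in> V" using y i sup by (auto simp: support_def)
    have A_out: "v \<notin> support A B ?X" if "v \<in> A i" for v
      using that i columns_disjoint[OF col] unfolding support_def by blast
    have y_out: "y \<notin> support A B ?X" using A_out y by blast
    have sup': "support A B ?X \<subseteq> V - {y}"
      using support_mono[of ?X X A B] sup y_out by blast
    have V': "finite (V - {y})" using V by simp
    have Y: "?Y \<subseteq> V - {y}" "?Y \<inter> support A B ?X = {}" "finite ?Y"
      using sup i A_out fin by (auto simp: support_def)
    have N: "GVD (V - {y}) (toric A B (V - {y}) ?X {} :: ('v, 'k) mpoly set)"
      by (rule less.hyps[OF card V' col' sup'])
    have C: "GVD (V - {y}) (link_ideal A B (V - {y}) ?X ?Y :: ('v, 'k) mpoly set)"
      by (rule GVD_link_ideal[OF col' ne less.hyps[OF card _ col'] Y(3) V' sup' Y(1,2)])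
    note I = ideal_toric[OF V col sup, of "{}"]
    have unmixed: "unmixed (poly_ring V) (toric A B V X {} :: ('v, 'k) mpoly set)"
    proof -
      have "unmixed (poly_ring V) (polys V \<inter> \<Inter>{toric A B V X {} :: ('v, 'k) mpoly set})"
        using primeideal_toric[OF V col sup, of "{}"]
        by (intro unmixed_Inter_primes[where h = "height (poly_ring V) (toric A B V X {})"]) auto
      moreover have "polys V \<inter> \<Inter>{toric A B V X {} :: ('v, 'k) mpoly set} = toric A B V X {}"
        by (auto simp: toric_def)
      ultimately show ?thesis by simp
    qed
    show ?thesis
    proof (rule GVD_decomposeI[OF V yV I unmixed link_ideal(1)[OF V' col' ne sup' Y(1,2)] C
          ideal_toric[OF V' col' sup'] N])
      fix f :: "('v, 'k) mpoly" and d
      assume f: "f \<in> toric A B V X {}" and d: "\<And>m. m \<in> keys f \<Longrightarrow> lookup m y \<le> d"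
      have "\<exists>j\<in>?X. B j \<subseteq> keys n" if n: "n \<in> keys (y_coeff y d f)" for n
      proof -
        define m where "m = n + single y d"
        have m: "m \<in> keys f" "lookup m y = d" using n by (auto simp: keys_y_coeff m_def lookup_add)
        obtain m' where m': "m' \<in> keys f" "m' \<noteq> m" "col_rel A B X m m'"
          using toric_ex_related[OF f m(1)] by blast
        then obtain j where j: "j \<in> X" "\<forall>v\<in>B j. lookup m v > lookup m' v" "\<forall>v\<in>A j. lookup m v < lookup m' v"
          using col_rel_ex_negative[OF col, of m m'] by blast
        \<comment> \<open>A negative shift in column \<open>i\<close> would raise the exponent of
          \<open>y\<close> above its maximum \<open>d\<close>.\<close>
        have "j \<noteq> i" using j(3) y d[OF m'(1)] m(2) by force
        moreover have "B j \<subseteq> keys n"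
        proof
          fix v assume v: "v \<in> B j"
          then have "v \<in> keys m" using j(2) by (auto simp: in_keys_iff)
          moreover have "v \<noteq> y" using columns_disjoint(1)[OF col i j(1) y] v by blast
          ultimately show "v \<in> keys n" using keys_add_single_subset[of n y d] by (auto simp: m_def)
        qed
        ultimately show ?thesis using j(1) by blast
      qed
      moreover have "zsum (y_coeff y d f) (S \<inter> {m. \<not> ?Y \<subseteq> keys m}) = 0" if S: "saturated A B ?X S" for S
        unfolding zsum_y_coeff
      proof (rule toric_zsum_eq_0[OF f])
        let ?U = "{m. lookup m y = d \<and> m - single y d \<in> S \<inter> {m. \<not> ?Y \<subseteq> keys m}}"
        fix m n assume m: "m \<in> keys f" "m \<in> ?U" and n: "n \<in> keys f" and rel: "col_rel A B X m n"
        obtain v where v: "v \<in> A i" "v \<noteq> y" "v \<notin> keys (m - single y d)" using m(2) by blast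
        then have v0: "lookup m v = 0" using keys_minus_single[of v y m d] by (simp add: in_keys_iff)
        obtain c where c': "col_shift A B X c m n" using rel unfolding col_rel_def by blast
        note c = col_shiftD(2)[OF c' i]
        \<comment> \<open>From \<open>m\<close> to \<open>n\<close> the exponents of
          \<open>v\<close> and \<open>y\<close> change by the same amount. That of \<open>v\<close>
          is 0 and cannot drop, that of \<open>y\<close> is the maximum \<open>d\<close> and cannot
          rise.\<close>
        have "c i \<le> 0" using c[OF v(1)] v0 by simp
        moreover have "c i \<ge> 0" using c[OF y] d[OF n] m(2) by simp
        ultimately have eq: "lookup m y = lookup n y" using c[OF y] by simp
        note rem = col_rel_remove[OF col rel i y eq]
        have "n - single y d \<in> S"
          using saturatedD[OF S col_rel_minus_outside[OF rem(1) y_out, of d]] m(2) by simp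
        moreover have "v \<notin> keys (n - single y d)"
          using v v0 rem(2)[OF v(1)] keys_minus_single[of v y n d] by (simp add: in_keys_iff)
        ultimately show "n \<in> ?U" using m(2) eq v by auto
      qed
      moreover have "y_coeff y d f \<in> polys (V - {y})"
        using toric_carrier[OF f] by (rule y_coeff_carrier)
      ultimately show "y_coeff y d f \<in> link_ideal A B (V - {y}) ?X ?Y"
        by (simp add: mon_ideal_def link_ideal_def)
    next
      show "toric A B V X {} \<inter> polys (V - {y}) = (toric A B (V - {y}) ?X {} :: ('v, 'k) mpoly set)"
      proof (intro subset_antisym subsetI)
        fix f :: "('v, 'k) mpoly" assume f: "f \<in> toric A B V X {} \<inter> polys (V - {y})"
        have y0: "lookup m y = 0" if "m \<in> keys f" for m using f that by (simp add: carrier_iff monomials_minus_y)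
        show "f \<in> toric A B (V - {y}) ?X {}"
        proof (rule toricI)
          fix S assume S: "saturated A B ?X S"
          show "zsum f S = 0"
          proof (rule toric_zsum_eq_0)
            fix m n assume mn: "m \<in> keys f" "n \<in> keys f" "m \<in> S" "col_rel A B X m n"
            \<comment> \<open>Neither monomial contains \<open>y\<close>, so column \<open>i\<close>
              is not shifted.\<close>
            have "col_rel A B ?X m n"
              by (rule col_rel_remove(1)[OF col mn(4) i y]) (simp add: y0 mn)
            then show "n \<in> S" using saturatedD[OF S] mn(3) by blast
          qed (use f in blast)
        qed (use f in blast)
      next
        fix f :: "('v, 'k) mpoly" assume f: "f \<in> toric A B (V - {y}) ?X {}"
        have fc: "f \<in> polys (V - {y})" using f by (rule toric_carrier)
        moreover have "f \<in> toric A B V X {}"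
        proof (rule toricI)
          show "f \<in> polys V" using fc carrier_mono[of "V - {y}" V] by blast
          fix S assume "saturated A B X S"
          then have "saturated A B ?X S" by (rule saturated_mono[OF col, rotated]) blast
          then show "zsum f S = 0" by (rule toric_saturated_zsum[OF f])
        qed
        ultimately show "f \<in> toric A B V X {} \<inter> polys (V - {y})" by blast
      qed
    next
      fix q :: "('v, 'k) mpoly" assume q: "q \<in> link_ideal A B (V - {y}) ?X ?Y"
      then have qm: "q \<in> mon_ideal (V - {y}) ?X B"
        and qs: "\<And>S. saturated A B ?X S \<Longrightarrow> zsum q (S \<inter> {m. \<not> ?Y \<subseteq> keys m}) = 0"
        by (simp_all add: link_ideal_def)
      have qc: "q \<in> polys (V - {y})" using qm by (simp add: mon_ideal_def)
      \<comment> \<open>If \<open>m\<close> is divisible by the product over \<open>?Y\<close>, then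
        \<open>m\<close> times \<open>y\<close> is divisible by A_i B_j for some \<open>j\<close>,
        and a minor replaces this factor by A_j B_i, which is free of \<open>y\<close>.\<close>
      have "\<exists>n\<in>monomials (V - {y}). col_rel A B X (single y 1 + m) n" if m: "m \<in> keys q" "?Y \<subseteq> keys m" for m
      proof -
        obtain j where j: "j \<in> X" "j \<noteq> i" "B j \<subseteq> keys m" using qm m(1) unfolding mon_ideal_def by blast
        have mV: "m \<in> monomials (V - {y})" using qc m(1) by (simp add: carrier_iff)
        have finj: "finite (A j)" "finite (B j)" using col j by (auto simp: columns_def)
        let ?s = "\<lambda>S v. if v \<in> S then 1 else 0 :: nat"
        \<comment> \<open>The subtractions are exact, because \<open>m\<close> contains the disjoint
          sets \<open>?Y\<close> and \<open>B j\<close>.\<close>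
        define n where "n = m - squarefree_monom ?Y - squarefree_monom (B j)
            + squarefree_monom (A j) + squarefree_monom (B i)"
        have ln: "lookup n v = lookup m v - ?s ?Y v - ?s (B j) v + ?s (A j) v + ?s (B i) v" for v
          unfolding n_def lookup_add lookup_minus using fin finj Y(3) by (simp add: lookup_squarefree_monom)
        have pos: "lookup m v > 0" if "v \<in> ?Y \<union> B j" for v
          using that m(2) j(3) by (auto simp: in_keys_iff)
        have my: "lookup m y = 0" using mV by (simp add: monomials_minus_y)
        have d1: "v \<notin> B i \<and> v \<notin> B j \<and> v \<notin> A j" if "v \<in> A i" for v
          using that columns_disjoint[OF col i i, of v] columns_disjoint[OF col i j(1), of v] j(2) by blast
        have d2: "v \<notin> A i \<and> v \<notin> A j \<and> v \<notin> B j" if "v \<in> B i" for v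
          using that columns_disjoint(1)[OF col i i, of v] columns_disjoint(1)[OF col j(1) i, of v]
            columns_disjoint(3)[OF col i j(1), of v] j(2) by blast
        have d3: "v \<notin> A i \<and> v \<notin> B i \<and> v \<notin> B j" if "v \<in> A j" for v
          using that columns_disjoint[OF col j(1) i, of v] columns_disjoint(1)[OF col j(1) j(1), of v] j(2) by blast
        have lm: "lookup (single y 1 + m) v = (if v = y then 1 else lookup m v)" for v
          using my by (simp add: lookup_add lookup_single when_def)
        have other: "lookup n v = lookup (single y 1 + m) v" if "v \<notin> A i \<union> B i \<union> A j \<union> B j" for v
          unfolding ln lm using that y by auto
        have vA: "int (lookup (single y 1 + m) v) = int (lookup n v) + 1" if "v \<in> A i" for v
          unfolding ln lm using d1[OF that] that pos[of v] my by auto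
        have vB: "int (lookup (single y 1 + m) v) = int (lookup n v) - 1" if "v \<in> B i" for v
          unfolding ln lm using d2[OF that] that y by auto
        have wA: "int (lookup (single y 1 + m) v) = int (lookup n v) - 1" if "v \<in> A j" for v
          unfolding ln lm using d3[OF that] that y by auto
        have wB: "int (lookup (single y 1 + m) v) = int (lookup n v) + 1" if "v \<in> B j" for v
          unfolding ln lm using d1[of v] d2[of v] d3[of v] that pos[of v] y by auto
        have "col_rel A B X (single y 1 + m) n"
        proof (rule col_relI[where c = "\<lambda>l. if l = i then 1 else if l = j then - 1 else 0"])
          have "(\<Sum>l\<in>X. if l = i then 1 else if l = j then - 1 else (0 :: int)) =
              (\<Sum>l\<in>X. (if l = i then 1 else 0) + (if l = j then - 1 else 0))"
            using j(2) by (intro sum.cong) auto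
          then show "(\<Sum>l\<in>X. if l = i then 1 else if l = j then - 1 else (0 :: int)) = 0"
            using X i j(1) by (simp add: sum.distrib)
          fix l v assume l: "l \<in> X"
          show "int (lookup (single y 1 + m) v) = int (lookup n v) + (if l = i then 1 else if l = j then - 1 else 0)"
            if v: "v \<in> A l"
          proof (cases "l = i \<or> l = j")
            case False
            then have "v \<notin> A i \<union> B i \<union> A j \<union> B j"
              using columns_disjoint[OF col l i, of v] columns_disjoint[OF col l j(1), of v] v by blast
            then show ?thesis using False other by simp
          qed (use vA wA v j(2) in auto)
          show "int (lookup (single y 1 + m) v) = int (lookup n v) - (if l = i then 1 else if l = j then - 1 else 0)"
            if v: "v \<in> B l"
          proof (cases "l = i \<or> l = j")
            case False
            then have "v \<notin> A i \<union> B i \<union> A j \<union> B j"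
              using columns_disjoint(3)[OF col l i, of v] columns_disjoint(3)[OF col l j(1), of v]
                columns_disjoint(1)[OF col i l, of v] columns_disjoint(1)[OF col j(1) l, of v] v by blast
            then show ?thesis using False other by simp
          qed (use vB wB v j(2) in auto)
        next
          fix v assume "v \<notin> support A B X"
          then have "v \<notin> A i \<union> B i \<union> A j \<union> B j" using i j(1) by (auto simp: support_def)
          then show "lookup (single y 1 + m) v = lookup n v" using other by simp
        qed
        moreover have "n \<in> monomials (V - {y})"
        proof -
          have "lookup n y = 0" using vA[OF y] lm[of y] by simp
          moreover have "v \<in> V" if "v \<in> keys n" for v
          proof (cases "v \<in> support A B X")
            case False
            then have "v \<notin> A i \<union> B i \<union> A j \<union> B j" using i j(1) by (auto simp: support_def)
            then have "lookup (single y 1 + m) v \<noteq> 0" using other[of v] that by (simp add: in_keys_iff)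
            then have "v = y \<or> v \<in> keys m" unfolding lm by (auto simp: in_keys_iff split: if_splits)
            then show ?thesis using mV yV by (auto simp: mem_monomials)
          qed (use sup in blast)
          ultimately show ?thesis by (auto simp: monomials_minus_y mem_monomials)
        qed
        ultimately show ?thesis by blast
      qed
      then obtain \<rho> where \<rho>: "\<And>m. m \<in> keys q \<Longrightarrow> ?Y \<subseteq> keys m \<Longrightarrow> \<rho> m \<in> monomials (V - {y})"
        "\<And>m. m \<in> keys q \<Longrightarrow> ?Y \<subseteq> keys m \<Longrightarrow> col_rel A B X (single y 1 + m) (\<rho> m)" by metis
      \<comment> \<open>Only the monomials of \<open>q\<close> divisible by the product over
        \<open>?Y\<close> are rewritten. The coefficient sums over the others vanish already for the
        columns \<open>?X\<close>, so they are left out of \<open>r\<close>.\<close>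
      define M where "M = keys q \<inter> {m. ?Y \<subseteq> keys m}"
      define r where "r = (\<Sum>m\<in>M. single (\<rho> m) (lookup q m))"
      have rc: "r \<in> polys (V - {y})"
        unfolding r_def M_def by (intro carrier_sum carrier_single \<rho>(1)) auto
      have "q * Var y - r \<in> toric A B V X {}"
      proof (rule toricI)
        have "q \<in> polys V" "r \<in> polys V"
          using qc rc carrier_mono[of "V - {y}" V] by blast+
        then show "q * Var y - r \<in> polys V"
          using carrier_Var[OF yV] by (intro carrier_diff carrier_mult)
        fix S assume S: "saturated A B X S"
        let ?T = "{m. single y 1 + m \<in> S}"
        have "zsum r S = (\<Sum>m\<in>M. if m \<in> ?T then lookup q m else 0)"
          unfolding r_def zsum_sum zsum_single
          by (rule sum.cong) (use saturatedD[OF S \<rho>(2)] in \<open>auto simp: M_def\<close>)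
        also have "\<dots> = zsum q (?T \<inter> {m. ?Y \<subseteq> keys m})"
          unfolding zsum_def M_def by (subst sum.inter_restrict[symmetric]) (auto intro: sum.cong)
        finally have r: "zsum r S = zsum q (?T \<inter> {m. ?Y \<subseteq> keys m})" .
        have "saturated A B ?X ?T"
          using saturated_translate[OF S] by (rule saturated_mono[OF col, rotated]) blast
        then have "zsum q (?T \<inter> {m. \<not> ?Y \<subseteq> keys m}) = 0" by (rule qs)
        moreover have "zsum q ?T = zsum q (?T \<inter> {m. ?Y \<subseteq> keys m}) + zsum q (?T \<inter> {m. \<not> ?Y \<subseteq> keys m})"
        proof -
          have T: "?T = (?T \<inter> {m. ?Y \<subseteq> keys m}) \<union> (?T \<inter> {m. \<not> ?Y \<subseteq> keys m})" by blast
          show ?thesis by (subst T, rule zsum_Un_disjoint) blast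
        qed
        ultimately show "zsum (q * Var y - r) S = 0" by (simp add: zsum_diff zsum_mult_Var r)
      qed
      then show "\<exists>r\<in>polys (V - {y}). q * Var y - r \<in> toric A B V X {}" using rc by blast
    qed
  qed
qed

section \<open>The toric ideal of a bouquet of odd cycles\<close>

lemma prod_Var: "(\<Prod>x\<in>e. Var x) = (single (squarefree_monom e) 1 :: ('v, 'k::field) mpoly)"
  by (induction e rule: infinite_finite_induct) (simp_all add: squarefree_monom_def Var_def mult_single)

lemma single_one_power:
  "single a (1 :: 'k::field) ^ n = single (\<Sum>k<n. a :: 'v monom) 1"
  by (induction n) (simp_all add: mult_single add.commute)

lemma prod_single_one: "(\<Prod>i\<in>F. single (a i) (1 :: 'k::field)) = single (\<Sum>i\<in>F. a i :: 'v monom) 1"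
  by (induction F rule: infinite_finite_induct) (simp_all add: mult_single)

text \<open>The exponent vector of the image of \<open>m\<close>; the multiple of an edge is written
  as repeated addition to match the power in \<open>substitute\<close>.\<close>

definition edge_monom :: "'a set monom \<Rightarrow> 'a monom" where
  "edge_monom m = (\<Sum>e\<in>keys m. \<Sum>k<lookup m e. squarefree_monom e)"

text \<open>The homomorphism sends monomials to monomials, so each coefficient of the image collects
  the coefficients over one fibre.\<close>

lemma toric_ideal_eq_fibre_sums:
  "(toric_ideal V E :: ('a set, 'k::field) mpoly set) =
     {f \<in> polys E. \<forall>\<mu>. zsum f {m. edge_monom m = \<mu>} = 0}"
proof -
  have "substitute (\<lambda>e. \<Prod>x\<in>e. Var x) f = lin (\<lambda>m. if True then single (edge_monom m) 1 else 0) f"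
    for f :: "('a set, 'k) mpoly"
    by (simp add: substitute_def lin_def Const_def prod_Var single_one_power prod_single_one edge_monom_def)
  moreover have "g = 0 \<longleftrightarrow> (\<forall>\<mu>. lookup g \<mu> = 0)" for g :: "('a, 'k) mpoly"
    by (simp add: poly_mapping_eq_iff fun_eq_iff)
  ultimately have "substitute (\<lambda>e. \<Prod>x\<in>e. Var x) f = 0 \<longleftrightarrow> (\<forall>\<mu>. zsum f {m. edge_monom m = \<mu>} = 0)"
    for f :: "('a set, 'k) mpoly"
    by (simp only: lookup_lin_fibre simp_thms)
  then show ?thesis
    by (simp add: toric_ideal_def a_kernel_def')
qed

lemma lookup_edge_monom:
  assumes "finite E" "\<And>e. e \<in> E \<Longrightarrow> finite e" "m \<in> monomials E"
  shows "lookup (edge_monom m) x = (\<Sum>e\<in>E. if x \<in> e then lookup m e else 0)"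
proof -
  have "lookup (edge_monom m) x = (\<Sum>e\<in>keys m. if x \<in> e then lookup m e else 0)"
    unfolding edge_monom_def lookup_sum using assms(2,3)
    by (intro sum.cong) (auto simp: lookup_squarefree_monom mem_monomials subset_iff)
  also have "\<dots> = (\<Sum>e\<in>E. if x \<in> e then lookup m e else 0)"
    by (rule sum.mono_neutral_left) (use assms in \<open>auto simp: mem_monomials in_keys_iff\<close>)
  finally show ?thesis .
qed

section \<open>The columns given by the cycles\<close>

definition odd_edges :: "(nat \<Rightarrow> nat) \<Rightarrow> nat \<Rightarrow> vertex set set" where
  "odd_edges t i = G_edge t i ` {j \<in> {1..2 * t i + 1}. odd j}"

definition even_edges :: "(nat \<Rightarrow> nat) \<Rightarrow> nat \<Rightarrow> vertex set set" where
  "even_edges t i = G_edge t i ` {j \<in> {1..2 * t i + 1}. even j}"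

lemma G_edge_inject:
  assumes "t i \<ge> 1" "t i' \<ge> 1" "j \<in> {1..2 * t i + 1}" "j' \<in> {1..2 * t i' + 1}"
    and "G_edge t i j = G_edge t i' j'"
  shows "i = i' \<and> j = j'"
  using assms by (auto simp: G_edge_def doubleton_eq_iff split: if_splits)

lemma Outer_mem_G_edge:
  assumes "t i \<ge> 1" "j \<in> {1..2 * t i + 1}"
  shows "Outer i' k \<in> G_edge t i j \<longleftrightarrow> i' = i \<and> k \<in> {1..2 * t i} \<and> (j = k \<or> j = k + 1)"
  using assms by (auto simp: G_edge_def split: if_splits)

lemma Center_mem_G_edge:
  assumes "t i \<ge> 1" "j \<in> {1..2 * t i + 1}"
  shows "Center \<in> G_edge t i j \<longleftrightarrow> j = 1 \<or> j = 2 * t i + 1"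
  using assms by (auto simp: G_edge_def split: if_splits)

lemma columns_G:
  assumes t: "\<forall>i\<in>{1..s}. t i \<ge> 1"
  shows "columns (odd_edges t) (even_edges t) {1..s}"
    and "support (odd_edges t) (even_edges t) {1..s} = G_edges s t"
proof -
  have ne: "odd_edges t i \<noteq> {} \<and> even_edges t i \<noteq> {}" if "i \<in> {1..s}" for i
  proof -
    have "G_edge t i 1 \<in> odd_edges t i" unfolding odd_edges_def by (rule imageI) simp
    moreover have "G_edge t i 2 \<in> even_edges t i"
      unfolding even_edges_def using t that by (intro imageI) fastforce
    ultimately show ?thesis by blast
  qed
  have inj: "i = i' \<and> j = j'" if "i \<in> {1..s}" "i' \<in> {1..s}" "j \<in> {1..2 * t i + 1}" "j' \<in> {1..2 * t i' + 1}"
    "G_edge t i j = G_edge t i' j'" for i i' j j'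
    using that t by (intro G_edge_inject) auto
  have "odd_edges t i \<inter> even_edges t j = {} \<and>
      (i \<noteq> j \<longrightarrow> odd_edges t i \<inter> odd_edges t j = {} \<and> even_edges t i \<inter> even_edges t j = {})"
    if "i \<in> {1..s}" "j \<in> {1..s}" for i j
    using inj[OF that] unfolding odd_edges_def even_edges_def by blast
  moreover have "finite (odd_edges t i) \<and> finite (even_edges t i)" for i
    by (simp add: odd_edges_def even_edges_def)
  ultimately show "columns (odd_edges t) (even_edges t) {1..s}"
    using ne unfolding columns_def by simp
  show "support (odd_edges t) (even_edges t) {1..s} = G_edges s t"
    unfolding support_def odd_edges_def even_edges_def G_edges_def by blast
qed

lemma sum_two_deltas:
  fixes f :: "nat \<Rightarrow> nat"
  assumes "finite S" "a \<in> S" "b \<in> S" "a \<noteq> b"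
  shows "(\<Sum>j\<in>S. if j = a \<or> j = b then f j else 0) = f a + f b"
proof -
  have "(\<Sum>j\<in>S. if j = a \<or> j = b then f j else 0) = (\<Sum>j\<in>S. if j \<in> {a, b} then f j else 0)"
    by (rule sum.cong) auto
  also have "\<dots> = sum f (S \<inter> {a, b})"
    by (rule sum.inter_restrict[symmetric]) (rule assms(1))
  also have "S \<inter> {a, b} = {a, b}" using assms by blast
  finally show ?thesis using assms(4) by simp
qed

text \<open>The exponent of a vertex is the sum over its incident edges: two at an outer vertex, and
  the first and last edge of every cycle at the center.\<close>

lemma lookup_edge_monom_G:
  assumes t: "\<forall>i\<in>{1..s}. t i \<ge> 1" and m: "m \<in> monomials (G_edges s t)"
  shows "i \<in> {1..s} \<Longrightarrow> k \<in> {1..2 * t i} \<Longrightarrow>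
      lookup (edge_monom m) (Outer i k) = lookup m (G_edge t i k) + lookup m (G_edge t i (k + 1))"
    and "i \<notin> {1..s} \<or> k \<notin> {1..2 * t i} \<Longrightarrow> lookup (edge_monom m) (Outer i k) = 0"
    and "lookup (edge_monom m) Center =
      (\<Sum>i\<in>{1..s}. lookup m (G_edge t i 1) + lookup m (G_edge t i (2 * t i + 1)))"
proof -
  let ?P = "SIGMA i:{1..s}. {1..2 * t i + 1}"
  have E: "G_edges s t = (\<lambda>(i, j). G_edge t i j) ` ?P"
    unfolding G_edges_def by force
  have inj: "inj_on (\<lambda>(i, j). G_edge t i j) ?P"
    using t by (intro inj_onI) (auto dest!: G_edge_inject[rotated 4])
  have "simple_graph (G_vertices s t) (G_edges s t)" by (rule simple_graph_G[OF t])
  then have fin: "finite e" if "e \<in> G_edges s t" for e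
    using that unfolding simple_graph_def by (metis card.infinite zero_neq_numeral)
  have finE: "finite (G_edges s t)" unfolding E by simp
  have sum: "lookup (edge_monom m) x =
      (\<Sum>i\<in>{1..s}. \<Sum>j\<in>{1..2 * t i + 1}. if x \<in> G_edge t i j then lookup m (G_edge t i j) else 0)" for x
  proof -
    have "lookup (edge_monom m) x = (\<Sum>e\<in>G_edges s t. if x \<in> e then lookup m e else 0)"
      by (rule lookup_edge_monom[OF finE fin m])
    also have "\<dots> = (\<Sum>(i, j)\<in>?P. if x \<in> G_edge t i j then lookup m (G_edge t i j) else 0)"
      unfolding E sum.reindex[OF inj] by (rule sum.cong) auto
    also have "\<dots> = (\<Sum>i\<in>{1..s}. \<Sum>j\<in>{1..2 * t i + 1}. if x \<in> G_edge t i j then lookup m (G_edge t i j) else 0)"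
      by (rule sum.Sigma[symmetric]) auto
    finally show ?thesis .
  qed
  show "lookup (edge_monom m) (Outer i k) = lookup m (G_edge t i k) + lookup m (G_edge t i (k + 1))"
    if i: "i \<in> {1..s}" and k: "k \<in> {1..2 * t i}"
  proof -
    have "(\<Sum>j\<in>{1..2 * t i' + 1}. if Outer i k \<in> G_edge t i' j then lookup m (G_edge t i' j) else 0) =
        (if i' = i then lookup m (G_edge t i k) + lookup m (G_edge t i (k + 1)) else 0)" if i': "i' \<in> {1..s}" for i'
    proof (cases "i' = i")
      case True
      have "(\<Sum>j\<in>{1..2 * t i' + 1}. if Outer i k \<in> G_edge t i' j then lookup m (G_edge t i' j) else 0) =
          (\<Sum>j\<in>{1..2 * t i + 1}. if j = k \<or> j = k + 1 then lookup m (G_edge t i j) else 0)"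
        unfolding True using k t i Outer_mem_G_edge[of t i _ i k] by (intro sum.cong) auto
      also have "\<dots> = lookup m (G_edge t i k) + lookup m (G_edge t i (k + 1))"
        using k by (intro sum_two_deltas) auto
      finally show ?thesis using True by simp
    next
      case False
      then show ?thesis using t i' Outer_mem_G_edge[of t i' _ i k] by (auto intro!: sum.neutral)
    qed
    then have "lookup (edge_monom m) (Outer i k) =
        (\<Sum>i'\<in>{1..s}. if i' = i then lookup m (G_edge t i k) + lookup m (G_edge t i (k + 1)) else 0)"
      unfolding sum by (rule sum.cong[OF refl])
    then show ?thesis using i by simp
  qed
  show "lookup (edge_monom m) (Outer i k) = 0" if "i \<notin> {1..s} \<or> k \<notin> {1..2 * t i}"
    unfolding sum using that t by (intro sum.neutral ballI) (auto simp: Outer_mem_G_edge)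
  have "(\<Sum>j\<in>{1..2 * t i + 1}. if Center \<in> G_edge t i j then lookup m (G_edge t i j) else 0) =
      lookup m (G_edge t i 1) + lookup m (G_edge t i (2 * t i + 1))" if i: "i \<in> {1..s}" for i
  proof -
    have ti: "t i \<ge> 1" using t i by blast
    have "(\<Sum>j\<in>{1..2 * t i + 1}. if Center \<in> G_edge t i j then lookup m (G_edge t i j) else 0) =
        (\<Sum>j\<in>{1..2 * t i + 1}. if j = 1 \<or> j = 2 * t i + 1 then lookup m (G_edge t i j) else 0)"
      using Center_mem_G_edge[of t i, OF ti] by (intro sum.cong) auto
    also have "\<dots> = lookup m (G_edge t i 1) + lookup m (G_edge t i (2 * t i + 1))"
      using ti by (intro sum_two_deltas) auto
    finally show ?thesis .
  qed
  then show "lookup (edge_monom m) Center =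
      (\<Sum>i\<in>{1..s}. lookup m (G_edge t i 1) + lookup m (G_edge t i (2 * t i + 1)))"
    unfolding sum by (rule sum.cong[OF refl])
qed

text \<open>The outer vertices correspond to the alternation of the shift along each cycle, the
  center to the condition on the sum of the shifts.\<close>

lemma edge_monom_eq_iff_col_rel:
  assumes t: "\<forall>i\<in>{1..s}. t i \<ge> 1"
    and m: "m \<in> monomials (G_edges s t)" and n: "n \<in> monomials (G_edges s t)"
  shows "edge_monom m = edge_monom n \<longleftrightarrow> col_rel (odd_edges t) (even_edges t) {1..s} m n"
proof
  note em = lookup_edge_monom_G[OF t m] and en = lookup_edge_monom_G[OF t n]
  define d where "d i j = int (lookup m (G_edge t i j)) - int (lookup n (G_edge t i j))" for i j
  assume eq: "edge_monom m = edge_monom n"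
  have alt: "d i (k + 1) = - d i k" if "i \<in> {1..s}" "k \<in> {1..2 * t i}" for i k
  proof -
    have "lookup m (G_edge t i k) + lookup m (G_edge t i (k + 1)) =
        lookup n (G_edge t i k) + lookup n (G_edge t i (k + 1))"
      using em(1)[OF that] en(1)[OF that] eq by simp
    then show ?thesis unfolding d_def by linarith
  qed
  have dj: "d i (Suc l) = (if even l then d i 1 else - d i 1)" if "i \<in> {1..s}" "l \<le> 2 * t i" for i l
    using that(2)
  proof (induction l)
    case (Suc l)
    then show ?case using alt[OF that(1), of "Suc l"] by auto
  qed simp
  have d_odd: "d i j = d i 1" if "i \<in> {1..s}" "j \<in> {1..2 * t i + 1}" "odd j" for i j
    using dj[OF that(1), of "j - 1"] that by auto
  have d_even: "d i j = - d i 1" if "i \<in> {1..s}" "j \<in> {1..2 * t i + 1}" "even j" for i j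
    using dj[OF that(1), of "j - 1"] that by auto
  show "col_rel (odd_edges t) (even_edges t) {1..s} m n"
  proof (rule col_relI[where c = "\<lambda>i. d i 1"])
    \<comment> \<open>\<open>2 * t i + 1\<close> is odd, so both edges of a cycle at the center
      carry the same difference; the factor 2 is cancelled among integers.\<close>
    have "(\<Sum>i\<in>{1..s}. 2 * d i 1) = (\<Sum>i\<in>{1..s}. d i 1 + d i (2 * t i + 1))"
    proof (rule sum.cong)
      fix i assume "i \<in> {1..s}"
      then show "2 * d i 1 = d i 1 + d i (2 * t i + 1)" using d_odd[of i "2 * t i + 1"] by simp
    qed simp
    also have "\<dots> = int (lookup (edge_monom m) Center) - int (lookup (edge_monom n) Center)"
      unfolding em(3) en(3) d_def by (simp add: sum.distrib sum_subtractf)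
    also have "\<dots> = 0" by (simp add: eq)
    finally show "(\<Sum>i\<in>{1..s}. d i 1) = 0" by (simp flip: sum_distrib_left)
    fix i e assume i: "i \<in> {1..s}"
    show "int (lookup m e) = int (lookup n e) + d i 1" if e: "e \<in> odd_edges t i"
    proof -
      obtain j where j: "e = G_edge t i j" "j \<in> {1..2 * t i + 1}" "odd j"
        using e unfolding odd_edges_def by blast
      have "int (lookup m e) - int (lookup n e) = d i 1"
        using d_odd[OF i j(2,3)] unfolding j(1) d_def .
      then show ?thesis by simp
    qed
    show "int (lookup m e) = int (lookup n e) - d i 1" if e: "e \<in> even_edges t i"
    proof -
      obtain j where j: "e = G_edge t i j" "j \<in> {1..2 * t i + 1}" "even j"
        using e unfolding even_edges_def by blast
      have "int (lookup m e) - int (lookup n e) = - d i 1"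
        using d_even[OF i j(2,3)] unfolding j(1) d_def .
      then show ?thesis by simp
    qed
  next
    fix e assume "e \<notin> support (odd_edges t) (even_edges t) {1..s}"
    then have "e \<notin> G_edges s t" by (simp only: columns_G(2)[OF t] not_False_eq_True)
    then have "e \<notin> keys m" "e \<notin> keys n" using m n by (auto simp: mem_monomials)
    then show "lookup m e = lookup n e" by (simp add: in_keys_iff)
  qed
next
  note em = lookup_edge_monom_G[OF t m] and en = lookup_edge_monom_G[OF t n]
  assume "col_rel (odd_edges t) (even_edges t) {1..s} m n"
  then obtain c where "col_shift (odd_edges t) (even_edges t) {1..s} c m n" unfolding col_rel_def by blast
  note c = col_shiftD[OF this]
  have mj: "int (lookup m (G_edge t i j)) = int (lookup n (G_edge t i j)) + (if odd j then c i else - c i)"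
    if "i \<in> {1..s}" "j \<in> {1..2 * t i + 1}" for i j
    using c(2,3)[OF that(1), of "G_edge t i j"] that(2) by (auto simp: odd_edges_def even_edges_def)
  show "edge_monom m = edge_monom n"
  proof (rule poly_mapping_eqI)
    fix x
    show "lookup (edge_monom m) x = lookup (edge_monom n) x"
    proof (cases x)
      case Center
      have "int (lookup (edge_monom m) Center) =
          (\<Sum>i\<in>{1..s}. int (lookup n (G_edge t i 1)) + int (lookup n (G_edge t i (2 * t i + 1))) + 2 * c i)"
        unfolding em(3) of_nat_sum by (rule sum.cong) (auto simp: mj)
      also have "\<dots> = int (lookup (edge_monom n) Center) + 2 * (\<Sum>i\<in>{1..s}. c i)"
        unfolding en(3) by (simp add: sum.distrib sum_distrib_left)
      finally show ?thesis using c(1) Center by simp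
    next
      case (Outer i k)
      show ?thesis
      proof (cases "i \<in> {1..s} \<and> k \<in> {1..2 * t i}")
        case True
        then have "int (lookup m (G_edge t i k) + lookup m (G_edge t i (k + 1))) =
            int (lookup n (G_edge t i k) + lookup n (G_edge t i (k + 1)))"
          using mj[of i k] mj[of i "k + 1"] by auto
        then show ?thesis using True em(1) en(1) Outer by auto
      qed (use em(2) en(2) Outer in auto)
    qed
  qed
qed

theorem theorem1p1:
  fixes s :: nat and t :: "nat \<Rightarrow> nat"
  assumes "s \<ge> 1"
    and "\<forall>i\<in>{1..s}. t i \<ge> 1"
  shows "GVD (G_edges s t)
           (toric_ideal (G_vertices s t) (G_edges s t) :: (vertex set, 'k::field) mpoly set)"
proof -
  let ?A = "odd_edges t" and ?B = "even_edges t" and ?E = "G_edges s t"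
  note col = columns_G[OF assms(2)]
  have "?E = (\<Union>i\<in>{1..s}. G_edge t i ` {1..2 * t i + 1})" unfolding G_edges_def by blast
  then have "finite ?E" by simp
  moreover have "(toric ?A ?B ?E {1..s} {} :: (vertex set, 'k) mpoly set) =
      {f \<in> polys ?E. \<forall>\<mu>. zsum f {m. keys m \<inter> {} = {} \<and> edge_monom m = \<mu>} = 0}"
    by (rule toric_eq_fibre_sums) (rule edge_monom_eq_iff_col_rel[OF assms(2)])
  then have "toric_ideal (G_vertices s t) ?E = (toric ?A ?B ?E {1..s} {} :: (vertex set, 'k) mpoly set)"
    by (simp add: toric_ideal_eq_fibre_sums)
  ultimately show ?thesis
    using GVD_toric[OF _ col(1), of ?E] col(2) by simp
qed

end
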